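(* Let $M$ be a $6$-manifold equipped with an $\mathrm{SU}(3)$-structure $(\Omega,\Upsilon)$ with torsion forms $\tau_0,\widehat\tau_0,\tau_2,\widehat\tau_2,\tau_3,\tau_4,\tau_5$, let $\theta\in[0,2\pi)$, and let $\Sigma\subset M$ be an immersed special Lagrangian $3$-fold of phase $\theta$. Then at each point of $\Sigma$ the mean curvature vector $H$ of $\Sigma$ is given by $$H=-\tfrac{1}{\sqrt2}\cos(\theta)\,[(\tau_2)_1]^\natural-\tfrac{1}{\sqrt2}\sin(\theta)\,[(\widehat\tau_2)_1]^\natural+\sin(\tfrac{\theta}{3})\,[(\tau_5)_{\mathsf T}]^\S-\cos(\tfrac{\theta}{3})\,[J(\tau_5)_{\mathsf N}]^\S ,$$ where the refined torsion forms are taken relative to the splitting $T_x^*M=\mathsf T\oplus\mathsf N$ determined by $\mathsf T^\sharp=e^{-i\theta/3}\cdot T_x\Sigma$. In particular, the largest torsion class of $\mathrm{SU}(3)$-structures for which every special Lagrangian $3$-fold (of every phase) is a minimal submanifold is $X_0^+\oplus X_0^-\oplus X_3\oplus X_4$, i.e. the class defined by $\tau_2=\widehat\tau_2=\tau_5=0$.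
   Context: **Linear model.** On $V=\mathbb R^6$ with standard orthonormal basis $e_1,\dots,e_6$ and dual basis $e^1,\dots,e^6$, write $e^{ij}=e^i\wedge e^j$, etc. Let $J_0e_p=e_{p+3}$, $J_0 e_{p+3}=-e_p$ ($p=1,2,3$), $\Omega_0=e^{14}+e^{25}+e^{36}$, $\Upsilon_0=(e^1+ie^4)\wedge(e^2+ie^5)\wedge(e^3+ie^6)$. Forms $\Lambda^k(V^* )$ carry the inner product for which $\{e^I: I \text{ increasing}\}$ is orthonormal. **$\mathrm{SU}(3)$-structures.** An $\mathrm{SU}(3)$-structure on an oriented $6$-manifold $M$ is a pair $(\Omega,\Upsilon)\in\Omega^2(M)\oplus\Omega^3(M;\mathbb C)$ such that at each $x\in M$ there is a linear isomorphism $u:T_xM\to\mathbb R^6$ with $\Omega|_x=u^*\Omega_0$, $\Upsilon|_x=u^*\Upsilon_0$. It induces a Riemannian metric $g$ and an almost complex structure $J$ on $M$ (pull back the standard inner product and $J_0$ by any such $u$). A complex number $a+ib$ acts on $T_xM$ by $a\,\mathrm{Id}+bJ$. **Torsion forms.** Let $\Lambda^2_8=\{\beta\in\Lambda^2: \beta\wedge\mathrm{Re}\Upsilon=0,\ \beta\wedge\Omega^2=0\}$ and $\Lambda^3_{12}=\{\gamma\in\Lambda^3:\gamma\wedge\Omega=0,\ \gamma\wedge\mathrm{Re}\Upsilon=\gamma\wedge\mathrm{Im}\Upsilon=0\}$. The torsion forms are the unique $\tau_0,\widehat\tau_0\in\Gamma(\Lambda^0)$, $\tau_2,\widehat\tau_2\in\Gamma(\Lambda^2_8)$,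 $\tau_3\in\Gamma(\Lambda^3_{12})$, $\tau_4,\tau_5\in\Gamma(\Lambda^1)$ with $$d\Omega=3\tau_0\mathrm{Re}\Upsilon+3\widehat\tau_0\mathrm{Im}\Upsilon+\tau_3+\tau_4\wedge\Omega,$$ $$d\,\mathrm{Re}\Upsilon=2\widehat\tau_0\Omega^2+\tau_5\wedge\mathrm{Re}\Upsilon+\tau_2\wedge\Omega,$$ $$d\,\mathrm{Im}\Upsilon=-2\tau_0\Omega^2+(\tau_5\circ J)\wedge\mathrm{Re}\Upsilon+\widehat\tau_2\wedge\Omega.$$ **Torsion classes.** Let $X_0^+,X_0^-,X_2^+,X_2^-,X_3,X_4,X_5$ denote the bundles $\Lambda^0,\Lambda^0,\Lambda^2_8,\Lambda^2_8,\Lambda^3_{12},\Lambda^1,\Lambda^1$ in which $\tau_0,\widehat\tau_0,\tau_2,\widehat\tau_2,\tau_3,\tau_4,\tau_5$ respectively take values. A torsion class is a direct sum of some subset of these seven bundles; an $\mathrm{SU}(3)$-structure belongs to it if and only if the torsion forms corresponding to the omitted summands vanish identically. "Largest" is with respect to inclusion, among torsion classes such that for every $\mathrm{SU}(3)$-structure in the class every special Lagrangian $3$-fold of every phase is minimal. **Special Lagrangians.** A $3$-plane $E\subset T_xM$ is special Lagrangian of phase $\theta$ if $\Omega|_E=0$ and $\mathrm{Im}(e^{-i\theta}\Upsilon)|_E=0$ (equivalently $\mathrm{Re}(e^{-i\theta}\Upsilon)=\pm1$ on orthonormal bases of $E$). A special Lagrangian $3$-fold of phase $\theta$ is an immersed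 $3$-dimensional submanifold $\Sigma$ all of whose tangent spaces are special Lagrangian of phase $\theta$. Its mean curvature vector $H$ is the trace of the second fundamental form; $\Sigma$ is minimal if $H=0$. **Refined torsion forms.** For $x\in\Sigma$, the plane $\mathsf T^\sharp:=e^{-i\theta/3}\cdot T_x\Sigma$ is special Lagrangian of phase $0$; let $\mathsf N^\sharp$ be its orthogonal complement. Choose a basis $e_1,\dots,e_6$ of $T_xM$ identifying $(\Omega|_x,\Upsilon|_x)$ with $(\Omega_0,\Upsilon_0)$ and with $\mathsf T^\sharp=\mathrm{span}(e_1,e_2,e_3)$, $\mathsf N^\sharp=\mathrm{span}(e_4,e_5,e_6)$; dually $\mathsf T=\mathrm{span}(e^1,e^2,e^3)$, $\mathsf N=\mathrm{span}(e^4,e^5,e^6)$. Put $$\Gamma_1=-e^{23}-e^{56},\quad \Gamma_2=-e^{31}-e^{64},\quad \Gamma_3=-e^{12}-e^{45},\qquad (\Lambda^2_8)_1=\mathrm{span}(\Gamma_1,\Gamma_2,\Gamma_3)\subset\Lambda^2_8 .$$ Then $(\tau_2)_1,(\widehat\tau_2)_1$ are the orthogonal projections of $\tau_2,\widehat\tau_2$ to $(\Lambda^2_8)_1$ and $(\tau_5)_{\mathsf T},(\tau_5)_{\mathsf N}$ are the components of $\tau_5$ in $\mathsf T,\mathsf N$. In the formula, $J(\tau_5)_{\mathsf N}:=(\tau_5)_{\mathsf N}\circ J\in\mathsf T$, so that $Je^{p+3}=e^p$. **Isomorphisms.** Let $w_p(\theta)=-\sin(\frac\theta3)e_p+\cos(\frac\theta3)e_{p+3}$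 for $p=1,2,3$, a basis of the normal space $(T_x\Sigma)^\perp=e^{i\theta/3}\cdot\mathsf N^\sharp$. The linear isometries $\natural:(\Lambda^2_8)_1\to(T_x\Sigma)^\perp$ and $\S:\mathsf T\to(T_x\Sigma)^\perp$ are determined by $(\Gamma_p)^\natural=\sqrt2\,w_p(\theta)$ and $(e^p)^\S=w_p(\theta)$. *)

theory Defs
  imports "HOL-Analysis.Analysis"
begin

section \<open>Exterior algebra\<close>

text \<open>A k-form on a vector space is a function on argument lists that is multilinear and alternating
  on lists of length k and vanishes on lists of every other length.\<close>

type_synonym ('v, 's) form = "'v list \<Rightarrow> 's"

definition alt_form :: "nat \<Rightarrow> ('v::real_vector, 's::real_vector) form \<Rightarrow> bool" where
  "alt_form k \<omega> \<longleftrightarrow>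
     (\<forall>vs. length vs \<noteq> k \<longrightarrow> \<omega> vs = 0) \<and>
     (\<forall>vs i. length vs = k \<longrightarrow> i < k \<longrightarrow> linear (\<lambda>v. \<omega> (vs[i := v]))) \<and>
     (\<forall>vs i j. length vs = k \<longrightarrow> i < j \<longrightarrow> j < k \<longrightarrow> vs ! i = vs ! j \<longrightarrow> \<omega> vs = 0)"

text \<open>The exterior product as a signed sum over shuffles, normalised so that
  (e1 wedge e2)[e1, e2] = 1. A shuffle is given by the set I of argument positions
  handed to the first factor, and its sign counts the inversions.  No degrees are needed, because
  forms vanish on lists of the wrong length.\<close>

definition wedge :: "('v, 's::comm_ring_1) form \<Rightarrow> ('v, 's) form \<Rightarrow> ('v, 's) form"
    (infixr "\<and>\<^sub>w" 75) where
  "(\<alpha> \<and>\<^sub>w \<beta>) vs =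
     (\<Sum>I\<in>Pow {..<length vs}.
        (-1) ^ card {(i, j). i \<in> I \<and> j \<in> {..<length vs} - I \<and> j < i}
        * \<alpha> (nths vs I) * \<beta> (nths vs (- I)))"

definition pullback :: "('v \<Rightarrow> 'w) \<Rightarrow> ('w, 's) form \<Rightarrow> ('v, 's) form" where
  "pullback u \<omega> = (\<lambda>vs. \<omega> (map u vs))"

definition Re_form :: "('v, complex) form \<Rightarrow> ('v, real) form" where
  "Re_form \<omega> = (\<lambda>vs. Re (\<omega> vs))"

definition Im_form :: "('v, complex) form \<Rightarrow> ('v, real) form" where
  "Im_form \<omega> = (\<lambda>vs. Im (\<omega> vs))"


section \<open>The linear model\<close>

text \<open>In the index type 6 the numeral 6 denotes 0, so the indices 1, ..., 6 are pairwise distinct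
  and exhaust the type.\<close>

definition covec :: "6 \<Rightarrow> (real^6, real) form" where
  "covec i vs = (if length vs = 1 then hd vs $ i else 0)"

definition zcovec :: "6 \<Rightarrow> (real^6, complex) form" where
  "zcovec p vs = complex_of_real (covec p vs) + \<i> * complex_of_real (covec (p + 3) vs)"

definition J0 :: "real^6 \<Rightarrow> real^6" where
  "J0 v = (\<Sum>p\<in>{1, 2, 3}. (v $ p) *\<^sub>R axis (p + 3) 1 - (v $ (p + 3)) *\<^sub>R axis p 1)"

definition Omega0 :: "(real^6, real) form" where
  "Omega0 vs = (covec 1 \<and>\<^sub>w covec 4) vs + (covec 2 \<and>\<^sub>w covec 5) vs + (covec 3 \<and>\<^sub>w covec 6) vs"

definition Upsilon0 :: "(real^6, complex) form" where
  "Upsilon0 = zcovec 1 \<and>\<^sub>w zcovec 2 \<and>\<^sub>w zcovec 3"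

definition adapted ::
    "(real^6, real) form \<Rightarrow> (real^6, complex) form \<Rightarrow> (real^6 \<Rightarrow> real^6) \<Rightarrow> bool" where
  "adapted \<Omega> \<Upsilon> u \<longleftrightarrow> linear u \<and> bij u \<and> \<Omega> = pullback u Omega0 \<and> \<Upsilon> = pullback u Upsilon0"

text \<open>The induced inner product and complex structure do not depend on the chosen isomorphism, since
  the stabiliser of the model pair is SU(3).\<close>

definition some_adapted ::
    "(real^6, real) form \<Rightarrow> (real^6, complex) form \<Rightarrow> real^6 \<Rightarrow> real^6" where
  "some_adapted \<Omega> \<Upsilon> = (SOME u. adapted \<Omega> \<Upsilon> u)"

definition su3_metric ::
    "(real^6, real) form \<Rightarrow> (real^6, complex) form \<Rightarrow> real^6 \<Rightarrow> real^6 \<Rightarrow> real" where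
  "su3_metric \<Omega> \<Upsilon> v w = some_adapted \<Omega> \<Upsilon> v \<bullet> some_adapted \<Omega> \<Upsilon> w"

definition su3_J :: "(real^6, real) form \<Rightarrow> (real^6, complex) form \<Rightarrow> real^6 \<Rightarrow> real^6" where
  "su3_J \<Omega> \<Upsilon> v = inv (some_adapted \<Omega> \<Upsilon>) (J0 (some_adapted \<Omega> \<Upsilon> v))"

definition complex_act ::
    "(real^6, real) form \<Rightarrow> (real^6, complex) form \<Rightarrow> complex \<Rightarrow> real^6 \<Rightarrow> real^6" where
  "complex_act \<Omega> \<Upsilon> z v = Re z *\<^sub>R v + Im z *\<^sub>R su3_J \<Omega> \<Upsilon> v"

definition Lambda28 ::
    "(real^6, real) form \<Rightarrow> (real^6, complex) form \<Rightarrow> (real^6, real) form set" where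
  "Lambda28 \<Omega> \<Upsilon> = {\<beta>. alt_form 2 \<beta> \<and>
     (\<forall>vs. (\<beta> \<and>\<^sub>w Re_form \<Upsilon>) vs = 0) \<and> (\<forall>vs. (\<beta> \<and>\<^sub>w \<Omega> \<and>\<^sub>w \<Omega>) vs = 0)}"

definition Lambda312 ::
    "(real^6, real) form \<Rightarrow> (real^6, complex) form \<Rightarrow> (real^6, real) form set" where
  "Lambda312 \<Omega> \<Upsilon> = {\<gamma>. alt_form 3 \<gamma> \<and> (\<forall>vs. (\<gamma> \<and>\<^sub>w \<Omega>) vs = 0) \<and>
     (\<forall>vs. (\<gamma> \<and>\<^sub>w Re_form \<Upsilon>) vs = 0) \<and> (\<forall>vs. (\<gamma> \<and>\<^sub>w Im_form \<Upsilon>) vs = 0)}"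

definition sl_plane ::
    "(real^6, real) form \<Rightarrow> (real^6, complex) form \<Rightarrow> real \<Rightarrow> (real^6) set \<Rightarrow> bool" where
  "sl_plane \<Omega> \<Upsilon> \<theta> E \<longleftrightarrow> subspace E \<and> dim E = 3 \<and>
     (\<forall>v\<in>E. \<forall>w\<in>E. \<Omega> [v, w] = 0) \<and>
     (\<forall>v\<in>E. \<forall>w\<in>E. \<forall>z\<in>E. Im (cis (- \<theta>) * \<Upsilon> [v, w, z]) = 0)"


section \<open>Smooth manifolds and differential forms\<close>

fun Ck_on :: "nat \<Rightarrow> 'x::real_normed_vector set \<Rightarrow> ('x \<Rightarrow> 'y::real_normed_vector) \<Rightarrow> bool" where
  "Ck_on 0 S f \<longleftrightarrow> continuous_on S f"
| "Ck_on (Suc k) S f \<longleftrightarrow>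
     (\<forall>x\<in>S. f differentiable (at x)) \<and> (\<forall>v. Ck_on k S (\<lambda>x. frechet_derivative f (at x) v))"

text \<open>Only meaningful for open sets, since the derivatives are unrestricted.\<close>

definition smooth_on :: "'x::real_normed_vector set \<Rightarrow> ('x \<Rightarrow> 'y::real_normed_vector) \<Rightarrow> bool" where
  "smooth_on S f \<longleftrightarrow> (\<forall>k. Ck_on k S f)"

text \<open>A chart is its domain together with its coordinate map, whose values off the domain are
  irrelevant.  The dimension is the cardinality of the index type.\<close>

type_synonym ('a, 'n) chart = "'a set \<times> ('a \<Rightarrow> real^'n)"

definition chart_img :: "('a, 'n::finite) chart \<Rightarrow> (real^'n) set" where
  "chart_img c = snd c ` fst c"

definition coord_dom :: "('b, 'm::finite) chart \<Rightarrow> ('b \<Rightarrow> 'a) \<Rightarrow> ('a, 'n::finite) chart \<Rightarrow> (real^'m) set" where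
  "coord_dom d f c = snd d ` {p \<in> fst d. f p \<in> fst c}"

definition coord_rep :: "('b, 'm::finite) chart \<Rightarrow> ('b \<Rightarrow> 'a) \<Rightarrow> ('a, 'n::finite) chart \<Rightarrow> real^'m \<Rightarrow> real^'n" where
  "coord_rep d f c = (\<lambda>s. snd c (f (inv_into (fst d) (snd d) s)))"

definition smooth_manifold :: "'a topology \<Rightarrow> ('a, 'n::finite) chart set \<Rightarrow> bool" where
  "smooth_manifold M A \<longleftrightarrow> Hausdorff_space M \<and> second_countable M \<and>
     (\<forall>c\<in>A. openin M (fst c) \<and> open (chart_img c) \<and>
        homeomorphic_map (subtopology M (fst c)) (top_of_set (chart_img c)) (snd c)) \<and>
     (\<Union>c\<in>A. fst c) = topspace M \<and>
     (\<forall>c\<in>A. \<forall>d\<in>A. smooth_on (coord_dom c id d) (coord_rep c id d))"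

definition smooth_map :: "'b topology \<Rightarrow> ('b, 'm::finite) chart set \<Rightarrow>
    'a topology \<Rightarrow> ('a, 'n::finite) chart set \<Rightarrow> ('b \<Rightarrow> 'a) \<Rightarrow> bool" where
  "smooth_map N B M A f \<longleftrightarrow> continuous_map N M f \<and>
     (\<forall>d\<in>B. \<forall>c\<in>A. smooth_on (coord_dom d f c) (coord_rep d f c))"

definition immersion :: "'b topology \<Rightarrow> ('b, 'm::finite) chart set \<Rightarrow>
    'a topology \<Rightarrow> ('a, 'n::finite) chart set \<Rightarrow> ('b \<Rightarrow> 'a) \<Rightarrow> bool" where
  "immersion N B M A f \<longleftrightarrow> smooth_map N B M A f \<and>
     (\<forall>d\<in>B. \<forall>c\<in>A. \<forall>s\<in>coord_dom d f c. inj (frechet_derivative (coord_rep d f c) (at s)))"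

text \<open>A field of forms is given by its coordinate expressions in the charts of the atlas.  Likewise a
  tangent vector at a point is represented, in each chart around that point, by a vector of
  coordinate space.\<close>

type_synonym ('a, 'n, 's) form_field = "('a, 'n) chart \<Rightarrow> real^'n \<Rightarrow> (real^'n, 's) form"

definition diff_form :: "('a, 'n::finite) chart set \<Rightarrow> nat \<Rightarrow>
    ('a, 'n, 's::real_normed_vector) form_field \<Rightarrow> bool" where
  "diff_form A k \<omega> \<longleftrightarrow>
     (\<forall>c\<in>A. (\<forall>y\<in>chart_img c. alt_form k (\<omega> c y)) \<and>
            (\<forall>vs. smooth_on (chart_img c) (\<lambda>y. \<omega> c y vs))) \<and>
     (\<forall>c\<in>A. \<forall>d\<in>A. \<forall>x\<in>fst c \<inter> fst d.
        \<omega> c (snd c x) =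
        pullback (frechet_derivative (coord_rep c id d) (at (snd c x))) (\<omega> d (snd d x)))"

text \<open>The invariant formula for the exterior derivative, evaluated on constant vector fields.\<close>

definition ext_deriv ::
    "(real^'n \<Rightarrow> (real^'n::finite, 's::real_normed_field) form) \<Rightarrow> real^'n \<Rightarrow> (real^'n, 's) form" where
  "ext_deriv \<omega> y vs = (\<Sum>i<length vs.
     (-1) ^ i * frechet_derivative (\<lambda>z. \<omega> z (take i vs @ drop (Suc i) vs)) (at y) (vs ! i))"

definition form_vanishes :: "('a, 'n::finite) chart set \<Rightarrow> ('a, 'n, real) form_field \<Rightarrow> bool" where
  "form_vanishes A \<tau> \<longleftrightarrow> (\<forall>c\<in>A. \<forall>y\<in>chart_img c. \<forall>vs. \<tau> c y vs = 0)"


section \<open>SU(3)-structures and their torsion\<close>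

text \<open>No orientation is part of the data: an SU(3)-structure orients the manifold.\<close>

definition su3_structure ::
    "('a, 6) chart set \<Rightarrow> ('a, 6, real) form_field \<Rightarrow> ('a, 6, complex) form_field \<Rightarrow> bool" where
  "su3_structure A \<Omega> \<Upsilon> \<longleftrightarrow> diff_form A 2 \<Omega> \<and> diff_form A 3 \<Upsilon> \<and>
     (\<forall>c\<in>A. \<forall>y\<in>chart_img c. \<exists>u. adapted (\<Omega> c y) (\<Upsilon> c y) u)"

text \<open>The letter h marks the torsion forms written with a hat.  The value of a 0-form is its value
  on the empty list.\<close>

definition torsion_forms ::
    "('a, 6) chart set \<Rightarrow> ('a, 6, real) form_field \<Rightarrow> ('a, 6, complex) form_field \<Rightarrow>
     ('a, 6, real) form_field \<Rightarrow> ('a, 6, real) form_field \<Rightarrow>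
     ('a, 6, real) form_field \<Rightarrow> ('a, 6, real) form_field \<Rightarrow>
     ('a, 6, real) form_field \<Rightarrow> ('a, 6, real) form_field \<Rightarrow> ('a, 6, real) form_field \<Rightarrow> bool" where
  "torsion_forms A \<Omega> \<Upsilon> \<tau>0 \<tau>0h \<tau>2 \<tau>2h \<tau>3 \<tau>4 \<tau>5 \<longleftrightarrow>
     diff_form A 0 \<tau>0 \<and> diff_form A 0 \<tau>0h \<and> diff_form A 2 \<tau>2 \<and> diff_form A 2 \<tau>2h \<and>
     diff_form A 3 \<tau>3 \<and> diff_form A 1 \<tau>4 \<and> diff_form A 1 \<tau>5 \<and>
     (\<forall>c\<in>A. \<forall>y\<in>chart_img c.
        \<tau>2 c y \<in> Lambda28 (\<Omega> c y) (\<Upsilon> c y) \<and> \<tau>2h c y \<in> Lambda28 (\<Omega> c y) (\<Upsilon> c y) \<and>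
        \<tau>3 c y \<in> Lambda312 (\<Omega> c y) (\<Upsilon> c y) \<and>
        (\<forall>vs. ext_deriv (\<Omega> c) y vs =
           3 * \<tau>0 c y [] * Re_form (\<Upsilon> c y) vs + 3 * \<tau>0h c y [] * Im_form (\<Upsilon> c y) vs
           + \<tau>3 c y vs + (\<tau>4 c y \<and>\<^sub>w \<Omega> c y) vs) \<and>
        (\<forall>vs. ext_deriv (\<lambda>z. Re_form (\<Upsilon> c z)) y vs =
           2 * \<tau>0h c y [] * (\<Omega> c y \<and>\<^sub>w \<Omega> c y) vs + (\<tau>5 c y \<and>\<^sub>w Re_form (\<Upsilon> c y)) vs
           + (\<tau>2 c y \<and>\<^sub>w \<Omega> c y) vs) \<and>
        (\<forall>vs. ext_deriv (\<lambda>z. Im_form (\<Upsilon> c z)) y vs =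
           - 2 * \<tau>0 c y [] * (\<Omega> c y \<and>\<^sub>w \<Omega> c y) vs
           + (pullback (su3_J (\<Omega> c y) (\<Upsilon> c y)) (\<tau>5 c y) \<and>\<^sub>w Re_form (\<Upsilon> c y)) vs
           + (\<tau>2h c y \<and>\<^sub>w \<Omega> c y) vs))"

datatype torsion_component = X0p | X0m | X2p | X2m | X3 | X4 | X5

text \<open>A torsion class is identified with its set of direct summands.\<close>

definition in_torsion_class ::
    "torsion_component set \<Rightarrow> ('a, 6) chart set \<Rightarrow> ('a, 6, real) form_field \<Rightarrow>
     ('a, 6, complex) form_field \<Rightarrow> bool" where
  "in_torsion_class S A \<Omega> \<Upsilon> \<longleftrightarrow> (\<exists>\<tau>0 \<tau>0h \<tau>2 \<tau>2h \<tau>3 \<tau>4 \<tau>5.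
     torsion_forms A \<Omega> \<Upsilon> \<tau>0 \<tau>0h \<tau>2 \<tau>2h \<tau>3 \<tau>4 \<tau>5 \<and>
     (X0p \<notin> S \<longrightarrow> form_vanishes A \<tau>0) \<and> (X0m \<notin> S \<longrightarrow> form_vanishes A \<tau>0h) \<and>
     (X2p \<notin> S \<longrightarrow> form_vanishes A \<tau>2) \<and> (X2m \<notin> S \<longrightarrow> form_vanishes A \<tau>2h) \<and>
     (X3 \<notin> S \<longrightarrow> form_vanishes A \<tau>3) \<and> (X4 \<notin> S \<longrightarrow> form_vanishes A \<tau>4) \<and>
     (X5 \<notin> S \<longrightarrow> form_vanishes A \<tau>5))"


section \<open>Mean curvature\<close>

text \<open>Coordinate expressions: G is a Riemannian metric on an open subset of the ambient coordinate
  space, F an immersion into it from an open subset of the parameter space.\<close>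

text \<open>The covariant derivative of the Levi-Civita connection on constant vector fields, given by the
  Koszul formula.\<close>

definition christoffel ::
    "(real^'n \<Rightarrow> real^'n \<Rightarrow> real^'n \<Rightarrow> real) \<Rightarrow> real^'n::finite \<Rightarrow> real^'n \<Rightarrow> real^'n \<Rightarrow> real^'n" where
  "christoffel G y v w = (THE a. \<forall>z. G y a z =
     (frechet_derivative (\<lambda>x. G x w z) (at y) v + frechet_derivative (\<lambda>x. G x v z) (at y) w
      - frechet_derivative (\<lambda>x. G x v w) (at y) z) / 2)"

definition normal_part :: "('v \<Rightarrow> 'v \<Rightarrow> real) \<Rightarrow> 'v set \<Rightarrow> 'v \<Rightarrow> 'v::real_vector" where
  "normal_part g E v = (THE n. (\<forall>t\<in>E. g n t = 0) \<and> v - n \<in> E)"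

definition second_fundamental_form ::
    "(real^'n \<Rightarrow> real^'n \<Rightarrow> real^'n \<Rightarrow> real) \<Rightarrow> (real^'m::finite \<Rightarrow> real^'n::finite) \<Rightarrow> real^'m \<Rightarrow>
     real^'m \<Rightarrow> real^'m \<Rightarrow> real^'n" where
  "second_fundamental_form G F s a b =
     normal_part (G (F s)) (range (frechet_derivative F (at s)))
       (frechet_derivative (\<lambda>r. frechet_derivative F (at r) b) (at s) a
        + christoffel G (F s) (frechet_derivative F (at s) a) (frechet_derivative F (at s) b))"

definition induced_metric ::
    "(real^'n \<Rightarrow> real^'n \<Rightarrow> real^'n \<Rightarrow> real) \<Rightarrow> (real^'m::finite \<Rightarrow> real^'n::finite) \<Rightarrow> real^'m \<Rightarrow>
     real^'m^'m" where
  "induced_metric G F s = (\<chi> i j. G (F s) (frechet_derivative F (at s) (axis i 1))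
                                          (frechet_derivative F (at s) (axis j 1)))"

text \<open>The trace of the second fundamental form with respect to the induced metric.\<close>

definition mean_curvature ::
    "(real^'n \<Rightarrow> real^'n \<Rightarrow> real^'n \<Rightarrow> real) \<Rightarrow> (real^'m::finite \<Rightarrow> real^'n::finite) \<Rightarrow> real^'m \<Rightarrow>
     real^'n" where
  "mean_curvature G F s = (\<Sum>i\<in>UNIV. \<Sum>j\<in>UNIV.
     (matrix_inv (induced_metric G F s) $ i $ j)
       *\<^sub>R second_fundamental_form G F s (axis i 1) (axis j 1))"


section \<open>Special Lagrangian 3-folds\<close>

text \<open>The tangent space of an immersed submanifold f, in the chart c of the ambient manifold, at the
  point with coordinates s in the chart d of the parameter manifold.\<close>

definition tangent_plane ::
    "('b, 'm::finite) chart \<Rightarrow> ('b \<Rightarrow> 'a) \<Rightarrow> ('a, 'n::finite) chart \<Rightarrow> real^'m \<Rightarrow> (real^'n) set" where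
  "tangent_plane d f c s = range (frechet_derivative (coord_rep d f c) (at s))"

definition special_lagrangian :: "'a topology \<Rightarrow> ('a, 6) chart set \<Rightarrow> ('a, 6, real) form_field \<Rightarrow>
    ('a, 6, complex) form_field \<Rightarrow> real \<Rightarrow>
    'b topology \<Rightarrow> ('b, 3) chart set \<Rightarrow> ('b \<Rightarrow> 'a) \<Rightarrow> bool" where
  "special_lagrangian M A \<Omega> \<Upsilon> \<theta> N B f \<longleftrightarrow> smooth_manifold N B \<and> immersion N B M A f \<and>
     (\<forall>d\<in>B. \<forall>c\<in>A. \<forall>p\<in>fst d. f p \<in> fst c \<longrightarrow>
        sl_plane (\<Omega> c (snd c (f p))) (\<Upsilon> c (snd c (f p))) \<theta> (tangent_plane d f c (snd d p)))"

text \<open>The vector is expressed in the chart c.\<close>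

definition su3_mean_curvature :: "('a, 6, real) form_field \<Rightarrow> ('a, 6, complex) form_field \<Rightarrow>
    ('b, 3) chart \<Rightarrow> ('b \<Rightarrow> 'a) \<Rightarrow> ('a, 6) chart \<Rightarrow> 'b \<Rightarrow> real^6" where
  "su3_mean_curvature \<Omega> \<Upsilon> d f c p =
     mean_curvature (\<lambda>y. su3_metric (\<Omega> c y) (\<Upsilon> c y)) (coord_rep d f c) (snd d p)"

definition minimal :: "('a, 6) chart set \<Rightarrow> ('a, 6, real) form_field \<Rightarrow> ('a, 6, complex) form_field \<Rightarrow>
    ('b, 3) chart set \<Rightarrow> ('b \<Rightarrow> 'a) \<Rightarrow> bool" where
  "minimal A \<Omega> \<Upsilon> B f \<longleftrightarrow>
     (\<forall>d\<in>B. \<forall>c\<in>A. \<forall>p\<in>fst d. f p \<in> fst c \<longrightarrow> su3_mean_curvature \<Omega> \<Upsilon> d f c p = 0)"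

text \<open>In every structure of the class, on every 6-manifold with points in the first type, every
  special Lagrangian 3-fold of every phase, parametrised by a manifold with points in the second
  type, is minimal.\<close>

definition sl_minimal_class :: "'a itself \<Rightarrow> 'b itself \<Rightarrow> torsion_component set \<Rightarrow> bool" where
  "sl_minimal_class TA TB S \<longleftrightarrow>
     (\<forall>(M::'a topology) A \<Omega> \<Upsilon> \<theta> (N::'b topology) B f.
        smooth_manifold M A \<longrightarrow> su3_structure A \<Omega> \<Upsilon> \<longrightarrow> in_torsion_class S A \<Omega> \<Upsilon> \<longrightarrow>
        0 \<le> \<theta> \<longrightarrow> \<theta> < 2 * pi \<longrightarrow> special_lagrangian M A \<Omega> \<Upsilon> \<theta> N B f \<longrightarrow> minimal A \<Omega> \<Upsilon> B f)"


section \<open>Refined torsion forms\<close>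

text \<open>A basis of the tangent space identifying the structure with the model is given by the
  isomorphism u onto the model space.\<close>

definition frame :: "(real^6 \<Rightarrow> real^6) \<Rightarrow> 6 \<Rightarrow> real^6" where
  "frame u i = inv u (axis i 1)"

definition coframe :: "(real^6 \<Rightarrow> real^6) \<Rightarrow> 6 \<Rightarrow> (real^6, real) form" where
  "coframe u i = pullback u (covec i)"

text \<open>E is the tangent space of the special Lagrangian of phase theta.\<close>

definition T_sharp ::
    "(real^6, real) form \<Rightarrow> (real^6, complex) form \<Rightarrow> real \<Rightarrow> (real^6) set \<Rightarrow> (real^6) set" where
  "T_sharp \<Omega> \<Upsilon> \<theta> E = complex_act \<Omega> \<Upsilon> (cis (- \<theta> / 3)) ` E"

definition sl_adapted :: "(real^6, real) form \<Rightarrow> (real^6, complex) form \<Rightarrow> real \<Rightarrow>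
    (real^6) set \<Rightarrow> (real^6 \<Rightarrow> real^6) \<Rightarrow> bool" where
  "sl_adapted \<Omega> \<Upsilon> \<theta> E u \<longleftrightarrow> adapted \<Omega> \<Upsilon> u \<and>
     T_sharp \<Omega> \<Upsilon> \<theta> E = span (frame u ` {1, 2, 3}) \<and>
     {n. \<forall>t\<in>T_sharp \<Omega> \<Upsilon> \<theta> E. su3_metric \<Omega> \<Upsilon> n t = 0} = span (frame u ` {4, 5, 6})"

definition Gam :: "(real^6 \<Rightarrow> real^6) \<Rightarrow> 6 \<Rightarrow> (real^6, real) form" where
  "Gam u p vs =
     (if p = 1 then - (coframe u 2 \<and>\<^sub>w coframe u 3) vs - (coframe u 5 \<and>\<^sub>w coframe u 6) vs
      else if p = 2 then - (coframe u 3 \<and>\<^sub>w coframe u 1) vs - (coframe u 6 \<and>\<^sub>w coframe u 4) vs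
      else if p = 3 then - (coframe u 1 \<and>\<^sub>w coframe u 2) vs - (coframe u 4 \<and>\<^sub>w coframe u 5) vs
      else 0)"

definition form_span3 :: "(6 \<Rightarrow> ('v, real) form) \<Rightarrow> ('v, real) form set" where
  "form_span3 b = range (\<lambda>(a :: 6 \<Rightarrow> real) vs. \<Sum>p\<in>{1, 2, 3}. a p * b p vs)"

text \<open>Every pair of distinct indices occurs exactly once.  The order on the index type puts 6 first,
  which changes e61 into -e16 and so does not affect the inner product.\<close>

definition form2_inner ::
    "(real^6 \<Rightarrow> real^6) \<Rightarrow> (real^6, real) form \<Rightarrow> (real^6, real) form \<Rightarrow> real" where
  "form2_inner u \<beta> \<gamma> =
     (\<Sum>(i, j)\<in>{(i, j). i < j}. \<beta> [frame u i, frame u j] * \<gamma> [frame u i, frame u j])"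

text \<open>The orthogonal projection onto the span of the three forms Gam.\<close>

definition proj_Lambda28_1 ::
    "(real^6 \<Rightarrow> real^6) \<Rightarrow> (real^6, real) form \<Rightarrow> (real^6, real) form" where
  "proj_Lambda28_1 u \<tau> = (THE \<beta>. \<beta> \<in> form_span3 (Gam u) \<and>
     (\<forall>\<gamma>\<in>form_span3 (Gam u). form2_inner u (\<lambda>vs. \<tau> vs - \<beta> vs) \<gamma> = 0))"

definition T_component :: "(real^6 \<Rightarrow> real^6) \<Rightarrow> (real^6, real) form \<Rightarrow> (real^6, real) form" where
  "T_component u \<eta> = (\<lambda>vs. \<Sum>i\<in>{1, 2, 3}. \<eta> [frame u i] * coframe u i vs)"

definition N_component :: "(real^6 \<Rightarrow> real^6) \<Rightarrow> (real^6, real) form \<Rightarrow> (real^6, real) form" where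
  "N_component u \<eta> = (\<lambda>vs. \<Sum>i\<in>{4, 5, 6}. \<eta> [frame u i] * coframe u i vs)"

definition normal_vec :: "(real^6 \<Rightarrow> real^6) \<Rightarrow> real \<Rightarrow> 6 \<Rightarrow> real^6" where
  "normal_vec u \<theta> p = - sin (\<theta> / 3) *\<^sub>R frame u p + cos (\<theta> / 3) *\<^sub>R frame u (p + 3)"

text \<open>The value at \<open>\<beta>\<close> of the linear map on the span of the basis \<open>b 1, b 2, b 3\<close> that sends
  each \<open>b p\<close> to \<open>w p\<close>.\<close>

definition linear_ext3 :: "(6 \<Rightarrow> ('v, real) form) \<Rightarrow> (6 \<Rightarrow> 'v) \<Rightarrow> ('v, real) form \<Rightarrow> 'v::real_vector" where
  "linear_ext3 b w \<beta> = (THE x. \<exists>a. \<beta> = (\<lambda>vs. \<Sum>p\<in>{1, 2, 3}. a p * b p vs) \<and>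
     x = (\<Sum>p\<in>{1, 2, 3}. a p *\<^sub>R w p))"

definition natural_iso :: "(real^6 \<Rightarrow> real^6) \<Rightarrow> real \<Rightarrow> (real^6, real) form \<Rightarrow> real^6" where
  "natural_iso u \<theta> = linear_ext3 (Gam u) (\<lambda>p. sqrt 2 *\<^sub>R normal_vec u \<theta> p)"

definition section_iso :: "(real^6 \<Rightarrow> real^6) \<Rightarrow> real \<Rightarrow> (real^6, real) form \<Rightarrow> real^6" where
  "section_iso u \<theta> = linear_ext3 (coframe u) (normal_vec u \<theta>)"

end

theory Submission
  imports Defs
begin

text \<open>Write \<open>\<phi> = Re (e\<^sup>-\<^sup>i\<^sup>\<theta> \<Upsilon>)\<close> and \<open>\<psi> = Im (e\<^sup>-\<^sup>i\<^sup>\<theta> \<Upsilon>)\<close>.  Multiplicativity of the complex determinant gives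
  \<open>\<phi>\<^sup>2 + \<psi>\<^sup>2 = det (g - i \<Omega>)\<close> on every triple of vectors, so \<open>\<phi>\<close> is a calibration whose calibrated planes
  are the special Lagrangian ones.  As \<open>\<psi>\<close> and \<open>\<Omega>\<close> vanish on a special Lagrangian, the first
  variation of volume agrees with that of the integral of \<open>\<phi>\<close>, and hence \<open>g(w, H) \<phi>|\<^sub>\<Sigma> = - (\<iota>\<^sub>w d\<phi>)|\<^sub>\<Sigma>\<close> for
  all normal \<open>w\<close>.  The torsion equations evaluate the right-hand side, and the terms in \<open>\<Omega>\<^sup>2\<close>
  do not contribute.

  Conversely, each of the summands \<open>X2p\<close>, \<open>X2m\<close>, \<open>X5\<close> is realised on its own by a coframe
  \<open>exp(\<lambda>\<^sub>i x\<^sub>m) dx\<^sub>i\<close> on \<open>\<real>\<^sup>6\<close>, in which a coordinate 3-plane is special Lagrangian but not minimal.\<close>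

section \<open>Exterior products\<close>

text \<open>\<Sigma> is never deformed and nothing is integrated: the first variation becomes an
  identity at one point, for one fixed vector w. Let C be the adjugate of the induced metric g.
  Putting w into one slot of the polarised determinant identity expresses that value of \<phi>
  through C and the products of w with the tangent vectors. The divergence of this along \<Sigma>
  yields the Koszul terms in which the metric is differentiated in tangent directions, together with
  the second derivatives of the immersion. Differentiating the determinant identity itself along w
  yields the remaining Koszul term. As C is det g times the inverse of g, the two combine to the
  trace of the second fundamental form paired with w on one side and to - d\<phi> on the other. The
  metric comes from an arbitrary choice of frame at each point, so its differentiability has to be
  recovered from \<Omega> and \<Upsilon>. Forms in \<open>Lambda28\<close> are J-invariant, hence
  unchanged by the rotation e^{i \<theta> / 3} between the plane of phase 0 and the tangent plane;
  therefore the coefficients of \<tau>2 involve \<theta> only through cos \<theta> and sin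
  \<theta>.\<close>

lemma wedge_Nil: "(\<alpha> \<and>\<^sub>w \<beta>) [] = \<alpha> [] * \<beta> []"
  by (simp add: wedge_def)

lemma wedge_Cons:
  fixes \<alpha> \<beta> :: "('v, 's::comm_ring_1) form"
  shows "(\<alpha> \<and>\<^sub>w \<beta>) (v # vs) =
     ((\<lambda>l. \<alpha> (v # l)) \<and>\<^sub>w \<beta>) vs + ((\<lambda>l. (-1) ^ length l * \<alpha> l) \<and>\<^sub>w (\<lambda>l. \<beta> (v # l))) vs"
proof -
  let ?n = "length vs"
  \<comment> \<open>The inversions of the shuffle I of n arguments.\<close>
  define T where "T n I = {(i, j). i \<in> I \<and> j \<in> {..<n} - I \<and> j < i}" for n and I :: "nat set"
  define g where "g I = (-1) ^ card (T (Suc ?n) I) * \<alpha> (nths (v # vs) I) * \<beta> (nths (v # vs) (- I))" for I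
  have finT: "finite (T n I)" if "I \<subseteq> {..<n}" for n I
    by (rule finite_subset[of _ "I \<times> {..<n}"]) (use that in \<open>auto simp: T_def intro: finite_subset\<close>)
  have split: "Pow {..<Suc ?n} = (\<lambda>I. insert 0 (Suc ` I)) ` Pow {..<?n} \<union> (`) Suc ` Pow {..<?n}"
  proof -
    have "{..<Suc ?n} = insert 0 (Suc ` {..<?n})"
      by (rule lessThan_Suc_eq_insert_0)
    moreover have "Pow (Suc ` {..<?n}) = (`) Suc ` Pow {..<?n}"
      by (rule image_Pow_surj[OF refl, symmetric])
    ultimately show ?thesis
      by (simp only: Pow_insert image_image Un_commute)
  qed
  have inj0: "inj_on (\<lambda>I. insert 0 (Suc ` I)) (Pow {..<?n})"
    by (intro inj_onI) (metis inj_Suc inj_image_eq_iff insert_ident nat.simps(3) imageE)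
  have injS: "inj_on ((`) Suc) (Pow {..<?n})"
    by (intro inj_onI) (metis inj_Suc inj_image_eq_iff)
  have T0: "card (T (Suc ?n) (insert 0 (Suc ` I))) = card (T ?n I)" if "I \<subseteq> {..<?n}" for I
  proof -
    have "T (Suc ?n) (insert 0 (Suc ` I)) = map_prod Suc Suc ` T ?n I"
      unfolding T_def
      by (auto simp: image_iff less_Suc_eq_0_disj) 
    moreover have "inj_on (map_prod Suc Suc) (T ?n I)"
      by (auto simp: inj_on_def)
    ultimately show ?thesis by (simp add: card_image)
  qed
  \<comment> \<open>If \<beta> receives the first argument, every position handed to \<alpha> is
    inverted with it, which adds \<open>card I\<close> inversions.\<close>
  have TS: "card (T (Suc ?n) (Suc ` I)) = card I + card (T ?n I)" if I: "I \<subseteq> {..<?n}" for I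
  proof -
    have eq: "T (Suc ?n) (Suc ` I) = (\<lambda>i. (Suc i, 0)) ` I \<union> map_prod Suc Suc ` T ?n I"
      unfolding T_def
      by (auto simp: image_iff less_Suc_eq_0_disj) 
    have finI: "finite I" using I finite_subset by blast
    have "card ((\<lambda>i. (Suc i, 0::nat)) ` I) = card I"
      by (rule card_image) (auto simp: inj_on_def)
    moreover have "card (map_prod Suc Suc ` T ?n I) = card (T ?n I)"
      by (rule card_image) (auto simp: inj_on_def)
    moreover have "(\<lambda>i. (Suc i, 0)) ` I \<inter> map_prod Suc Suc ` T ?n I = {}" by auto
    ultimately show ?thesis
      unfolding eq using finI finT[OF I] by (simp add: card_Un_disjoint)
  qed
  have n0: "nths (v # vs) (insert 0 (Suc ` I)) = v # nths vs I"
    "nths (v # vs) (- insert 0 (Suc ` I)) = nths vs (- I)" for I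
    by (auto simp: nths_Cons intro!: arg_cong[where f = "nths vs"])
  have nS: "nths (v # vs) (Suc ` I) = nths vs I"
    "nths (v # vs) (- (Suc ` I)) = v # nths vs (- I)" for I
    by (auto simp: nths_Cons intro!: arg_cong[where f = "nths vs"])
  have len: "length (nths vs I) = card I" if "I \<subseteq> {..<?n}" for I
    using that by (auto simp: length_nths intro!: arg_cong[where f = card])
  have W: "(\<alpha> \<and>\<^sub>w \<beta>) l = (\<Sum>I\<in>Pow {..<length l}. (-1) ^ card (T (length l) I) * \<alpha> (nths l I) * \<beta> (nths l (- I)))"
    for \<alpha> \<beta> :: "('v, 's) form" and l
    unfolding wedge_def T_def ..
  have "(\<alpha> \<and>\<^sub>w \<beta>) (v # vs) = sum g (Pow {..<Suc ?n})"
    unfolding W g_def by simp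
  also have "\<dots> = sum g ((\<lambda>I. insert 0 (Suc ` I)) ` Pow {..<?n}) + sum g ((`) Suc ` Pow {..<?n})"
    unfolding split by (rule sum.union_disjoint) auto
  also have "sum g ((\<lambda>I. insert 0 (Suc ` I)) ` Pow {..<?n}) = ((\<lambda>l. \<alpha> (v # l)) \<and>\<^sub>w \<beta>) vs"
    unfolding W sum.reindex[OF inj0] o_def
    by (rule sum.cong) (simp_all add: g_def n0 T0)
  also have "sum g ((`) Suc ` Pow {..<?n}) = ((\<lambda>l. (-1) ^ length l * \<alpha> l) \<and>\<^sub>w (\<lambda>l. \<beta> (v # l))) vs"
    unfolding W sum.reindex[OF injS] o_def
    by (rule sum.cong) (simp_all add: g_def nS TS len power_add mult_ac)
  finally show ?thesis .
qed

lemmas wedge_expand = wedge_Nil wedge_Cons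

lemma exhaust_6: "x = 1 \<or> x = 2 \<or> x = 3 \<or> x = 4 \<or> x = 5 \<or> x = 6" for x :: 6
proof (induct x)
  case (of_int z)
  then have "z = 0 \<or> z = 1 \<or> z = 2 \<or> z = 3 \<or> z = 4 \<or> z = 5" by fastforce
  then show ?case by auto
qed

lemma UNIV_6: "UNIV = {1, 2, 3, 4, 5, 6::6}"
  using exhaust_6 by auto

lemma forall_6: "(\<forall>i::6. P i) \<longleftrightarrow> P 1 \<and> P 2 \<and> P 3 \<and> P 4 \<and> P 5 \<and> P 6"
  by (metis exhaust_6)

lemma sum_6: "sum f (UNIV::6 set) = f 1 + f 2 + f 3 + f 4 + f 5 + f 6"
  unfolding UNIV_6 by (simp add: add_ac)


lemma wedge_eq_0_length:
  assumes "\<And>l. length l \<noteq> k \<Longrightarrow> \<alpha> l = 0" "\<And>l. length l \<noteq> m \<Longrightarrow> \<beta> l = 0" "length vs \<noteq> k + m"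
  shows "(\<alpha> \<and>\<^sub>w \<beta>) vs = 0"
  unfolding wedge_def
proof (rule sum.neutral, rule ballI)
  fix I assume "I \<in> Pow {..<length vs}"
  have "card {i. i < length vs \<and> i \<in> I} + card {i. i < length vs \<and> i \<in> - I}
      = card ({i. i < length vs \<and> i \<in> I} \<union> {i. i < length vs \<and> i \<in> - I})"
    by (rule card_Un_disjoint[symmetric]) auto
  also have "\<dots> = card {..<length vs}"
    by (rule arg_cong[where f = card]) auto
  finally have "length (nths vs I) + length (nths vs (- I)) = length vs"
    by (simp add: length_nths)
  then have "length (nths vs I) \<noteq> k \<or> length (nths vs (- I)) \<noteq> m"
    using assms(3) by auto
  then show "(- 1) ^ card {(i, j). i \<in> I \<and> j \<in> {..<length vs} - I \<and> j < i} *
      \<alpha> (nths vs I) * \<beta> (nths vs (- I)) = 0"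
    using assms(1,2) by auto
qed

section \<open>The linear model\<close>

lemma covec_simps [simp]: "covec i [] = 0" "covec i [v] = v $ i" "covec i (v # w # l) = 0"
  by (simp_all add: covec_def)

lemma covec_length: "length l \<noteq> 1 \<Longrightarrow> covec i l = 0"
  by (simp add: covec_def)

definition zco :: "6 \<Rightarrow> real^6 \<Rightarrow> complex" where
  "zco p v = Complex (v $ p) (v $ (p + 3))"

lemma zcovec_simps [simp]: "zcovec p [] = 0" "zcovec p [v] = zco p v" "zcovec p (v # w # l) = 0"
  by (simp_all add: zcovec_def zco_def complex_eq_iff)

lemma Omega0_eq: "Omega0 [v, w] = v $ 1 * w $ 4 - v $ 4 * w $ 1 + v $ 2 * w $ 5 - v $ 5 * w $ 2
    + v $ 3 * w $ 6 - v $ 6 * w $ 3"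
  by (simp add: Omega0_def wedge_expand)

lemma Omega0_length: "length l \<noteq> 2 \<Longrightarrow> Omega0 l = 0"
  unfolding Omega0_def by (simp add: wedge_eq_0_length[OF covec_length covec_length])

lemma Upsilon0_eq: "Upsilon0 [a, b, c] =
    zco 1 a * zco 2 b * zco 3 c - zco 1 a * zco 3 b * zco 2 c
    - zco 2 a * zco 1 b * zco 3 c + zco 2 a * zco 3 b * zco 1 c
    + zco 3 a * zco 1 b * zco 2 c - zco 3 a * zco 2 b * zco 1 c"
  by (simp add: Upsilon0_def wedge_expand algebra_simps)

lemma Upsilon0_length: "length l \<noteq> 3 \<Longrightarrow> Upsilon0 l = 0"
  unfolding Upsilon0_def
  by (rule wedge_eq_0_length[of 1 _ 2]; (rule wedge_eq_0_length[of 1 _ 1])?)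
     (auto simp: zcovec_def covec_def)

lemma J0_nth [simp]: "J0 v $ 1 = - v $ 4" "J0 v $ 2 = - v $ 5" "J0 v $ 3 = - v $ 6"
    "J0 v $ 4 = v $ 1" "J0 v $ 5 = v $ 2" "J0 v $ 6 = v $ 3"
  by (simp_all add: J0_def axis_def)

lemma vec6_eq_iff: "v = w \<longleftrightarrow> v $ 1 = w $ 1 \<and> v $ 2 = w $ 2 \<and> v $ 3 = w $ 3 \<and> v $ 4 = w $ 4 \<and>
    v $ 5 = w $ 5 \<and> v $ 6 = w $ 6" for v w :: "'a^6"
  by (simp add: vec_eq_iff forall_6)

lemma inner_vec6: "v \<bullet> w = v $ 1 * w $ 1 + v $ 2 * w $ 2 + v $ 3 * w $ 3 + v $ 4 * w $ 4 +
    v $ 5 * w $ 5 + v $ 6 * w $ 6" for v w :: "real^6"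
  by (simp add: inner_vec_def sum_6)

lemma zco_J0 [simp]: "zco 1 (J0 v) = \<i> * zco 1 v" "zco 2 (J0 v) = \<i> * zco 2 v" "zco 3 (J0 v) = \<i> * zco 3 v"
  by (simp_all add: zco_def complex_eq_iff)

lemma zco_simps [simp]: "zco p (v + w) = zco p v + zco p w" "zco p (r *\<^sub>R v) = of_real r * zco p v"
  by (simp_all add: zco_def complex_eq_iff)

lemma linear_J0: "linear J0"
  by (rule linearI) (simp_all add: vec6_eq_iff)

lemma Omega0_J0: "Omega0 [v, J0 w] = v \<bullet> w"
  by (simp add: Omega0_eq inner_vec6)

lemma Upsilon0_J0: "Upsilon0 [J0 v, a, b] = \<i> * Upsilon0 [v, a, b]"
  by (simp add: Upsilon0_eq algebra_simps)

text \<open>The standard Hermitian form on complex 3-space, linear in the first argument.\<close>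

definition herm :: "real^6 \<Rightarrow> real^6 \<Rightarrow> complex" where
  "herm a b = Complex (a \<bullet> b) (- Omega0 [a, b])"

lemma herm_eq: "herm a b = zco 1 a * cnj (zco 1 b) + zco 2 a * cnj (zco 2 b) + zco 3 a * cnj (zco 3 b)"
  by (simp add: herm_def zco_def complex_eq_iff inner_vec6 Omega0_eq algebra_simps)

text \<open>The determinant of a product \<open>A B\<^sup>*\<close> of complex matrices.\<close>

lemma Upsilon0_mult_cnj:
  "Upsilon0 [a1, a2, a3] * cnj (Upsilon0 [b1, b2, b3]) =
     herm a1 b1 * herm a2 b2 * herm a3 b3 - herm a1 b1 * herm a2 b3 * herm a3 b2
   - herm a1 b2 * herm a2 b1 * herm a3 b3 + herm a1 b2 * herm a2 b3 * herm a3 b1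
   + herm a1 b3 * herm a2 b1 * herm a3 b2 - herm a1 b3 * herm a2 b2 * herm a3 b1"
  unfolding Upsilon0_eq herm_eq complex_cnj_add complex_cnj_diff complex_cnj_mult by algebra

text \<open>A vector can be read off from its contraction with \<open>Upsilon0\<close>. This makes J
  depend on \<Upsilon> alone, and it supplies the linear system behind the differentiability of the
  metric.\<close>

lemma Upsilon0_axis: "Upsilon0 [v, axis 2 1, axis 3 1] = zco 1 v" "Upsilon0 [v, axis 3 1, axis 1 1] = zco 2 v"
   "Upsilon0 [v, axis 1 1, axis 2 1] = zco 3 v"
  by (simp_all add: Upsilon0_eq zco_def axis_def complex_eq_iff)

section \<open>Alternating forms and adapted frames\<close>

lemma alt_form_length: "alt_form k \<omega> \<Longrightarrow> length l \<noteq> k \<Longrightarrow> \<omega> l = 0"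
  by (simp add: alt_form_def)

lemma alt_form_1D:
  assumes "alt_form 1 \<omega>" shows "linear (\<lambda>v. \<omega> [v])"
proof -
  have "linear (\<lambda>v. \<omega> ([0][0 := v]))"
    using assms unfolding alt_form_def by (metis One_nat_def length_Cons list.size(3) zero_less_one)
  then show ?thesis by simp
qed

lemma alt_form_2D:
  assumes "alt_form 2 \<omega>"
  shows "linear (\<lambda>v. \<omega> [v, b])" "linear (\<lambda>v. \<omega> [a, v])" "\<omega> [a, a] = 0" "\<omega> [a, b] = - \<omega> [b, a]"
proof -
  have L: "linear (\<lambda>v. \<omega> ([a, b][i := v]))" if "i < 2" for i a b
  proof -
    have "length [a, b] = 2" by simp
    with assms that show ?thesis unfolding alt_form_def by blast
  qed
  show l: "linear (\<lambda>v. \<omega> [v, b])" "linear (\<lambda>v. \<omega> [a, v])" for a b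
    using L[of 0 0 b] L[of 1 a 0] by simp_all
  have *: "\<omega> vs = 0" if "length vs = 2" "i < j" "j < 2" "vs ! i = vs ! j" for i j vs
    using assms that by (simp add: alt_form_def)
  show z: "\<omega> [a, a] = 0" for a
    using *[of "[a, a]" 0 1] by simp
  have "\<omega> [a + b, a + b] = \<omega> [a, a] + \<omega> [a, b] + (\<omega> [b, a] + \<omega> [b, b])"
    by (simp only: linear_add[OF l(1)] linear_add[OF l(2)] add_ac)
  then show "\<omega> [a, b] = - \<omega> [b, a]" by (simp add: z eq_neg_iff_add_eq_0)
qed

lemma alt_form_3D:
  assumes "alt_form 3 \<omega>"
  shows "linear (\<lambda>v. \<omega> [v, b, c])" "linear (\<lambda>v. \<omega> [a, v, c])" "linear (\<lambda>v. \<omega> [a, b, v])"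
    "\<omega> [a, a, c] = 0" "\<omega> [a, b, a] = 0" "\<omega> [a, b, b] = 0"
    "\<omega> [a, b, c] = - \<omega> [b, a, c]" "\<omega> [a, b, c] = - \<omega> [c, b, a]" "\<omega> [a, b, c] = - \<omega> [a, c, b]"
proof -
  have L: "linear (\<lambda>v. \<omega> ([a, b, c][i := v]))" if "i < 3" for i a b c
  proof -
    have "length [a, b, c] = 3" by simp
    with assms that show ?thesis unfolding alt_form_def by blast
  qed
  show l: "linear (\<lambda>v. \<omega> [v, b, c])" "linear (\<lambda>v. \<omega> [a, v, c])" "linear (\<lambda>v. \<omega> [a, b, v])" for a b c
    using L[of 0 0 b c] L[of 1 a 0 c] L[of 2 a b 0] by simp_all
  have *: "\<omega> vs = 0" if "length vs = 3" "i < j" "j < 3" "vs ! i = vs ! j" for i j vs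
    using assms that by (simp add: alt_form_def)
  show z: "\<omega> [a, a, c] = 0" "\<omega> [a, b, a] = 0" "\<omega> [a, b, b] = 0" for a b c
    using *[of "[a, a, c]" 0 1] *[of "[a, b, a]" 0 2] *[of "[a, b, b]" 1 2] by simp_all
  note la = linear_add[OF l(1)] linear_add[OF l(2)] linear_add[OF l(3)]
  have "\<omega> [a + b, a + b, c] = \<omega> [a, a, c] + \<omega> [a, b, c] + (\<omega> [b, a, c] + \<omega> [b, b, c])"
    by (simp only: la add_ac)
  then show "\<omega> [a, b, c] = - \<omega> [b, a, c]" by (simp add: z eq_neg_iff_add_eq_0)
  have "\<omega> [a + c, b, a + c] = \<omega> [a, b, a] + \<omega> [a, b, c] + (\<omega> [c, b, a] + \<omega> [c, b, c])"
    by (simp only: la add_ac)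
  then show "\<omega> [a, b, c] = - \<omega> [c, b, a]" by (simp add: z eq_neg_iff_add_eq_0)
  have "\<omega> [a, b + c, b + c] = \<omega> [a, b, b] + \<omega> [a, b, c] + (\<omega> [a, c, b] + \<omega> [a, c, c])"
    by (simp only: la add_ac)
  then show "\<omega> [a, b, c] = - \<omega> [a, c, b]" by (simp add: z eq_neg_iff_add_eq_0)
qed

lemma less_3_cases: "i < (3::nat) \<longleftrightarrow> i = 0 \<or> i = 1 \<or> i = 2" by auto

lemma length_3_conv: "length l = 3 \<longleftrightarrow> (\<exists>a b c. l = [a, b, c])"
  by (auto simp: numeral_3_eq_3 length_Suc_conv)

lemma length_2_conv: "length l = 2 \<longleftrightarrow> (\<exists>a b. l = [a, b])"
  by (auto simp: numeral_2_eq_2 length_Suc_conv)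

lemma alt_form_1I:
  assumes "\<And>l. length l \<noteq> 1 \<Longrightarrow> \<omega> l = 0" "linear (\<lambda>v. \<omega> [v])"
  shows "alt_form 1 \<omega>"
  using assms by (auto simp: alt_form_def length_Suc_conv)

lemma alt_form_2I:
  assumes "\<And>l. length l \<noteq> 2 \<Longrightarrow> \<omega> l = 0" "\<And>b. linear (\<lambda>v. \<omega> [v, b])" "\<And>a. linear (\<lambda>v. \<omega> [a, v])"
    "\<And>a. \<omega> [a, a] = 0"
  shows "alt_form 2 \<omega>"
  unfolding alt_form_def
proof (intro conjI allI impI)
  fix vs :: "'a list" assume "length vs = 2"
  then obtain a b where vs: "vs = [a, b]" by (auto simp: length_2_conv)
  show "linear (\<lambda>v. \<omega> (vs[i := v]))" if "i < 2" for i
    using assms(2,3) that by (auto simp: vs less_2_cases_iff)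
  show "\<omega> vs = 0" if "i < j" "j < 2" "vs ! i = vs ! j" for i j
    using assms(4) that by (auto simp: vs less_2_cases_iff)
qed (use assms in auto)

lemma alt_form_3I:
  assumes "\<And>l. length l \<noteq> 3 \<Longrightarrow> \<omega> l = 0" "\<And>b c. linear (\<lambda>v. \<omega> [v, b, c])"
    "\<And>a c. linear (\<lambda>v. \<omega> [a, v, c])" "\<And>a b. linear (\<lambda>v. \<omega> [a, b, v])"
    "\<And>a c. \<omega> [a, a, c] = 0" "\<And>a b. \<omega> [a, b, a] = 0" "\<And>a b. \<omega> [a, b, b] = 0"
  shows "alt_form 3 \<omega>"
  unfolding alt_form_def
proof (intro conjI allI impI)
  fix vs :: "'a list" assume "length vs = 3"
  then obtain a b c where vs: "vs = [a, b, c]" by (auto simp: length_3_conv)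
  show "linear (\<lambda>v. \<omega> (vs[i := v]))" if "i < 3" for i
    using assms(2-4) that by (auto simp: vs less_3_cases)
  show "\<omega> vs = 0" if "i < j" "j < 3" "vs ! i = vs ! j" for i j
  proof -
    have "i = 0 \<and> j = 1 \<or> i = 0 \<and> j = 2 \<or> i = 1 \<and> j = 2" using that by arith
    then show ?thesis using assms(5-7) that(3) by (auto simp: vs)
  qed
qed (use assms in auto)

lemma alt_form_Omega0: "alt_form 2 Omega0"
  by (rule alt_form_2I)
     (auto simp: Omega0_length Omega0_eq algebra_simps intro!: linearI)

lemma alt_form_Upsilon0: "alt_form 3 Upsilon0"
  by (rule alt_form_3I)
     (auto simp: Upsilon0_length Upsilon0_eq algebra_simps scaleR_conv_of_real[where 'a=complex] intro!: linearI)

lemma alt_form_pullback: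
  fixes u :: "'v::real_vector \<Rightarrow> 'w::real_vector"
  assumes "alt_form k \<omega>" "linear u"
  shows "alt_form k (pullback u \<omega>)"
  unfolding alt_form_def pullback_def
proof (intro conjI allI impI)
  fix vs :: "'v list" assume vs: "length vs = k"
  show "linear (\<lambda>v. \<omega> (map u (vs[i := v])))" if "i < k" for i
  proof -
    have "linear (\<lambda>v. \<omega> ((map u vs)[i := v]))"
      using assms(1) vs that by (simp add: alt_form_def)
    from linear_compose[OF assms(2) this] show ?thesis by (simp add: map_update o_def)
  qed
  show "\<omega> (map u vs) = 0" if "i < j" "j < k" "vs ! i = vs ! j" for i j
    using assms(1) vs that by (auto simp: alt_form_def)
qed (use assms in \<open>auto simp: alt_form_def\<close>)

lemma alt_form_bounded_linear:
  assumes "alt_form k \<omega>" "linear T"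
  shows "alt_form k (\<lambda>l. T (\<omega> l))"
  using assms unfolding alt_form_def
  by (auto simp: linear_0 intro: linear_compose[unfolded o_def, of _ T])

lemma J0_J0: "J0 (J0 v) = - v"
  by (simp add: vec6_eq_iff)

lemma zco_eq_iff: "v = w \<longleftrightarrow> zco 1 v = zco 1 w \<and> zco 2 v = zco 2 w \<and> zco 3 v = zco 3 w"
  by (auto simp: vec6_eq_iff zco_def)

context
  fixes \<Omega> :: "(real^6, real) form" and \<Upsilon> :: "(real^6, complex) form" and u
  assumes ad: "adapted \<Omega> \<Upsilon> u"
begin

lemma adapted_linear: "linear u" and adapted_bij: "bij u"
  using ad by (auto simp: adapted_def)

lemma adapted_Omega: "\<Omega> l = Omega0 (map u l)" and adapted_Upsilon: "\<Upsilon> l = Upsilon0 (map u l)"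
  using ad by (auto simp: adapted_def pullback_def)

lemma adapted_alt_form: "alt_form 2 \<Omega>" "alt_form 3 \<Upsilon>"
  using ad alt_form_pullback alt_form_Omega0 alt_form_Upsilon0 by (auto simp: adapted_def)

lemma adapted_some: "adapted \<Omega> \<Upsilon> (some_adapted \<Omega> \<Upsilon>)"
  unfolding some_adapted_def using ad by (rule someI[of "adapted \<Omega> \<Upsilon>"])

lemma adapted_u_inv: "u (inv u v) = v" and adapted_inv_u: "inv u (u v) = v"
  using adapted_bij by (auto simp: bij_is_surj surj_f_inv_f bij_is_inj)

end

text \<open>\<open>su3_J\<close> is defined with a chosen frame, but \<Upsilon> is complex linear in
  each slot and a vector is determined by its contraction with \<Upsilon>, so every adapted frame
  intertwines J with \<open>J0\<close>.\<close>

lemma adapted_J: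
  assumes ad: "adapted \<Omega> \<Upsilon> u"
  shows "u (su3_J \<Omega> \<Upsilon> v) = J0 (u v)"
proof -
  define u' where "u' = some_adapted \<Omega> \<Upsilon>"
  have ad': "adapted \<Omega> \<Upsilon> u'" unfolding u'_def by (rule adapted_some[OF ad])
  define Jv where "Jv = su3_J \<Omega> \<Upsilon> v"
  have Jv: "u' Jv = J0 (u' v)"
    unfolding Jv_def su3_J_def u'_def[symmetric] by (rule adapted_u_inv[OF ad'])
  have "\<Upsilon> [Jv, a, b] = \<i> * \<Upsilon> [v, a, b]" for a b
    by (simp add: adapted_Upsilon[OF ad'] Jv Upsilon0_J0)
  then have "Upsilon0 [u Jv, u a, u b] = Upsilon0 [J0 (u v), u a, u b]" for a b
    by (simp add: adapted_Upsilon[OF ad] Upsilon0_J0)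
  then have "Upsilon0 [u Jv, a, b] = Upsilon0 [J0 (u v), a, b]" for a b
    by (metis adapted_u_inv[OF ad])
  then have "u Jv = J0 (u v)"
    unfolding zco_eq_iff by (metis Upsilon0_axis)
  then show ?thesis by (simp add: Jv_def)
qed

text \<open>The right-hand side mentions no frame once J is known to be independent of it. Hence the
  metric can be computed in every adapted frame, and its regularity reduces to that of \<Omega> and
  J.\<close>

lemma adapted_metric_J:
  assumes ad: "adapted \<Omega> \<Upsilon> u"
  shows "su3_metric \<Omega> \<Upsilon> v w = \<Omega> [v, su3_J \<Omega> \<Upsilon> w]"
  using adapted_J[OF adapted_some[OF ad]] adapted_Omega[OF adapted_some[OF ad]]
  by (simp add: su3_metric_def Omega0_J0)

lemma adapted_metric:
  assumes ad: "adapted \<Omega> \<Upsilon> u"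
  shows "su3_metric \<Omega> \<Upsilon> v w = u v \<bullet> u w"
  unfolding adapted_metric_J[OF ad] using adapted_J[OF ad]
  by (simp add: adapted_Omega[OF ad] Omega0_J0)

lemma adapted_linear_metric:
  assumes ad: "adapted \<Omega> \<Upsilon> u"
  shows "linear (\<lambda>v. su3_metric \<Omega> \<Upsilon> v w)" "linear (\<lambda>w. su3_metric \<Omega> \<Upsilon> v w)"
  unfolding adapted_metric[OF ad]
  by (auto intro!: linearI simp: linear_add[OF adapted_linear[OF ad]] linear_scale[OF adapted_linear[OF ad]]
      inner_add_left inner_add_right)

lemma adapted_metric_sym:
  assumes ad: "adapted \<Omega> \<Upsilon> u"
  shows "su3_metric \<Omega> \<Upsilon> v w = su3_metric \<Omega> \<Upsilon> w v"
  unfolding adapted_metric[OF ad] by (rule inner_commute)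

lemma adapted_metric_eq_0:
  assumes ad: "adapted \<Omega> \<Upsilon> u"
  shows "su3_metric \<Omega> \<Upsilon> v v = 0 \<longleftrightarrow> v = 0"
  unfolding adapted_metric[OF ad]
  using adapted_linear[OF ad] adapted_bij[OF ad]
  by (simp add: linear_injective_0 bij_is_inj) (metis linear_0 linear_injective_0 bij_is_inj)

definition su3_herm where "su3_herm \<Omega> \<Upsilon> v w = Complex (su3_metric \<Omega> \<Upsilon> v w) (- \<Omega> [v, w])"

lemma adapted_mult_cnj:
  assumes ad: "adapted \<Omega> \<Upsilon> u"
  defines "h \<equiv> su3_herm \<Omega> \<Upsilon>"
  shows "\<Upsilon> [a1, a2, a3] * cnj (\<Upsilon> [b1, b2, b3]) =
     h a1 b1 * h a2 b2 * h a3 b3 - h a1 b1 * h a2 b3 * h a3 b2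
   - h a1 b2 * h a2 b1 * h a3 b3 + h a1 b2 * h a2 b3 * h a3 b1
   + h a1 b3 * h a2 b1 * h a3 b2 - h a1 b3 * h a2 b2 * h a3 b1"
proof -
  have "h v w = herm (u v) (u w)" for v w
    by (simp add: h_def herm_def su3_herm_def adapted_metric[OF ad] adapted_Omega[OF ad])
  then show ?thesis
    by (simp add: adapted_Upsilon[OF ad] Upsilon0_mult_cnj)
qed

section \<open>Differential calculus\<close>

text \<open>The product rule for evaluating a varying linear map, given only derivatives of its
  values on fixed vectors: T is expanded in a basis of its finite-dimensional domain, so no operator
  norm appears.\<close>

lemma has_derivative_apply_linear:
  fixes T :: "'s::real_normed_vector \<Rightarrow> 'v::euclidean_space \<Rightarrow> 'w::real_normed_vector"
  assumes W: "open W" "s \<in> W" and lin: "\<And>x. x \<in> W \<Longrightarrow> linear (T x)"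
    and D: "\<And>v. ((\<lambda>x. T x v) has_derivative (\<lambda>h. D h v)) (at s)"
    and A: "(A has_derivative A') (at s)"
  shows "((\<lambda>x. T x (A x)) has_derivative (\<lambda>h. D h (A s) + T s (A' h))) (at s)"
proof -
  have ex: "T x v = (\<Sum>b\<in>Basis. (v \<bullet> b) *\<^sub>R T x b)" if "x \<in> W" for x v
  proof -
    have "T x (\<Sum>b\<in>Basis. (v \<bullet> b) *\<^sub>R b) = (\<Sum>b\<in>Basis. (v \<bullet> b) *\<^sub>R T x b)"
      by (simp add: linear_sum[OF lin[OF that]] linear_scale[OF lin[OF that]])
    then show ?thesis by (simp add: euclidean_representation)
  qed
  \<comment> \<open>Linearity of \<open>D h\<close> in the vector is not a hypothesis; at
    \<open>A s\<close> it results from comparing two derivatives of the same function.\<close>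
  have "((\<lambda>x. \<Sum>b\<in>Basis. (A s \<bullet> b) *\<^sub>R T x b) has_derivative (\<lambda>h. \<Sum>b\<in>Basis. (A s \<bullet> b) *\<^sub>R D h b)) (at s)"
    by (auto intro!: derivative_eq_intros D)
  then have "((\<lambda>x. T x (A s)) has_derivative (\<lambda>h. \<Sum>b\<in>Basis. (A s \<bullet> b) *\<^sub>R D h b)) (at s)"
    by (rule has_derivative_transform_within_open[OF _ W]) (rule ex[symmetric])
  from has_derivative_unique[OF D this] have Ds: "D h (A s) = (\<Sum>b\<in>Basis. (A s \<bullet> b) *\<^sub>R D h b)" for h
    by metis
  have "((\<lambda>x. \<Sum>b\<in>Basis. (A x \<bullet> b) *\<^sub>R T x b) has_derivative
      (\<lambda>h. \<Sum>b\<in>Basis. (A s \<bullet> b) *\<^sub>R D h b + (A' h \<bullet> b) *\<^sub>R T s b)) (at s)"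
    by (auto intro!: derivative_eq_intros D A)
  moreover have "(\<Sum>b\<in>Basis. (A s \<bullet> b) *\<^sub>R D h b + (A' h \<bullet> b) *\<^sub>R T s b) = D h (A s) + T s (A' h)" for h
    unfolding Ds by (subst ex[OF W(2), of "A' h"]) (simp add: sum.distrib)
  ultimately have "((\<lambda>x. \<Sum>b\<in>Basis. (A x \<bullet> b) *\<^sub>R T x b) has_derivative (\<lambda>h. D h (A s) + T s (A' h))) (at s)"
    by simp
  then show ?thesis
    by (rule has_derivative_transform_within_open[OF _ W]) (rule ex[symmetric])
qed

text \<open>The mean value theorem applied twice to the second difference, in direction a and then
  in direction b.\<close>

lemma mixed_difference:
  fixes f :: "'x::real_normed_vector \<Rightarrow> real"
  assumes f: "\<And>x. x \<in> W \<Longrightarrow> (f has_derivative f' x) (at x)"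
    and g: "\<And>x. x \<in> W \<Longrightarrow> ((\<lambda>y. f' y a) has_derivative g x) (at x)"
    and h: "0 < h" and W: "\<And>t r. 0 \<le> t \<Longrightarrow> t \<le> h \<Longrightarrow> 0 \<le> r \<Longrightarrow> r \<le> h \<Longrightarrow> s + t *\<^sub>R a + r *\<^sub>R b \<in> W"
  shows "\<exists>t r. 0 \<le> t \<and> t \<le> h \<and> 0 \<le> r \<and> r \<le> h \<and>
    f (s + h *\<^sub>R a + h *\<^sub>R b) - f (s + h *\<^sub>R a) - f (s + h *\<^sub>R b) + f s = h * h * g (s + t *\<^sub>R a + r *\<^sub>R b) b"
proof -
  have W0: "s + t *\<^sub>R a \<in> W" if "0 \<le> t" "t \<le> h" for t
    using W[OF that, of 0] h by simp
  define \<phi> where "\<phi> t = f (s + t *\<^sub>R a + h *\<^sub>R b) - f (s + t *\<^sub>R a)" for t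
  have d1: "DERIV \<phi> t :> f' (s + t *\<^sub>R a + h *\<^sub>R b) a - f' (s + t *\<^sub>R a) a" if t: "0 \<le> t" "t \<le> h" for t
  proof -
    have "((\<lambda>t. f (s + t *\<^sub>R a + h *\<^sub>R b)) has_derivative (\<lambda>k. f' (s + t *\<^sub>R a + h *\<^sub>R b) (k *\<^sub>R a))) (at t)"
      by (rule has_derivative_compose[of "\<lambda>t. s + t *\<^sub>R a + h *\<^sub>R b", OF _ f[OF W[OF t, of h]]]) (use h in \<open>auto intro!: derivative_eq_intros\<close>)
    moreover have "((\<lambda>t. f (s + t *\<^sub>R a)) has_derivative (\<lambda>k. f' (s + t *\<^sub>R a) (k *\<^sub>R a))) (at t)"
      by (rule has_derivative_compose[of "\<lambda>t. s + t *\<^sub>R a", OF _ f[OF W0[OF t]]]) (auto intro!: derivative_eq_intros)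
    moreover have "f' x (k *\<^sub>R a) = k * f' x a" if "x \<in> W" for x k
      using linear_scale[OF has_derivative_linear[OF f[OF that]]] by simp
    ultimately show ?thesis
      unfolding \<phi>_def has_field_derivative_def
      using h by (intro has_derivative_eq_rhs[OF has_derivative_diff])
        (auto simp: fun_eq_iff W W0 t left_diff_distrib right_diff_distrib mult.commute)
  qed
  obtain t where t': "0 < t" "t < h" and
    e1: "\<phi> h - \<phi> 0 = (h - 0) * (f' (s + t *\<^sub>R a + h *\<^sub>R b) a - f' (s + t *\<^sub>R a) a)"
    using MVT2[OF h, of \<phi> "\<lambda>t. f' (s + t *\<^sub>R a + h *\<^sub>R b) a - f' (s + t *\<^sub>R a) a"] d1 by blast
  note t = less_imp_le[OF t'(1)] less_imp_le[OF t'(2)]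
  have d2: "DERIV (\<lambda>r. f' (s + t *\<^sub>R a + r *\<^sub>R b) a) r :> g (s + t *\<^sub>R a + r *\<^sub>R b) b" if r: "0 \<le> r" "r \<le> h" for r
  proof -
    have "((\<lambda>r. f' (s + t *\<^sub>R a + r *\<^sub>R b) a) has_derivative (\<lambda>k. g (s + t *\<^sub>R a + r *\<^sub>R b) (k *\<^sub>R b))) (at r)"
      by (rule has_derivative_compose[of "\<lambda>r. s + t *\<^sub>R a + r *\<^sub>R b", OF _ g[OF W[OF t r]]]) (auto intro!: derivative_eq_intros)
    moreover have "g x (k *\<^sub>R b) = k * g x b" if "x \<in> W" for x k
      using linear_scale[OF has_derivative_linear[OF g[OF that]]] by simp
    ultimately show ?thesis
      unfolding has_field_derivative_def by (simp add: W t r mult.commute[of _ "g _ b"])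
  qed
  obtain r where r': "0 < r" "r < h" and
    e2: "f' (s + t *\<^sub>R a + h *\<^sub>R b) a - f' (s + t *\<^sub>R a + 0 *\<^sub>R b) a = (h - 0) * g (s + t *\<^sub>R a + r *\<^sub>R b) b"
    using MVT2[OF h, of "\<lambda>r. f' (s + t *\<^sub>R a + r *\<^sub>R b) a" "\<lambda>r. g (s + t *\<^sub>R a + r *\<^sub>R b) b"] d2 by blast
  note r = less_imp_le[OF r'(1)] less_imp_le[OF r'(2)]
  show ?thesis
    using t r e1 e2 unfolding \<phi>_def by (intro exI[of _ t] exI[of _ r]) simp
qed

text \<open>Schwarz's theorem. The second difference over a small parallelogram is symmetric in a
  and b, so the two mixed derivatives agree at suitable points near s, and continuity carries this
  to s.\<close>

lemma symmetric_second_derivative: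
  fixes f :: "'x::real_normed_vector \<Rightarrow> real"
  assumes W: "open W" "s \<in> W"
    and f: "\<And>x. x \<in> W \<Longrightarrow> (f has_derivative f' x) (at x)"
    and ga: "\<And>x. x \<in> W \<Longrightarrow> ((\<lambda>y. f' y a) has_derivative ga x) (at x)"
    and gb: "\<And>x. x \<in> W \<Longrightarrow> ((\<lambda>y. f' y b) has_derivative gb x) (at x)"
    and ca: "continuous_on W (\<lambda>x. ga x b)" and cb: "continuous_on W (\<lambda>x. gb x a)"
  shows "ga s b = gb s a"
proof (rule ccontr)
  assume ne: "ga s b \<noteq> gb s a"
  define e where "e = \<bar>ga s b - gb s a\<bar> / 2"
  have e: "e > 0" using ne by (simp add: e_def)
  have "isCont (\<lambda>x. ga x b) s" "isCont (\<lambda>x. gb x a) s"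
    using ca cb W by (simp_all add: continuous_on_eq_continuous_at)
  then obtain d1 d2 where d1: "d1 > 0" "\<And>x. dist x s < d1 \<Longrightarrow> dist (ga x b) (ga s b) < e"
    and d2: "d2 > 0" "\<And>x. dist x s < d2 \<Longrightarrow> dist (gb x a) (gb s a) < e"
    using e unfolding continuous_at_eps_delta by (metis (no_types))
  obtain d3 where d3: "d3 > 0" "\<And>x. dist x s < d3 \<Longrightarrow> x \<in> W"
    using W by (metis open_dist)
  define d where "d = min d1 (min d2 d3)"
  \<comment> \<open>This keeps the whole parallelogram within distance d of s; the summand 1 covers
    the case a = b = 0.\<close>
  define h where "h = d / (norm a + norm b + 1)"
  have d: "d > 0" using d1 d2 d3 by (simp add: d_def)
  have nn: "norm a + norm b + 1 > 0" using norm_ge_zero[of a] norm_ge_zero[of b] by linarith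
  have h: "h > 0" using d nn by (simp add: h_def)
  have near: "dist (s + t *\<^sub>R a + r *\<^sub>R b) s < d" "dist (s + t *\<^sub>R b + r *\<^sub>R a) s < d"
    if "0 \<le> t" "t \<le> h" "0 \<le> r" "r \<le> h" for t r
  proof -
    have *: "norm (t *\<^sub>R a + r *\<^sub>R b) < d" if "0 \<le> t" "t \<le> h" "0 \<le> r" "r \<le> h" for t r
    proof -
      have "norm (t *\<^sub>R a + r *\<^sub>R b) \<le> t * norm a + r * norm b"
        using norm_triangle_ineq[of "t *\<^sub>R a" "r *\<^sub>R b"] that by simp
      also have "\<dots> \<le> h * norm a + h * norm b"
        using that by (intro add_mono mult_right_mono) auto
      also have "\<dots> < h * (norm a + norm b + 1)" using h by (simp add: algebra_simps)
      also have "\<dots> = d" using nn by (simp add: h_def)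
      finally show ?thesis .
    qed
    show "dist (s + t *\<^sub>R a + r *\<^sub>R b) s < d" "dist (s + t *\<^sub>R b + r *\<^sub>R a) s < d"
      using *[OF that] *[OF that(3,4,1,2)] by (simp_all add: dist_norm add.assoc add.commute[of "t *\<^sub>R b"])
  qed
  obtain t r where 1: "0 \<le> t" "t \<le> h" "0 \<le> r" "r \<le> h"
    "f (s + h *\<^sub>R a + h *\<^sub>R b) - f (s + h *\<^sub>R a) - f (s + h *\<^sub>R b) + f s = h * h * ga (s + t *\<^sub>R a + r *\<^sub>R b) b"
    using mixed_difference[OF f ga h, of W s b] near d3(2) by (auto simp: d_def)
  obtain t' r' where 2: "0 \<le> t'" "t' \<le> h" "0 \<le> r'" "r' \<le> h"
    "f (s + h *\<^sub>R b + h *\<^sub>R a) - f (s + h *\<^sub>R b) - f (s + h *\<^sub>R a) + f s = h * h * gb (s + t' *\<^sub>R b + r' *\<^sub>R a) a"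
    using mixed_difference[OF f gb h, of W s a] near d3(2) by (auto simp: d_def)
  have "h * h * ga (s + t *\<^sub>R a + r *\<^sub>R b) b = h * h * gb (s + t' *\<^sub>R b + r' *\<^sub>R a) a"
    using 1(5) 2(5) by (simp add: algebra_simps)
  then have "ga (s + t *\<^sub>R a + r *\<^sub>R b) b = gb (s + t' *\<^sub>R b + r' *\<^sub>R a) a"
    using h by simp
  moreover have "dist (ga (s + t *\<^sub>R a + r *\<^sub>R b) b) (ga s b) < e"
    using near(1)[OF 1(1-4)] by (intro d1(2)) (simp add: d_def)
  moreover have "dist (gb (s + t' *\<^sub>R b + r' *\<^sub>R a) a) (gb s a) < e"
    using near(2)[OF 2(1-4)] by (intro d2(2)) (simp add: d_def)
  ultimately show False
    by (simp add: e_def dist_real_def abs_if split: if_splits)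
qed

section \<open>Differentiability of the induced metric\<close>

lemma det_differentiable:
  fixes M :: "'a::real_normed_vector \<Rightarrow> real^'n^'n"
  assumes "\<And>i j. (\<lambda>x. M x $ i $ j) differentiable (at y)"
  shows "(\<lambda>x. det (M x)) differentiable (at y)"
proof -
  from assms obtain M' where [derivative_intros]: "((\<lambda>x. M x $ i $ j) has_derivative M' i j) (at y)" for i j
    unfolding differentiable_def by metis
  show ?thesis
    unfolding det_def differentiable_def by (rule exI) (rule derivative_intros)+
qed

text \<open>Cramer's rule: the determinant of A x stays nonzero near y, and there J is a quotient of
  polynomials in the entries of A and b.\<close>

lemma implicit_linear_differentiable:
  fixes A :: "'a::real_normed_vector \<Rightarrow> real^'n \<Rightarrow> real^'n"
  assumes U: "open U" "y \<in> U"
    and lin: "\<And>x. x \<in> U \<Longrightarrow> linear (A x)"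
    and dA: "\<And>v i. (\<lambda>x. A x v $ i) differentiable (at y)" and inj: "inj (A y)"
    and b: "\<And>x. x \<in> U \<Longrightarrow> A x (J x) = b x" and db: "\<And>i. (\<lambda>x. b x $ i) differentiable (at y)"
  shows "J differentiable (at y)"
proof -
  define M where "M x = matrix (A x)" for x
  have MA: "M x *v v = A x v" if "x \<in> U" for x v
    unfolding M_def using lin[OF that] by (simp add: linear_matrix_vector_mul_eq matrix_vector_mul)
  have dM: "(\<lambda>x. M x $ i $ j) differentiable (at y)" for i j
    unfolding M_def matrix_def using dA by simp
  have det0: "det (M y) \<noteq> 0"
    using inj det_nz_iff_inj[OF lin[OF U(2)]] by (simp add: M_def)
  have dd: "(\<lambda>x. det (M x)) differentiable (at y)"
    by (rule det_differentiable[OF dM])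
  then have "isCont (\<lambda>x. det (M x)) y"
    by (rule differentiable_imp_continuous_within)
  then obtain V where V: "open V" "y \<in> V" "\<And>x. x \<in> V \<Longrightarrow> det (M x) \<noteq> 0"
    using continuous_at_avoid[of y "\<lambda>x. det (M x)" 0] det0 by (metis mem_ball centre_in_ball open_ball dist_commute)
  define R where "R x = (\<Sum>k\<in>UNIV. (det (\<chi> i j. if j = k then b x $ i else M x $ i $ j) / det (M x)) *\<^sub>R axis k (1::real))" for x
  have "R differentiable (at y)"
    unfolding R_def
  proof (intro differentiable_sum ballI differentiable_scaleR differentiable_divide dd det0 differentiable_const finite)
    fix k
    show "(\<lambda>x. det (\<chi> i j. if j = k then b x $ i else M x $ i $ j)) differentiable (at y)"
      proof (rule det_differentiable)
      fix i j
      show "(\<lambda>x. (\<chi> i j. if j = k then b x $ i else M x $ i $ j) $ i $ j) differentiable (at y)"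
        by (cases "j = k") (simp_all add: db dM)
    qed
  qed
  then obtain R' where R': "(R has_derivative R') (at y)" by (auto simp: differentiable_def)
  have "R x = J x" if "x \<in> U \<inter> V" for x
  proof -
    have "M x *v J x = b x" using that MA b by simp
    then have "J x = (\<chi> k. det (\<chi> i j. if j = k then b x $ i else M x $ i $ j) / det (M x))"
      using cramer[OF V(3)] that by blast
    then show ?thesis
      by (simp add: R_def vec_eq_iff axis_def if_distrib cong: if_cong)
  qed
  then have "(J has_derivative R') (at y)"
    using has_derivative_transform_within_open[OF R', of "U \<inter> V"] U V by auto
  then show ?thesis by (auto simp: differentiable_def)
qed

lemma differentiable_Re: "f differentiable F \<Longrightarrow> (\<lambda>x. Re (f x)) differentiable F"
  and differentiable_Im: "f differentiable F \<Longrightarrow> (\<lambda>x. Im (f x)) differentiable F"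
  unfolding differentiable_def by (metis has_derivative_Re, metis has_derivative_Im)

lemma differentiable_apply_linear:
  fixes T :: "'s::real_normed_vector \<Rightarrow> 'v::euclidean_space \<Rightarrow> 'w::real_normed_vector"
  assumes "open W" "s \<in> W" "\<And>x. x \<in> W \<Longrightarrow> linear (T x)"
    and "\<And>v. (\<lambda>x. T x v) differentiable (at s)" "A differentiable (at s)"
  shows "(\<lambda>x. T x (A x)) differentiable (at s)"
proof -
  from assms(4,5) obtain D A' where "\<And>v. ((\<lambda>x. T x v) has_derivative D v) (at s)"
    "(A has_derivative A') (at s)"
    unfolding differentiable_def by metis
  from has_derivative_apply_linear[OF assms(1-3), where D = "\<lambda>h v. D v h", OF _ this] show ?thesis
    by (auto simp: differentiable_def)
qed

text \<open>No smooth choice of adapted frames is needed: with the frame \<open>f\<close> frozen at \<open>y\<close>, the map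
  \<open>A x v\<close> with complex coordinates \<open>\<Upsilon> x [v, f 2, f 3]\<close>, \<open>\<Upsilon> x [v, f 3, f 1]\<close>, \<open>\<Upsilon> x [v, f 1, f 2]\<close> satisfies
  \<open>A x \<circ> J = J0 \<circ> A x\<close>, which is a linear system for \<open>J\<close> that is invertible near \<open>y\<close>.\<close>

lemma su3_metric_differentiable:
  assumes U: "open U" "y \<in> U" and ad: "\<And>x. x \<in> U \<Longrightarrow> \<exists>u. adapted (\<Omega> x) (\<Upsilon> x) u"
    and d\<Omega>: "\<And>l. (\<lambda>x. \<Omega> x l) differentiable (at y)" and d\<Upsilon>: "\<And>l. (\<lambda>x. \<Upsilon> x l) differentiable (at y)"
  shows "(\<lambda>x. su3_metric (\<Omega> x) (\<Upsilon> x) v w) differentiable (at y)"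
proof -
  obtain u where u: "adapted (\<Omega> y) (\<Upsilon> y) u" using ad U by blast
  define f where "f i = inv u (axis i 1)" for i
  have uf: "u (f i) = axis i 1" for i unfolding f_def by (rule adapted_u_inv[OF u])
  define B where "B i x v = (if i = 1 \<or> i = 4 then \<Upsilon> x [v, f 2, f 3] else if i = 2 \<or> i = 5 then \<Upsilon> x [v, f 3, f 1]
    else \<Upsilon> x [v, f 1, f 2])" for i :: 6 and x v
  define A where "A x v = (\<chi> i. if i = 1 \<or> i = 2 \<or> i = 3 then Re (B i x v) else Im (B i x v))" for x v
  have zA: "zco 1 (A x v) = \<Upsilon> x [v, f 2, f 3]" "zco 2 (A x v) = \<Upsilon> x [v, f 3, f 1]"
    "zco 3 (A x v) = \<Upsilon> x [v, f 1, f 2]" for x v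
    by (simp_all add: zco_def A_def B_def complex_eq_iff)
  have linB: "linear (B i x)" if x: "x \<in> U" for i x
  proof -
    obtain u where "adapted (\<Omega> x) (\<Upsilon> x) u" using ad x by blast
    from alt_form_3D(1)[OF adapted_alt_form(2)[OF this]] have "linear (\<lambda>v. B i x v)"
      unfolding B_def by (cases "i = 1 \<or> i = 4"; cases "i = 2 \<or> i = 5") simp_all
    then show ?thesis .
  qed
  have linA: "linear (A x)" if x: "x \<in> U" for x
    by (rule linearI) (simp_all add: A_def vec_eq_iff linear_add[OF linB[OF x]] linear_scale[OF linB[OF x]])
  have "A y = u"
    by (rule ext) (unfold zco_eq_iff zA, simp add: adapted_Upsilon[OF u] uf Upsilon0_axis)
  then have injA: "inj (A y)" using adapted_bij[OF u] by (simp add: bij_is_inj)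
  have AJ: "A x (su3_J (\<Omega> x) (\<Upsilon> x) w) = J0 (A x w)" if x: "x \<in> U" for x
  proof -
    obtain u where "adapted (\<Omega> x) (\<Upsilon> x) u" using ad x by blast
    then show ?thesis
      unfolding zco_eq_iff zA zco_J0 by (simp add: adapted_Upsilon adapted_J Upsilon0_J0)
  qed
  have dB: "(\<lambda>x. B i x v) differentiable (at y)" for i v
    unfolding B_def using d\<Upsilon> by (cases "i = 1 \<or> i = 4"; cases "i = 2 \<or> i = 5") simp_all
  have dB': "(\<lambda>x. Re (B i x v)) differentiable (at y)" "(\<lambda>x. Im (B i x v)) differentiable (at y)" for i v
    using dB by (rule differentiable_Re, rule differentiable_Im)
  have dA: "(\<lambda>x. A x v $ i) differentiable (at y)" for v i
    unfolding A_def using dB' by (cases "i = 1 \<or> i = 2 \<or> i = 3") simp_all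
  have dJA: "(\<lambda>x. J0 (A x w) $ i) differentiable (at y)" for i
    using exhaust_6[of i] by (elim disjE; hypsubst; unfold J0_nth; intro dA differentiable_minus)
  have dJ: "(\<lambda>x. su3_J (\<Omega> x) (\<Upsilon> x) w) differentiable (at y)"
    by (rule implicit_linear_differentiable[OF U linA dA injA AJ dJA])
  have "(\<lambda>x. \<Omega> x [v, su3_J (\<Omega> x) (\<Upsilon> x) w]) differentiable (at y)"
  proof (rule differentiable_apply_linear[OF U _ d\<Omega> dJ])
    fix x assume "x \<in> U"
    then obtain u where "adapted (\<Omega> x) (\<Upsilon> x) u" using ad by blast
    then show "linear (\<lambda>w. \<Omega> x [v, w])" using adapted_alt_form(1) alt_form_2D(2) by blast
  qed
  then obtain D where D: "((\<lambda>x. \<Omega> x [v, su3_J (\<Omega> x) (\<Upsilon> x) w]) has_derivative D) (at y)"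
    by (auto simp: differentiable_def)
  have "((\<lambda>x. su3_metric (\<Omega> x) (\<Upsilon> x) v w) has_derivative D) (at y)"
  proof (rule has_derivative_transform_within_open[OF D U])
    fix x assume "x \<in> U"
    then obtain u where "adapted (\<Omega> x) (\<Upsilon> x) u" using ad by blast
    then show "\<Omega> x [v, su3_J (\<Omega> x) (\<Upsilon> x) w] = su3_metric (\<Omega> x) (\<Upsilon> x) v w"
      by (simp add: adapted_metric_J)
  qed
  then show ?thesis by (auto simp: differentiable_def)
qed

text \<open>Justifies the definite description in \<open>normal_part\<close>: existence is the
  Euclidean orthogonal decomposition transported by u, uniqueness is definiteness of the
  metric.\<close>

lemma adapted_normal_part:
  fixes E :: "(real^6) set" and v :: "real^6"
  assumes ad: "adapted \<Omega> \<Upsilon> u" and E: "subspace E"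
  defines "n \<equiv> normal_part (su3_metric \<Omega> \<Upsilon>) E v"
  shows "t \<in> E \<Longrightarrow> su3_metric \<Omega> \<Upsilon> n t = 0" "v - n \<in> E"
proof -
  note lin = adapted_linear[OF ad]
  have sub: "subspace (u ` E)" by (rule linear_subspace_image[OF lin E])
  obtain y z where yz: "y \<in> span (u ` E)" "\<And>w. w \<in> span (u ` E) \<Longrightarrow> orthogonal z w" "u v = y + z"
    using orthogonal_subspace_decomp_exists[of "u ` E" "u v"] by metis
  have sp: "span (u ` E) = u ` E" using sub by (rule span_eq_iff[THEN iffD2])
  define m where "m = inv u z"
  have um: "u m = z" by (simp add: m_def adapted_u_inv[OF ad])
  have P: "(\<forall>t\<in>E. su3_metric \<Omega> \<Upsilon> m t = 0) \<and> v - m \<in> E"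
  proof
    show "\<forall>t\<in>E. su3_metric \<Omega> \<Upsilon> m t = 0"
      using yz(2) by (auto simp: adapted_metric[OF ad] um sp orthogonal_def)
    have "u (v - m) \<in> u ` E" using yz(1,3) by (simp add: linear_diff[OF lin] um sp)
    then show "v - m \<in> E" using adapted_bij[OF ad] by (metis bij_is_inj inj_image_mem_iff)
  qed
  have U: "m' = m" if m': "(\<forall>t\<in>E. su3_metric \<Omega> \<Upsilon> m' t = 0) \<and> v - m' \<in> E" for m'
  proof -
    have "(v - m) - (v - m') \<in> E" using subspace_diff[OF E] m' P by blast
    then have *: "m' - m \<in> E" by simp
    have "su3_metric \<Omega> \<Upsilon> (m' - m) (m' - m) = su3_metric \<Omega> \<Upsilon> m' (m' - m) - su3_metric \<Omega> \<Upsilon> m (m' - m)"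
      by (rule linear_diff[OF adapted_linear_metric(1)[OF ad]])
    then show ?thesis using * m' P adapted_metric_eq_0[OF ad, of "m' - m"] by auto
  qed
  have "(\<forall>t\<in>E. su3_metric \<Omega> \<Upsilon> n t = 0) \<and> v - n \<in> E"
  proof -
    have "n = m"
      unfolding n_def normal_part_def 
    proof (rule the_equality)
      show "(\<forall>t\<in>E. su3_metric \<Omega> \<Upsilon> m t = 0) \<and> v - m \<in> E" by (rule P)
    next
      fix m' assume "(\<forall>t\<in>E. su3_metric \<Omega> \<Upsilon> m' t = 0) \<and> v - m' \<in> E"
      then show "m' = m" by (rule U)
    qed
    then show ?thesis using P by simp
  qed
  then show "t \<in> E \<Longrightarrow> su3_metric \<Omega> \<Upsilon> n t = 0" "v - n \<in> E" by auto
qed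

text \<open>Riesz representation for the induced metric; it makes the description in
  \<open>christoffel\<close> determine a vector.\<close>

lemma adapted_riesz:
  assumes ad: "adapted \<Omega> \<Upsilon> u" and f: "linear (f :: real^6 \<Rightarrow> real)"
  shows "\<exists>!a. \<forall>z. su3_metric \<Omega> \<Upsilon> a z = f z"
proof
  note lin = adapted_linear[OF ad]
  have "linear (inv u)"
    using lin adapted_bij[OF ad] by (metis bij_is_inj inj_linear_imp_inv_linear)
  define a where "a = inv u (\<Sum>b\<in>Basis. f (inv u b) *\<^sub>R b)"
  show "\<forall>z. su3_metric \<Omega> \<Upsilon> a z = f z"
  proof
    fix z
    have "su3_metric \<Omega> \<Upsilon> a z = (\<Sum>b\<in>Basis. f (inv u b) *\<^sub>R b) \<bullet> u z"
      by (simp add: adapted_metric[OF ad] a_def adapted_u_inv[OF ad])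
    also have "\<dots> = (\<Sum>b\<in>Basis. f (inv u b) * (b \<bullet> u z))"
      by (simp only: inner_sum_left inner_scaleR_left)
    also have "\<dots> = (\<Sum>b\<in>Basis. f ((u z \<bullet> b) *\<^sub>R inv u b))"
      by (simp add: linear_scale[OF f] inner_commute mult.commute)
    also have "\<dots> = f (inv u (\<Sum>b\<in>Basis. (u z \<bullet> b) *\<^sub>R b))"
      by (simp add: linear_sum[OF f] linear_sum[OF \<open>linear (inv u)\<close>] linear_scale[OF \<open>linear (inv u)\<close>])
    also have "\<dots> = f z" by (simp add: euclidean_representation adapted_inv_u[OF ad])
    finally show "su3_metric \<Omega> \<Upsilon> a z = f z" .
  qed
  fix a' assume a': "\<forall>z. su3_metric \<Omega> \<Upsilon> a' z = f z"
  have "su3_metric \<Omega> \<Upsilon> (a' - a) (a' - a) = 0"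
    using a' \<open>\<forall>z. su3_metric \<Omega> \<Upsilon> a z = f z\<close> by (simp add: linear_diff[OF adapted_linear_metric(1)[OF ad]])
  then show "a' = a" using adapted_metric_eq_0[OF ad, of "a' - a"] by simp
qed

text \<open>At a zero of b the derivative of a drops out. In \<open>cofactor_divergence\<close> the
  factor b vanishes because w is normal, so the cofactors never have to be differentiated
  explicitly.\<close>

lemma has_derivative_mult_zero:
  fixes a b :: "'s::real_normed_vector \<Rightarrow> real"
  assumes "a differentiable (at s)" "(b has_derivative b') (at s)" "b s = 0"
  shows "((\<lambda>x. a x * b x) has_derivative (\<lambda>h. a s * b' h)) (at s)"
proof -
  from assms(1) obtain a' where "(a has_derivative a') (at s)" by (auto simp: differentiable_def)
  from has_derivative_mult[OF this assms(2)] show ?thesis by (simp add: assms(3))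
qed

section \<open>First variation along a special Lagrangian\<close>

lemma differentiable_has_derivative: "f differentiable (at x) \<Longrightarrow> (f has_derivative frechet_derivative f (at x)) (at x)"
  by (simp add: frechet_derivative_works)

text \<open>The determinant of the Hermitian 3 by 3 matrix g - i o, split into det g and a remainder
  that is quadratic in o.\<close>

lemma Re_hermitian_det:
  fixes g11 g12 g13 g22 g23 g33 o12 o13 o23 :: real
  shows "Re (Complex g11 0 * Complex g22 0 * Complex g33 0 - Complex g11 0 * Complex g23 (- o23) * Complex g23 o23
     - Complex g12 (- o12) * Complex g12 o12 * Complex g33 0 + Complex g12 (- o12) * Complex g23 (- o23) * Complex g13 o13
     + Complex g13 (- o13) * Complex g12 o12 * Complex g23 o23 - Complex g13 (- o13) * Complex g22 0 * Complex g13 o13)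
   = g11 * g22 * g33 + 2 * (g12 * g13 * g23) - g11 * (g23 * g23) - g22 * (g13 * g13) - g33 * (g12 * g12)
     - (g11 * (o23 * o23) + g22 * (o13 * o13) + g33 * (o12 * o12)
        - 2 * (g12 * (o23 * o13)) + 2 * (g13 * (o23 * o12)) - 2 * (g23 * (o13 * o12)))"
  by (simp add: algebra_simps)

text \<open>Adjugate over determinant. \<open>matrix_inv\<close> is defined by choice, and the
  two-sided inverse pins it down. The cofactors avoid the entries below the diagonal in order to
  match \<open>C\<close> in the locale \<open>sl_patch\<close>.\<close>

lemma matrix_inv_symmetric_3:
  fixes A :: "real^3^3"
  assumes s: "A $ 2 $ 1 = A $ 1 $ 2" "A $ 3 $ 1 = A $ 1 $ 3" "A $ 3 $ 2 = A $ 2 $ 3"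
  defines "C \<equiv> (\<lambda>(i::3) (j::3).
      if i = 1 then (if j = 1 then A$2$2 * A$3$3 - A$2$3 * A$2$3 else if j = 2 then A$1$3 * A$2$3 - A$1$2 * A$3$3 else A$1$2 * A$2$3 - A$1$3 * A$2$2)
      else if i = 2 then (if j = 1 then A$1$3 * A$2$3 - A$1$2 * A$3$3 else if j = 2 then A$1$1 * A$3$3 - A$1$3 * A$1$3 else A$1$2 * A$1$3 - A$1$1 * A$2$3)
      else (if j = 1 then A$1$2 * A$2$3 - A$1$3 * A$2$2 else if j = 2 then A$1$2 * A$1$3 - A$1$1 * A$2$3 else A$1$1 * A$2$2 - A$1$2 * A$1$2))"
  assumes d: "det A \<noteq> 0"
  shows "matrix_inv A = (\<chi> i j. C i j / det A)"
proof -
  let ?B = "\<chi> i j. C i j / det A"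
  have D: "det A = A$1$1 * C 1 1 + A$1$2 * C 1 2 + A$1$3 * C 1 3"
    by (simp add: det_3 s C_def algebra_simps)
  have "A ** (\<chi> i j. C i j) = mat (det A)"
    unfolding vec_eq_iff forall_3 D
    by (simp add: matrix_matrix_mult_def sum_3 mat_def s C_def algebra_simps)
  moreover have "A ** ?B = (1 / det A) *\<^sub>R (A ** (\<chi> i j. C i j))"
    by (simp add: vec_eq_iff matrix_matrix_mult_def sum_divide_distrib)
  moreover have "(1 / det A) *\<^sub>R mat (det A) = (mat 1 :: real^3^3)"
    using d by (simp add: vec_eq_iff mat_def)
  ultimately have AB: "A ** ?B = mat 1" by simp
  then have BA: "?B ** A = mat 1" by (rule matrix_left_right_inverse[THEN iffD1])
  have "invertible A" using AB BA by (auto simp: invertible_def)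
  then have "matrix_inv A ** A = mat 1"
    unfolding matrix_inv_def invertible_def by (rule someI2_ex) blast
  then have "matrix_inv A ** A ** ?B = ?B" by (simp add: matrix_mul_lid)
  then show ?thesis by (simp add: matrix_mul_assoc[symmetric] AB matrix_mul_rid)
qed

text \<open>One pair of charts: U is the image of the ambient chart, W the part of the parameter
  chart that is mapped into it, F the coordinate expression of the immersion. The analytic
  hypotheses are two continuous derivatives of F and one derivative of the forms.\<close>

locale sl_patch =
  fixes U :: "(real^6) set" and W :: "(real^3) set" and F :: "real^3 \<Rightarrow> real^6"
    and \<Omega> :: "real^6 \<Rightarrow> (real^6, real) form" and \<Upsilon> :: "real^6 \<Rightarrow> (real^6, complex) form" and \<theta> :: real
  assumes openU: "open U" and openW: "open W" and FU: "\<And>s. s \<in> W \<Longrightarrow> F s \<in> U"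
    and dF: "\<And>s. s \<in> W \<Longrightarrow> F differentiable (at s)"
    and dP: "\<And>s v. s \<in> W \<Longrightarrow> (\<lambda>r. frechet_derivative F (at r) v) differentiable (at s)"
    and cQ: "\<And>a b. continuous_on W (\<lambda>s. frechet_derivative (\<lambda>r. frechet_derivative F (at r) a) (at s) b)"
    and ad: "\<And>y. y \<in> U \<Longrightarrow> \<exists>u. adapted (\<Omega> y) (\<Upsilon> y) u"
    and d\<Omega>: "\<And>y l. y \<in> U \<Longrightarrow> (\<lambda>x. \<Omega> x l) differentiable (at y)"
    and d\<Upsilon>: "\<And>y l. y \<in> U \<Longrightarrow> (\<lambda>x. \<Upsilon> x l) differentiable (at y)"
    and sl: "\<And>s. s \<in> W \<Longrightarrow> sl_plane (\<Omega> (F s)) (\<Upsilon> (F s)) \<theta> (range (frechet_derivative F (at s)))"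
    and injF: "\<And>s. s \<in> W \<Longrightarrow> inj (frechet_derivative F (at s))"
begin

definition G where "G y = su3_metric (\<Omega> y) (\<Upsilon> y)"
definition \<phi> where "\<phi> y l = Re (cis (- \<theta>) * \<Upsilon> y l)"
definition \<psi> where "\<psi> y l = Im (cis (- \<theta>) * \<Upsilon> y l)"
definition P where "P i s = frechet_derivative F (at s) (axis i 1)" for i :: 3
definition Q where "Q i j s = frechet_derivative (P j) (at s) (axis i 1)" for i j :: 3
definition DG where "DG y h v w = frechet_derivative (\<lambda>x. G x v w) (at y) h"
definition D\<phi> where "D\<phi> y h l = frechet_derivative (\<lambda>x. \<phi> x l) (at y) h"

lemma dG: "y \<in> U \<Longrightarrow> ((\<lambda>x. G x v w) has_derivative (\<lambda>h. DG y h v w)) (at y)"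
  unfolding DG_def G_def
  by (rule differentiable_has_derivative) (rule su3_metric_differentiable[OF openU _ ad d\<Omega> d\<Upsilon>])

lemma d_phi_differentiable: "y \<in> U \<Longrightarrow> (\<lambda>x. \<phi> x l) differentiable (at y)"
  and d_psi_differentiable: "y \<in> U \<Longrightarrow> (\<lambda>x. \<psi> x l) differentiable (at y)"
  unfolding \<phi>_def \<psi>_def
  by (rule differentiable_Re, rule differentiable_mult[OF differentiable_const d\<Upsilon>], assumption)
     (rule differentiable_Im, rule differentiable_mult[OF differentiable_const d\<Upsilon>], assumption)

lemma d\<phi>: "y \<in> U \<Longrightarrow> ((\<lambda>x. \<phi> x l) has_derivative (\<lambda>h. D\<phi> y h l)) (at y)"
  unfolding D\<phi>_def by (rule differentiable_has_derivative) (rule d_phi_differentiable)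

lemma G_lin: "y \<in> U \<Longrightarrow> linear (\<lambda>v. G y v w)" "y \<in> U \<Longrightarrow> linear (\<lambda>w. G y v w)"
  unfolding G_def using ad adapted_linear_metric by blast+

lemma G_sym: "y \<in> U \<Longrightarrow> G y v w = G y w v"
  unfolding G_def using ad adapted_metric_sym by blast

lemma G_eq_0: "y \<in> U \<Longrightarrow> G y v v = 0 \<longleftrightarrow> v = 0"
  unfolding G_def using ad adapted_metric_eq_0 by blast

lemma \<phi>_alt: "y \<in> U \<Longrightarrow> alt_form 3 (\<phi> y)" and \<psi>_alt: "y \<in> U \<Longrightarrow> alt_form 3 (\<psi> y)"
proof -
  assume y: "y \<in> U"
  then obtain u where u: "adapted (\<Omega> y) (\<Upsilon> y) u" using ad by blast
  have "linear (\<lambda>z. Re (cis (- \<theta>) * z))" "linear (\<lambda>z. Im (cis (- \<theta>) * z))"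
    by (auto intro!: linearI simp: algebra_simps)
  then show "alt_form 3 (\<phi> y)" "alt_form 3 (\<psi> y)"
    unfolding \<phi>_def \<psi>_def by (auto intro: alt_form_bounded_linear[OF adapted_alt_form(2)[OF u]])
qed

lemma \<Omega>_alt: "y \<in> U \<Longrightarrow> alt_form 2 (\<Omega> y)"
  using ad adapted_alt_form(1) by blast

text \<open>The common phase cancels against its conjugate, so the determinant identity has the same
  shape for every \<theta>.\<close>

lemma mult_cnj: 
  fixes a b :: complex
  shows "Re (cis (- \<theta>) * a) * Re (cis (- \<theta>) * b) + Im (cis (- \<theta>) * a) * Im (cis (- \<theta>) * b) = Re (a * cnj b)"
proof -
  have gen: "Re x * Re y + Im x * Im y = Re (x * cnj y)" for x y by simp
  have "(cis (- \<theta>) * a) * cnj (cis (- \<theta>) * b) = (cis (- \<theta>) * cnj (cis (- \<theta>))) * (a * cnj b)"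
    by (simp only: complex_cnj_mult mult_ac)
  also have "\<dots> = a * cnj b" by (simp add: cis_cnj cis_mult)
  finally show ?thesis by (simp only: gen)
qed

lemma P_range: "P i s \<in> range (frechet_derivative F (at s))"
  by (simp add: P_def)

lemma \<Omega>_P: "s \<in> W \<Longrightarrow> \<Omega> (F s) [P i s, P j s] = 0"
  using sl[of s] P_range unfolding sl_plane_def by blast

lemma \<psi>_P: "s \<in> W \<Longrightarrow> \<psi> (F s) [P i s, P j s, P k s] = 0"
proof -
  assume "s \<in> W"
  from sl[OF this, unfolded sl_plane_def, THEN conjunct2, THEN conjunct2, THEN conjunct2]
  have "\<forall>v\<in>range (frechet_derivative F (at s)). \<forall>w\<in>range (frechet_derivative F (at s)).
      \<forall>z\<in>range (frechet_derivative F (at s)). \<psi> (F s) [v, w, z] = 0"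
    unfolding \<psi>_def .
  then show ?thesis using P_range by blast
qed

abbreviation g where "g i j s \<equiv> G (F s) (P i s) (P j s)"

text \<open>The adjugate of the Gram matrix \<open>g\<close>, written without the entries below the
  diagonal so that its symmetry is seen by unfolding.\<close>

definition C where "C i j s =
  (if i = 1 then (if j = 1 then g 2 2 s * g 3 3 s - g 2 3 s * g 2 3 s else if j = 2 then g 1 3 s * g 2 3 s - g 1 2 s * g 3 3 s
     else g 1 2 s * g 2 3 s - g 1 3 s * g 2 2 s)
   else if i = 2 then (if j = 1 then g 1 3 s * g 2 3 s - g 1 2 s * g 3 3 s else if j = 2 then g 1 1 s * g 3 3 s - g 1 3 s * g 1 3 s
     else g 1 2 s * g 1 3 s - g 1 1 s * g 2 3 s)
   else (if j = 1 then g 1 2 s * g 2 3 s - g 1 3 s * g 2 2 s else if j = 2 then g 1 2 s * g 1 3 s - g 1 1 s * g 2 3 s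
     else g 1 1 s * g 2 2 s - g 1 2 s * g 1 2 s))" for i j :: 3

text \<open>Up to sign the volume density: its square is the determinant of the induced
  metric.\<close>

abbreviation \<Phi> where "\<Phi> s \<equiv> \<phi> (F s) [P 1 s, P 2 s, P 3 s]"

text \<open>The determinant identity polarised in one slot. On tangent vectors \<Omega> and \<psi>
  vanish, so all columns of the Hermitian determinant except that of w are real; expanding along the
  column of w gives cofactors times the real parts of its entries.\<close>

lemma phi_cofactor:
  assumes s: "s \<in> W"
  shows "\<Phi> s * \<phi> (F s) [w, P 2 s, P 3 s] = C 1 1 s * G (F s) w (P 1 s) + C 1 2 s * G (F s) w (P 2 s) + C 1 3 s * G (F s) w (P 3 s)"
    "\<Phi> s * \<phi> (F s) [P 1 s, w, P 3 s] = C 2 1 s * G (F s) w (P 1 s) + C 2 2 s * G (F s) w (P 2 s) + C 2 3 s * G (F s) w (P 3 s)"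
    "\<Phi> s * \<phi> (F s) [P 1 s, P 2 s, w] = C 3 1 s * G (F s) w (P 1 s) + C 3 2 s * G (F s) w (P 2 s) + C 3 3 s * G (F s) w (P 3 s)"
proof -
  have y: "F s \<in> U" by (rule FU[OF s])
  then obtain u where u: "adapted (\<Omega> (F s)) (\<Upsilon> (F s)) u" using ad by blast
  have h: "su3_herm (\<Omega> (F s)) (\<Upsilon> (F s)) (P i s) (P j s) = of_real (g i j s)" for i j
    by (simp add: su3_herm_def \<Omega>_P[OF s] G_def complex_eq_iff)
  have hw: "Re (su3_herm (\<Omega> (F s)) (\<Upsilon> (F s)) (P i s) w) = G (F s) w (P i s)" for i
    using G_sym[OF y, of w "P i s"] by (simp add: su3_herm_def G_def)
  have *: "\<Phi> s * \<phi> (F s) [b1, b2, b3] = Re (\<Upsilon> (F s) [P 1 s, P 2 s, P 3 s] * cnj (\<Upsilon> (F s) [b1, b2, b3]))" for b1 b2 b3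
    using mult_cnj[of "\<Upsilon> (F s) [P 1 s, P 2 s, P 3 s]" "\<Upsilon> (F s) [b1, b2, b3]"] \<psi>_P[OF s, of 1 2 3]
    by (simp add: \<phi>_def \<psi>_def)
  have sy: "g 2 1 s = g 1 2 s" "g 3 1 s = g 1 3 s" "g 3 2 s = g 2 3 s"
    using G_sym[OF y] by auto
  show "\<Phi> s * \<phi> (F s) [w, P 2 s, P 3 s] = C 1 1 s * G (F s) w (P 1 s) + C 1 2 s * G (F s) w (P 2 s) + C 1 3 s * G (F s) w (P 3 s)"
    unfolding * adapted_mult_cnj[OF u] h
    by (simp add: hw C_def sy[simplified] algebra_simps)
  show "\<Phi> s * \<phi> (F s) [P 1 s, w, P 3 s] = C 2 1 s * G (F s) w (P 1 s) + C 2 2 s * G (F s) w (P 2 s) + C 2 3 s * G (F s) w (P 3 s)"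
    unfolding * adapted_mult_cnj[OF u] h
    by (simp add: hw C_def sy[simplified] algebra_simps)
  show "\<Phi> s * \<phi> (F s) [P 1 s, P 2 s, w] = C 3 1 s * G (F s) w (P 1 s) + C 3 2 s * G (F s) w (P 2 s) + C 3 3 s * G (F s) w (P 3 s)"
    unfolding * adapted_mult_cnj[OF u] h
    by (simp add: hw C_def sy[simplified] algebra_simps)
qed

lemma C_sym: "C j i s = C i j s"
  by (simp add: C_def)

lemma P_indep:
  assumes s: "s \<in> W" and z: "a *\<^sub>R P 1 s + b *\<^sub>R P 2 s + c *\<^sub>R P 3 s = 0"
  shows "a = 0 \<and> b = 0 \<and> c = 0"
proof -
  have lin: "linear (frechet_derivative F (at s))"
    using differentiable_has_derivative[OF dF[OF s]] by (rule has_derivative_linear)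
  have "frechet_derivative F (at s) (a *\<^sub>R axis 1 1 + b *\<^sub>R axis 2 1 + c *\<^sub>R axis 3 1) = 0"
    using z by (simp add: P_def linear_add[OF lin] linear_scale[OF lin])
  then have "a *\<^sub>R axis 1 1 + b *\<^sub>R axis 2 1 + c *\<^sub>R axis (3::3) (1::real) = 0"
    using injF[OF s] linear_injective_0[OF lin] by blast
  then show ?thesis by (simp add: vec_eq_iff forall_3 axis_def)
qed

text \<open>If \<Phi> were zero, the third cofactor formula and nondegeneracy of the metric would
  give a linear relation among the coordinate tangent vectors. Its last coefficient is the Gram
  determinant of the first two, which must then vanish, against their independence.\<close>

lemma \<Phi>_nonzero: assumes s: "s \<in> W" shows "\<Phi> s \<noteq> 0"
proof
  assume z: "\<Phi> s = 0"
  have y: "F s \<in> U" by (rule FU[OF s])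
  have "G (F s) w (C 3 1 s *\<^sub>R P 1 s + C 3 2 s *\<^sub>R P 2 s + C 3 3 s *\<^sub>R P 3 s) = 0" for w
    using phi_cofactor(3)[OF s, of w] z by (simp add: linear_add[OF G_lin(2)[OF y]] linear_scale[OF G_lin(2)[OF y]])
  then have "C 3 1 s *\<^sub>R P 1 s + C 3 2 s *\<^sub>R P 2 s + C 3 3 s *\<^sub>R P 3 s = 0"
    using G_eq_0[OF y] by blast
  then have "C 3 3 s = 0" using P_indep[OF s] by blast
  then have c: "g 1 1 s * g 2 2 s - g 1 2 s * g 1 2 s = 0" by (simp add: C_def)
  \<comment> \<open>The part of \<open>P 1 s\<close> orthogonal to \<open>P 2 s\<close>, multiplied
    by \<open>g 2 2 s\<close>; its square length is a multiple of the Gram determinant.\<close>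
  define v where "v = g 2 2 s *\<^sub>R P 1 s - g 1 2 s *\<^sub>R P 2 s"
  have "G (F s) v v = g 2 2 s * (g 1 1 s * g 2 2 s - g 1 2 s * g 1 2 s)"
    using G_sym[OF y, of "P 2 s" "P 1 s"]
    by (simp add: v_def linear_diff[OF G_lin(1)[OF y]] linear_diff[OF G_lin(2)[OF y]]
        linear_scale[OF G_lin(1)[OF y]] linear_scale[OF G_lin(2)[OF y]] algebra_simps)
  then have "v = 0" using c G_eq_0[OF y] by simp
  then have "g 2 2 s = 0" using P_indep[OF s, of "g 2 2 s" "- g 1 2 s" 0] by (simp add: v_def)
  then have "P 2 s = 0" using G_eq_0[OF y] by blast
  then show False using P_indep[OF s, of 0 1 0] by simp
qed


section \<open>Derivatives of the metric and of \<phi> along the patch\<close>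

lemma dF': "s \<in> W \<Longrightarrow> (F has_derivative frechet_derivative F (at s)) (at s)"
  by (rule differentiable_has_derivative[OF dF])

lemma dP': "s \<in> W \<Longrightarrow> (P j has_derivative frechet_derivative (P j) (at s)) (at s)"
  using dP unfolding P_def by (rule differentiable_has_derivative)

text \<open>The symmetry holds on the open set U and passes to the derivative by uniqueness;
  \<open>DG_linear\<close> and \<open>D\<phi>_swap\<close> are obtained in the same way.\<close>

lemma DG_sym: assumes y: "y \<in> U" shows "DG y h v w = DG y h w v"
proof -
  have "((\<lambda>x. G x w v) has_derivative (\<lambda>h. DG y h v w)) (at y)"
    by (rule has_derivative_transform_within_open[OF dG[OF y] openU y]) (rule G_sym)
  from has_derivative_unique[OF this dG[OF y]] show ?thesis by metis
qed

lemma DG_linear: assumes y: "y \<in> U" shows "linear (DG y h v)"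
proof (rule linearI)
  fix a b r
  have "((\<lambda>x. G x v a + G x v b) has_derivative (\<lambda>h. DG y h v a + DG y h v b)) (at y)"
    by (intro derivative_intros dG[OF y])
  then have "((\<lambda>x. G x v (a + b)) has_derivative (\<lambda>h. DG y h v a + DG y h v b)) (at y)"
    by (rule has_derivative_transform_within_open[OF _ openU y]) (simp add: linear_add[OF G_lin(2)])
  from has_derivative_unique[OF this dG[OF y]] show "DG y h v (a + b) = DG y h v a + DG y h v b" by metis
  have "((\<lambda>x. r *\<^sub>R G x v a) has_derivative (\<lambda>h. r *\<^sub>R DG y h v a)) (at y)"
    by (intro derivative_intros dG[OF y])
  then have "((\<lambda>x. G x v (r *\<^sub>R a)) has_derivative (\<lambda>h. r *\<^sub>R DG y h v a)) (at y)"
    by (rule has_derivative_transform_within_open[OF _ openU y]) (simp add: linear_scale[OF G_lin(2)])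
  from has_derivative_unique[OF this dG[OF y]] show "DG y h v (r *\<^sub>R a) = r *\<^sub>R DG y h v a" by metis
qed

lemma D\<phi>_swap: assumes y: "y \<in> U"
  shows "D\<phi> y h [a, b, c] = - D\<phi> y h [b, a, c]" "D\<phi> y h [a, b, c] = - D\<phi> y h [a, c, b]"
proof -
  have "((\<lambda>x. \<phi> x [a, b, c]) has_derivative (\<lambda>h. - D\<phi> y h [b, a, c])) (at y)"
    by (rule has_derivative_transform_within_open[OF has_derivative_minus[OF d\<phi>[OF y]] openU y])
       (rule alt_form_3D(7)[OF \<phi>_alt, symmetric])
  from has_derivative_unique[OF d\<phi>[OF y] this] show "D\<phi> y h [a, b, c] = - D\<phi> y h [b, a, c]" by metis
  have "((\<lambda>x. \<phi> x [a, b, c]) has_derivative (\<lambda>h. - D\<phi> y h [a, c, b])) (at y)"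
    by (rule has_derivative_transform_within_open[OF has_derivative_minus[OF d\<phi>[OF y]] openU y])
       (rule alt_form_3D(9)[OF \<phi>_alt, symmetric])
  from has_derivative_unique[OF d\<phi>[OF y] this] show "D\<phi> y h [a, b, c] = - D\<phi> y h [a, c, b]" by metis
qed

lemma dG_comp:
  assumes s: "s \<in> W"
  shows "((\<lambda>r. G (F r) w (P j r)) has_derivative
    (\<lambda>h. DG (F s) (frechet_derivative F (at s) h) w (P j s) + G (F s) w (frechet_derivative (P j) (at s) h))) (at s)"
  by (rule has_derivative_apply_linear[OF openW s, of "\<lambda>r. G (F r) w"])
     (rule G_lin(2)[OF FU] has_derivative_compose[OF dF'[OF s] dG[OF FU[OF s]]] dP'[OF s] | assumption)+

text \<open>The varying arguments are inserted one at a time; the result of each stage is the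
  derivative hypothesis of the next.\<close>

lemma d\<phi>_comp:
  assumes s: "s \<in> W" and X: "(X has_derivative X') (at s)" and Y: "(Y has_derivative Y') (at s)"
    and Z: "(Z has_derivative Z') (at s)"
  shows "((\<lambda>r. \<phi> (F r) [X r, Y r, Z r]) has_derivative
    (\<lambda>h. D\<phi> (F s) (frechet_derivative F (at s) h) [X s, Y s, Z s] + \<phi> (F s) [X' h, Y s, Z s]
       + \<phi> (F s) [X s, Y' h, Z s] + \<phi> (F s) [X s, Y s, Z' h])) (at s)"
proof -
  let ?F' = "frechet_derivative F (at s)"
  note alt = \<phi>_alt[OF FU]
  have 0: "((\<lambda>r. \<phi> (F r) l) has_derivative (\<lambda>h. D\<phi> (F s) (?F' h) l)) (at s)" for l
    by (rule has_derivative_compose[OF dF'[OF s] d\<phi>[OF FU[OF s]]])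
  have 1: "((\<lambda>r. \<phi> (F r) [X r, b, c]) has_derivative
      (\<lambda>h. D\<phi> (F s) (?F' h) [X s, b, c] + \<phi> (F s) [X' h, b, c])) (at s)" for b c
    by (rule has_derivative_apply_linear[OF openW s, of "\<lambda>r v. \<phi> (F r) [v, b, c]", OF _ 0 X])
       (rule alt_form_3D(1)[OF alt])
  have 2: "((\<lambda>r. \<phi> (F r) [X r, Y r, c]) has_derivative
      (\<lambda>h. (D\<phi> (F s) (?F' h) [X s, Y s, c] + \<phi> (F s) [X' h, Y s, c]) + \<phi> (F s) [X s, Y' h, c])) (at s)" for c
    by (rule has_derivative_apply_linear[OF openW s, of "\<lambda>r v. \<phi> (F r) [X r, v, c]", OF _ 1 Y])
       (rule alt_form_3D(2)[OF alt])
  show ?thesis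
    by (rule has_derivative_apply_linear[OF openW s, of "\<lambda>r v. \<phi> (F r) [X r, Y r, v]", OF _ 2 Z])
       (rule alt_form_3D(3)[OF alt])
qed

lemma g_differentiable: assumes s: "s \<in> W" shows "(\<lambda>r. g i j r) differentiable (at s)"
proof (rule differentiable_apply_linear[OF openW s, of "\<lambda>r v. G (F r) v (P j r)"])
  show "linear (\<lambda>v. G (F x) v (P j x))" if "x \<in> W" for x
    by (rule G_lin(1)[OF FU[OF that]])
  show "(\<lambda>r. G (F r) v (P j r)) differentiable (at s)" for v
    using dG_comp[OF s] by (auto simp: differentiable_def)
  show "P i differentiable (at s)"
    using dP'[OF s] by (auto simp: differentiable_def)
qed

lemma C_differentiable: assumes s: "s \<in> W" shows "(\<lambda>r. C i j r) differentiable (at s)"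
  unfolding C_def
  by (cases "i = 1"; cases "i = 2"; cases "j = 1"; cases "j = 2"; simp)
     (intro differentiable_diff differentiable_mult g_differentiable[OF s])+

lemma \<Phi>_differentiable: assumes s: "s \<in> W" shows "(\<lambda>r. \<Phi> r) differentiable (at s)"
  using d\<phi>_comp[OF s dP'[OF s] dP'[OF s] dP'[OF s]] by (auto simp: differentiable_def)

lemma FP: "frechet_derivative F (at s) (axis i 1) = P i s"
  and PQ: "frechet_derivative (P j) (at s) (axis i 1) = Q i j s"
  by (simp_all add: P_def Q_def)

lemma Q_sym: assumes s: "s \<in> W" shows "Q i j s = Q j i s"
proof (subst vec_eq_iff, rule allI)
  fix k
  have 1: "((\<lambda>r. F r $ k) has_derivative (\<lambda>v. frechet_derivative F (at x) v $ k)) (at x)" if "x \<in> W" for x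
    by (rule bounded_linear.has_derivative[OF bounded_linear_vec_nth dF'[OF that]])
  have 2: "((\<lambda>r. frechet_derivative F (at r) (axis j 1) $ k) has_derivative
      (\<lambda>v. frechet_derivative (P j) (at x) v $ k)) (at x)" if "x \<in> W" for x j
    using bounded_linear.has_derivative[OF bounded_linear_vec_nth dP'[OF that, of j]] by (simp add: P_def)
  have 3: "continuous_on W (\<lambda>x. frechet_derivative (P j) (at x) v $ k)" for j v
    using cQ[of "axis j 1" v] unfolding P_def by (intro continuous_intros)
  show "Q i j s $ k = Q j i s $ k"
    using symmetric_second_derivative[OF openW s 1 2[where j = j] 2[where j = i] 3[of j "axis i 1"] 3[of i "axis j 1"]]
    unfolding Q_def .
qed

text \<open>The identity \<open>\<phi>\<^sup>2 + \<psi>\<^sup>2 = det (g - i \<Omega>)\<close> differentiated in the base point: \<open>\<psi>\<close> and \<open>\<Omega>\<close> occur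
  quadratically and vanish on the tangent plane.\<close>

lemma cofactor_variation:
  assumes s: "s \<in> W"
  shows "2 * \<Phi> s * D\<phi> (F s) h [P 1 s, P 2 s, P 3 s] = (\<Sum>i\<in>UNIV. \<Sum>j\<in>UNIV. C i j s * DG (F s) h (P i s) (P j s))"
proof -
  define y where "y = F s"
  have y: "y \<in> U" using FU[OF s] by (simp add: y_def)
  \<comment> \<open>The tangent vectors are frozen at s while the base point moves, also off the
    submanifold, so the determinant identity is needed with \<psi> and \<Omega> still
    present.\<close>
  define a where "a i = P i s" for i
  define l where "l = [a 1, a 2, a 3]"
  define om where "om i j x = \<Omega> x [a i, a j]" for i j x
  define p where "p x = G x (a 1) (a 1) * G x (a 2) (a 2) * G x (a 3) (a 3) + 2 * (G x (a 1) (a 2) * G x (a 1) (a 3) * G x (a 2) (a 3))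
     - G x (a 1) (a 1) * (G x (a 2) (a 3) * G x (a 2) (a 3)) - G x (a 2) (a 2) * (G x (a 1) (a 3) * G x (a 1) (a 3))
     - G x (a 3) (a 3) * (G x (a 1) (a 2) * G x (a 1) (a 2))" for x
  define q where "q x = G x (a 1) (a 1) * (om 2 3 x * om 2 3 x) + G x (a 2) (a 2) * (om 1 3 x * om 1 3 x) + G x (a 3) (a 3) * (om 1 2 x * om 1 2 x)
        - 2 * (G x (a 1) (a 2) * (om 2 3 x * om 1 3 x)) + 2 * (G x (a 1) (a 3) * (om 2 3 x * om 1 2 x)) - 2 * (G x (a 2) (a 3) * (om 1 3 x * om 1 2 x))" for x
  have id: "\<phi> x l * \<phi> x l + \<psi> x l * \<psi> x l = p x - q x" if x: "x \<in> U" for x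
  proof -
    obtain u where u: "adapted (\<Omega> x) (\<Upsilon> x) u" using ad x by blast
    have h: "su3_herm (\<Omega> x) (\<Upsilon> x) (a i) (a j) = Complex (G x (a i) (a j)) (- om i j x)" for i j
      by (simp add: su3_herm_def G_def om_def)
    have om: "om i i x = 0" "om 2 1 x = - om 1 2 x" "om 3 1 x = - om 1 3 x" "om 3 2 x = - om 2 3 x" for i
      unfolding om_def using alt_form_2D(3,4)[OF \<Omega>_alt[OF x]] by blast+
    have "\<phi> x l * \<phi> x l + \<psi> x l * \<psi> x l = Re (\<Upsilon> x l * cnj (\<Upsilon> x l))"
      unfolding \<phi>_def \<psi>_def by (rule mult_cnj)
    also have "\<dots> = p x - q x"
      unfolding l_def adapted_mult_cnj[OF u] h om
        G_sym[OF x, of "a 2" "a 1"] G_sym[OF x, of "a 3" "a 1"] G_sym[OF x, of "a 3" "a 2"] p_def q_def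
        minus_minus minus_zero
      by (rule Re_hermitian_det)
    finally show ?thesis .
  qed
  have omy: "om i j y = 0" for i j by (simp add: om_def y_def a_def \<Omega>_P[OF s])
  have psiy: "\<psi> y l = 0" by (simp add: l_def y_def a_def \<psi>_P[OF s])
  obtain ps where ps: "((\<lambda>x. \<psi> x l) has_derivative ps) (at y)"
    using d_psi_differentiable[OF y] by (auto simp: differentiable_def)
  define om' where "om' i j = frechet_derivative (om i j) (at y)" for i j
  have om': "(om i j has_derivative om' i j) (at y)" for i j
    unfolding om'_def by (rule differentiable_has_derivative) (unfold om_def[abs_def], rule d\<Omega>[OF y])
  have L: "((\<lambda>x. \<phi> x l * \<phi> x l + \<psi> x l * \<psi> x l) has_derivative (\<lambda>h. 2 * \<phi> y l * D\<phi> y h l)) (at y)"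
    by (rule has_derivative_eq_rhs[OF has_derivative_add[OF has_derivative_mult[OF d\<phi>[OF y] d\<phi>[OF y]] has_derivative_mult[OF ps ps]]])
       (simp add: psiy fun_eq_iff)
  note dG' = dG[OF y, THEN has_derivative_eq_rhs] om'[THEN has_derivative_eq_rhs]
  have q: "(q has_derivative (\<lambda>h. 0)) (at y)"
    unfolding q_def by (auto intro!: derivative_eq_intros dG' simp: omy)
  \<comment> \<open>Jacobi's formula: the derivative of a determinant is the adjugate contracted
    with the derivative of the matrix.\<close>
  have p: "(p has_derivative (\<lambda>h. \<Sum>i\<in>UNIV. \<Sum>j\<in>UNIV. C i j s * DG (F s) h (P i s) (P j s))) (at y)"
    unfolding p_def
    by (auto intro!: derivative_eq_intros dG' simp: fun_eq_iff sum_3 C_def y_def[symmetric] a_def[symmetric]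
        DG_sym[OF y, of _ "a 2" "a 1"] DG_sym[OF y, of _ "a 3" "a 1"] DG_sym[OF y, of _ "a 3" "a 2"] algebra_simps)
  have "((\<lambda>x. p x - q x) has_derivative (\<lambda>h. (\<Sum>i\<in>UNIV. \<Sum>j\<in>UNIV. C i j s * DG (F s) h (P i s) (P j s)) - 0)) (at y)"
    by (intro derivative_intros p q)
  then have "((\<lambda>x. \<phi> x l * \<phi> x l + \<psi> x l * \<psi> x l) has_derivative
      (\<lambda>h. (\<Sum>i\<in>UNIV. \<Sum>j\<in>UNIV. C i j s * DG (F s) h (P i s) (P j s)) - 0)) (at y)"
    by (rule has_derivative_transform_within_open[OF _ openU y]) (rule id[symmetric])
  from has_derivative_unique[OF L this] show ?thesis
    unfolding l_def y_def a_def by (simp add: fun_eq_iff)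
qed


text \<open>The divergence of the identities \<open>phi_cofactor\<close>; the second derivatives inside \<open>\<phi>\<close> cancel by
  antisymmetry.\<close>

lemma cofactor_divergence:
  assumes s: "s \<in> W" and w: "\<And>i. G (F s) w (P i s) = 0"
  shows "\<Phi> s * (D\<phi> (F s) (P 1 s) [w, P 2 s, P 3 s] + D\<phi> (F s) (P 2 s) [P 1 s, w, P 3 s] + D\<phi> (F s) (P 3 s) [P 1 s, P 2 s, w])
     = (\<Sum>i\<in>UNIV. \<Sum>j\<in>UNIV. C i j s * (DG (F s) (P i s) w (P j s) + G (F s) w (Q i j s)))"
proof -
  note P' = dP'[OF s]
  have y: "F s \<in> U" by (rule FU[OF s])
  have const: "((\<lambda>r. w) has_derivative (\<lambda>h. 0)) (at s)" by (rule has_derivative_const)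
  have z: "\<phi> (F s) [0, b, c] = 0" "\<phi> (F s) [b, 0, c] = 0" "\<phi> (F s) [b, c, 0] = 0" for b c
    using linear_0[OF alt_form_3D(1)[OF \<phi>_alt[OF y]]] linear_0[OF alt_form_3D(2)[OF \<phi>_alt[OF y]]]
      linear_0[OF alt_form_3D(3)[OF \<phi>_alt[OF y]]] by auto
  \<comment> \<open>As w is normal and \<Phi> nonzero, \<phi> vanishes with w in any slot. Each
    product in the identities thus has a factor that is zero at s.\<close>
  have w0: "\<phi> (F s) [w, P 2 s, P 3 s] = 0" "\<phi> (F s) [P 1 s, w, P 3 s] = 0" "\<phi> (F s) [P 1 s, P 2 s, w] = 0"
    using phi_cofactor[OF s, of w] w \<Phi>_nonzero[OF s] by auto
  have dcof: "((\<lambda>r. C i 1 r * G (F r) w (P 1 r) + C i 2 r * G (F r) w (P 2 r) + C i 3 r * G (F r) w (P 3 r))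
      has_derivative (\<lambda>h. \<Sum>j\<in>UNIV. C i j s * (DG (F s) (frechet_derivative F (at s) h) w (P j s) + G (F s) w (frechet_derivative (P j) (at s) h)))) (at s)" for i
    unfolding sum_3
    by (intro has_derivative_add has_derivative_mult_zero C_differentiable[OF s] dG_comp[OF s] w)
  have "\<Phi> s * (D\<phi> (F s) (frechet_derivative F (at s) h) [w, P 2 s, P 3 s] + \<phi> (F s) [w, frechet_derivative (P 2) (at s) h, P 3 s]
        + \<phi> (F s) [w, P 2 s, frechet_derivative (P 3) (at s) h])
      = (\<Sum>j\<in>UNIV. C 1 j s * (DG (F s) (frechet_derivative F (at s) h) w (P j s) + G (F s) w (frechet_derivative (P j) (at s) h)))" for h
    using has_derivative_unique[OF
        has_derivative_transform_within_open[OF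
          has_derivative_mult_zero[OF \<Phi>_differentiable[OF s] d\<phi>_comp[OF s const P'[of 2] P'[of 3]] w0(1)] openW s phi_cofactor(1)] dcof]
    by (simp only: z add_0_right add_0) metis
  \<comment> \<open>The identity for slot i is differentiated along the i-th coordinate, as in a
    divergence.\<close>
  from this[of "axis 1 1"]
  have e1: "\<Phi> s * (D\<phi> (F s) (P 1 s) [w, P 2 s, P 3 s] + \<phi> (F s) [w, Q 1 2 s, P 3 s] + \<phi> (F s) [w, P 2 s, Q 1 3 s])
      = (\<Sum>j\<in>UNIV. C 1 j s * (DG (F s) (P 1 s) w (P j s) + G (F s) w (Q 1 j s)))"
    unfolding FP PQ .
  have "\<Phi> s * (D\<phi> (F s) (frechet_derivative F (at s) h) [P 1 s, w, P 3 s] + \<phi> (F s) [frechet_derivative (P 1) (at s) h, w, P 3 s]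
        + \<phi> (F s) [P 1 s, w, frechet_derivative (P 3) (at s) h])
      = (\<Sum>j\<in>UNIV. C 2 j s * (DG (F s) (frechet_derivative F (at s) h) w (P j s) + G (F s) w (frechet_derivative (P j) (at s) h)))" for h
    using has_derivative_unique[OF
        has_derivative_transform_within_open[OF
          has_derivative_mult_zero[OF \<Phi>_differentiable[OF s] d\<phi>_comp[OF s P'[of 1] const P'[of 3]] w0(2)] openW s phi_cofactor(2)] dcof]
    by (simp only: z add_0_right add_0) metis
  from this[of "axis 2 1"]
  have e2: "\<Phi> s * (D\<phi> (F s) (P 2 s) [P 1 s, w, P 3 s] + \<phi> (F s) [Q 2 1 s, w, P 3 s] + \<phi> (F s) [P 1 s, w, Q 2 3 s])
      = (\<Sum>j\<in>UNIV. C 2 j s * (DG (F s) (P 2 s) w (P j s) + G (F s) w (Q 2 j s)))"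
    unfolding FP PQ .
  have "\<Phi> s * (D\<phi> (F s) (frechet_derivative F (at s) h) [P 1 s, P 2 s, w] + \<phi> (F s) [frechet_derivative (P 1) (at s) h, P 2 s, w]
        + \<phi> (F s) [P 1 s, frechet_derivative (P 2) (at s) h, w])
      = (\<Sum>j\<in>UNIV. C 3 j s * (DG (F s) (frechet_derivative F (at s) h) w (P j s) + G (F s) w (frechet_derivative (P j) (at s) h)))" for h
    using has_derivative_unique[OF
        has_derivative_transform_within_open[OF
          has_derivative_mult_zero[OF \<Phi>_differentiable[OF s] d\<phi>_comp[OF s P'[of 1] P'[of 2] const] w0(3)] openW s phi_cofactor(3)] dcof]
    by (simp only: z add_0_right add_0) metis
  from this[of "axis 3 1"]
  have e3: "\<Phi> s * (D\<phi> (F s) (P 3 s) [P 1 s, P 2 s, w] + \<phi> (F s) [Q 3 1 s, P 2 s, w] + \<phi> (F s) [P 1 s, Q 3 2 s, w])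
      = (\<Sum>j\<in>UNIV. C 3 j s * (DG (F s) (P 3 s) w (P j s) + G (F s) w (Q 3 j s)))"
    unfolding FP PQ .
  have cancel: "\<phi> (F s) [Q 2 1 s, w, P 3 s] = - \<phi> (F s) [w, Q 1 2 s, P 3 s]"
    "\<phi> (F s) [Q 3 1 s, P 2 s, w] = - \<phi> (F s) [w, P 2 s, Q 1 3 s]"
    "\<phi> (F s) [P 1 s, Q 3 2 s, w] = - \<phi> (F s) [P 1 s, w, Q 2 3 s]"
    unfolding Q_sym[OF s, of 2 1] Q_sym[OF s, of 3 1] Q_sym[OF s, of 3 2]
    by (rule alt_form_3D(7)[OF \<phi>_alt[OF y]], rule alt_form_3D(8)[OF \<phi>_alt[OF y]], rule alt_form_3D(9)[OF \<phi>_alt[OF y]])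
  have "\<Phi> s * (D\<phi> (F s) (P 1 s) [w, P 2 s, P 3 s] + D\<phi> (F s) (P 2 s) [P 1 s, w, P 3 s] + D\<phi> (F s) (P 3 s) [P 1 s, P 2 s, w])
    = \<Phi> s * (D\<phi> (F s) (P 1 s) [w, P 2 s, P 3 s] + \<phi> (F s) [w, Q 1 2 s, P 3 s] + \<phi> (F s) [w, P 2 s, Q 1 3 s])
    + \<Phi> s * (D\<phi> (F s) (P 2 s) [P 1 s, w, P 3 s] + \<phi> (F s) [Q 2 1 s, w, P 3 s] + \<phi> (F s) [P 1 s, w, Q 2 3 s])
    + \<Phi> s * (D\<phi> (F s) (P 3 s) [P 1 s, P 2 s, w] + \<phi> (F s) [Q 3 1 s, P 2 s, w] + \<phi> (F s) [P 1 s, Q 3 2 s, w])"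
    unfolding cancel by (simp add: distrib_left right_diff_distrib)
  then show ?thesis unfolding e1 e2 e3 sum_3[of "\<lambda>i. \<Sum>j\<in>UNIV. C i j s * (DG (F s) (P i s) w (P j s) + G (F s) w (Q i j s))"] .
qed

section \<open>Levi-Civita connection, second fundamental form and first variation\<close>

lemma metric_christoffel:
  assumes y: "y \<in> U"
  shows "G y z (christoffel G y v w) = (DG y v w z + DG y w v z - DG y z v w) / 2"
proof -
  obtain u where u: "adapted (\<Omega> y) (\<Upsilon> y) u" using ad y by blast
  define f where "f z = (DG y v w z + DG y w v z - DG y z v w) / 2" for z
  have L: "linear (\<lambda>z. DG y z v w)"
    using has_derivative_linear[OF dG[OF y]] .
  have f: "linear f"
    unfolding f_def
    by (intro linearI) (simp_all add: linear_add[OF L] linear_scale[OF L] linear_add[OF DG_linear[OF y]]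
        linear_scale[OF DG_linear[OF y]] algebra_simps add_divide_distrib diff_divide_distrib)
  from adapted_riesz[OF u f] have "\<forall>z. G y (THE a. \<forall>z. G y a z = f z) z = f z"
    unfolding G_def by (rule theI')
  then have "G y (christoffel G y v w) z = f z"
    unfolding christoffel_def f_def DG_def by blast
  then show ?thesis using G_sym[OF y] by (simp add: f_def)
qed

lemma sff_eq:
  "second_fundamental_form G F s (axis i 1) (axis j 1) =
     normal_part (G (F s)) (range (frechet_derivative F (at s))) (Q i j s + christoffel G (F s) (P i s) (P j s))"
  unfolding second_fundamental_form_def P_def Q_def ..

lemma subspace_tangent: "s \<in> W \<Longrightarrow> subspace (range (frechet_derivative F (at s)))"
  using sl unfolding sl_plane_def by blast

lemma tangent_eq: assumes s: "s \<in> W" shows "\<exists>a b c. frechet_derivative F (at s) v = a *\<^sub>R P 1 s + b *\<^sub>R P 2 s + c *\<^sub>R P 3 s"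
proof -
  note lin = has_derivative_linear[OF dF'[OF s]]
  have "v = v $ 1 *\<^sub>R axis 1 1 + v $ 2 *\<^sub>R axis 2 1 + v $ 3 *\<^sub>R axis 3 1"
    by (simp add: vec_eq_iff forall_3 axis_def)
  then have "frechet_derivative F (at s) v = v $ 1 *\<^sub>R P 1 s + v $ 2 *\<^sub>R P 2 s + v $ 3 *\<^sub>R P 3 s"
    unfolding P_def by (metis (no_types) linear_add[OF lin] linear_scale[OF lin])
  then show ?thesis by blast
qed

lemma normal_iff:
  assumes s: "s \<in> W"
  shows "(\<forall>t\<in>range (frechet_derivative F (at s)). G (F s) n t = 0) \<longleftrightarrow> (\<forall>i. G (F s) n (P i s) = 0)"
proof
  assume *: "\<forall>i. G (F s) n (P i s) = 0"
  note lin = G_lin(2)[OF FU[OF s]]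
  show "\<forall>t\<in>range (frechet_derivative F (at s)). G (F s) n t = 0"
  proof
    fix t assume "t \<in> range (frechet_derivative F (at s))"
    then obtain a b c where "t = a *\<^sub>R P 1 s + b *\<^sub>R P 2 s + c *\<^sub>R P 3 s" using tangent_eq[OF s] by blast
    then show "G (F s) n t = 0" by (simp add: linear_add[OF lin] linear_scale[OF lin] *)
  qed
qed (use P_range in blast)

lemma mean_curvature_normal:
  assumes s: "s \<in> W" shows "G (F s) (mean_curvature G F s) (P k s) = 0"
proof -
  obtain u where u: "adapted (\<Omega> (F s)) (\<Upsilon> (F s)) u" using ad FU[OF s] by blast
  note lin = G_lin(1)[OF FU[OF s]]
  have "G (F s) (second_fundamental_form G F s a b) (P k s) = 0" for a b
    unfolding second_fundamental_form_def G_def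
    by (rule adapted_normal_part(1)[OF u subspace_tangent[OF s] P_range])
  then show ?thesis
    unfolding mean_curvature_def by (simp add: linear_sum[OF lin] linear_scale[OF lin])
qed

text \<open>The first variation formula on the coordinate frame, with \<Phi> as the value of \<phi>,
  so no orthonormal frame is chosen. The vector w has to be normal only at the point itself.\<close>

lemma mean_curvature_variation:
  assumes s: "s \<in> W" and w: "\<And>i. G (F s) w (P i s) = 0"
  shows "G (F s) w (mean_curvature G F s) * \<Phi> s = - ext_deriv \<phi> (F s) [w, P 1 s, P 2 s, P 3 s]"
proof -
  have y: "F s \<in> U" by (rule FU[OF s])
  obtain u where u: "adapted (\<Omega> (F s)) (\<Upsilon> (F s)) u" using ad y by blast
  note lin = G_lin(2)[OF y]
  have sy: "g 2 1 s = g 1 2 s" "g 3 1 s = g 1 3 s" "g 3 2 s = g 2 3 s"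
    using G_sym[OF y] by auto
  have ig: "induced_metric G F s $ i $ j = g i j s" for i j
    by (simp add: induced_metric_def P_def)
  have det: "det (induced_metric G F s) = \<Phi> s * \<Phi> s"
    unfolding phi_cofactor(1)[OF s] det_3 ig sy by (simp add: C_def algebra_simps)
  then have det0: "det (induced_metric G F s) \<noteq> 0" using \<Phi>_nonzero[OF s] by simp
  have inv: "matrix_inv (induced_metric G F s) $ i $ j = C i j s / (\<Phi> s * \<Phi> s)" for i j
    by (subst matrix_inv_symmetric_3[OF _ _ _ det0]) (simp_all only: ig sy det C_def vec_lambda_beta)
  have II: "G (F s) w (second_fundamental_form G F s (axis i 1) (axis j 1))
     = G (F s) w (Q i j s) + (DG (F s) (P i s) w (P j s) + DG (F s) (P j s) w (P i s) - DG (F s) w (P i s) (P j s)) / 2" (is "_ = ?R i j") for i j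
  proof -
    define X where "X = Q i j s + christoffel G (F s) (P i s) (P j s)"
    define n where "n = normal_part (G (F s)) (range (frechet_derivative F (at s))) X"
    have "X - n \<in> range (frechet_derivative F (at s))"
      unfolding n_def G_def by (rule adapted_normal_part(2)[OF u subspace_tangent[OF s]])
    then have "G (F s) w (X - n) = 0" using normal_iff[OF s, of w] w by blast
    then have "G (F s) w n = G (F s) w X" by (simp add: linear_diff[OF lin])
    also have "\<dots> = ?R i j"
      unfolding X_def linear_add[OF lin] metric_christoffel[OF y]
      by (simp only: DG_sym[OF y, of "P i s" "P j s" w] DG_sym[OF y, of "P j s" "P i s" w])
    finally show ?thesis by (simp only: sff_eq n_def X_def)
  qed
  have H: "G (F s) w (mean_curvature G F s) * (\<Phi> s * \<Phi> s) = (\<Sum>i\<in>UNIV. \<Sum>j\<in>UNIV. C i j s * ?R i j)"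
    unfolding mean_curvature_def using \<Phi>_nonzero[OF s]
    by (simp add: linear_sum[OF lin] linear_scale[OF lin] inv II sum_distrib_right)
  \<comment> \<open>By symmetry of C the two terms with a tangential derivative of the metric have
    equal sums, which absorbs their factor 1/2.\<close>
  have R: "(\<Sum>i\<in>UNIV. \<Sum>j\<in>UNIV. C i j s * ?R i j) =
      (\<Sum>i\<in>UNIV. \<Sum>j\<in>UNIV. C i j s * (DG (F s) (P i s) w (P j s) + G (F s) w (Q i j s)))
      - (\<Sum>i\<in>UNIV. \<Sum>j\<in>UNIV. C i j s * DG (F s) w (P i s) (P j s)) / 2"
    unfolding sum_3 C_sym[of 2 1] C_sym[of 3 1] C_sym[of 3 2] by (simp add: field_simps)
  have E: "ext_deriv \<phi> (F s) [w, P 1 s, P 2 s, P 3 s] =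
     D\<phi> (F s) w [P 1 s, P 2 s, P 3 s] - D\<phi> (F s) (P 1 s) [w, P 2 s, P 3 s]
     + D\<phi> (F s) (P 2 s) [w, P 1 s, P 3 s] - D\<phi> (F s) (P 3 s) [w, P 1 s, P 2 s]"
    by (simp add: ext_deriv_def D\<phi>_def lessThan_Suc numeral_eq_Suc)
  \<comment> \<open>\<open>ext_deriv\<close> leaves w in front. Moving it into the slot of the
    differentiating vector turns the alternating signs into the equal signs of
    \<open>cofactor_divergence\<close>.\<close>
  have sw: "D\<phi> (F s) (P 2 s) [w, P 1 s, P 3 s] = - D\<phi> (F s) (P 2 s) [P 1 s, w, P 3 s]"
    "D\<phi> (F s) (P 3 s) [w, P 1 s, P 2 s] = D\<phi> (F s) (P 3 s) [P 1 s, P 2 s, w]"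
    using D\<phi>_swap(1)[OF y, of _ w "P 1 s"] D\<phi>_swap(2)[OF y, of _ "P 1 s" w] by auto
  have "(G (F s) w (mean_curvature G F s) * \<Phi> s) * \<Phi> s = - ext_deriv \<phi> (F s) [w, P 1 s, P 2 s, P 3 s] * \<Phi> s"
    unfolding E sw using H[unfolded R cofactor_divergence[OF s w, symmetric] cofactor_variation[OF s, symmetric]]
    by (simp add: algebra_simps)
  then show ?thesis by (rule mult_right_cancel[OF \<Phi>_nonzero[OF s], THEN iffD1])
qed

end

section \<open>The torsion component normal to a special Lagrangian\<close>

lemma wedge_alt_length:
  fixes \<alpha> \<beta> :: "('v::real_vector, real) form"
  assumes "alt_form k \<alpha>" "alt_form m \<beta>" "length l \<noteq> k + m"
  shows "(\<alpha> \<and>\<^sub>w \<beta>) l = 0"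
  by (rule wedge_eq_0_length[OF _ _ assms(3)])
     (rule alt_form_length[OF assms(1)] alt_form_length[OF assms(2)]; assumption)+

lemma alt_form_Re_form: "alt_form k \<omega> \<Longrightarrow> alt_form k (Re_form \<omega>)"
  unfolding Re_form_def by (erule alt_form_bounded_linear[where T = Re], rule linearI, simp_all)

lemma wedge_1_3:
  fixes \<alpha> \<beta> :: "('v::real_vector, real) form"
  assumes \<alpha>: "alt_form 1 \<alpha>" and \<beta>: "alt_form 3 \<beta>"
  shows "(\<alpha> \<and>\<^sub>w \<beta>) [a, b, c, d] = \<alpha> [a] * \<beta> [b, c, d] - \<alpha> [b] * \<beta> [a, c, d] + \<alpha> [c] * \<beta> [a, b, d] - \<alpha> [d] * \<beta> [a, b, c]"
  by (simp add: wedge_expand alt_form_length[OF \<alpha>] alt_form_length[OF \<beta>])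

lemma wedge_2_2:
  fixes \<alpha> \<beta> :: "('v::real_vector, real) form"
  assumes \<alpha>: "alt_form 2 \<alpha>" and \<beta>: "alt_form 2 \<beta>"
  shows "(\<alpha> \<and>\<^sub>w \<beta>) [a, b, c, d] = \<alpha> [a, b] * \<beta> [c, d] - \<alpha> [a, c] * \<beta> [b, d] + \<alpha> [a, d] * \<beta> [b, c]
    + \<alpha> [b, c] * \<beta> [a, d] - \<alpha> [b, d] * \<beta> [a, c] + \<alpha> [c, d] * \<beta> [a, b]"
  by (simp add: wedge_expand alt_form_length[OF \<alpha>] alt_form_length[OF \<beta>])

lemma wedge_2_3:
  fixes \<alpha> \<beta> :: "('v::real_vector, real) form"
  assumes \<alpha>: "alt_form 2 \<alpha>" and \<beta>: "alt_form 3 \<beta>"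
  shows "(\<alpha> \<and>\<^sub>w \<beta>) [a, b, c, d, e] = \<alpha> [a, b] * \<beta> [c, d, e] - \<alpha> [a, c] * \<beta> [b, d, e] + \<alpha> [a, d] * \<beta> [b, c, e]
    - \<alpha> [a, e] * \<beta> [b, c, d] + \<alpha> [b, c] * \<beta> [a, d, e] - \<alpha> [b, d] * \<beta> [a, c, e] + \<alpha> [b, e] * \<beta> [a, c, d]
    + \<alpha> [c, d] * \<beta> [a, b, e] - \<alpha> [c, e] * \<beta> [a, b, d] + \<alpha> [d, e] * \<beta> [a, b, c]"
  by (simp add: wedge_expand alt_form_length[OF \<alpha>] alt_form_length[OF \<beta>])

text \<open>After contraction with w there remains an alternating 3-form, so its restriction to the
  tangent plane is known from its value on one basis.\<close>

lemma alt_form_wedge_1_3: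
  fixes \<alpha> \<beta> :: "('v::real_vector, real) form"
  assumes \<alpha>: "alt_form 1 \<alpha>" and \<beta>: "alt_form 3 \<beta>"
  shows "alt_form 3 (\<lambda>l. (\<alpha> \<and>\<^sub>w \<beta>) (w # l))"
proof (rule alt_form_3I)
  note a = alt_form_1D[OF \<alpha>] and b = alt_form_3D(1-3)[OF \<beta>] and c = alt_form_3D(4-6)[OF \<beta>]
  note la = linear_add[OF a] linear_scale[OF a]
  note lb = linear_add[OF b(1)] linear_scale[OF b(1)] linear_add[OF b(2)] linear_scale[OF b(2)] linear_add[OF b(3)] linear_scale[OF b(3)]
  note W = wedge_1_3[OF \<alpha> \<beta>]
  show "(\<alpha> \<and>\<^sub>w \<beta>) (w # l) = 0" if "length l \<noteq> 3" for l
    using that by (intro wedge_alt_length[OF \<alpha> \<beta>]) auto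
  show "linear (\<lambda>v. (\<alpha> \<and>\<^sub>w \<beta>) [w, v, b, c])" "linear (\<lambda>v. (\<alpha> \<and>\<^sub>w \<beta>) [w, b, v, c])" "linear (\<lambda>v. (\<alpha> \<and>\<^sub>w \<beta>) [w, b, c, v])" for b c
    unfolding W by (auto intro!: linearI simp: la lb algebra_simps)
  show "(\<alpha> \<and>\<^sub>w \<beta>) [w, x, x, z] = 0" "(\<alpha> \<and>\<^sub>w \<beta>) [w, x, z, z] = 0" for x z
    unfolding W c by simp_all
  show "(\<alpha> \<and>\<^sub>w \<beta>) [w, x, z, x] = 0" for x z
    unfolding W c using alt_form_3D(9)[OF \<beta>, of w x z] by simp
qed

lemma alt_form_wedge_2_2:
  fixes \<alpha> \<beta> :: "('v::real_vector, real) form"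
  assumes \<alpha>: "alt_form 2 \<alpha>" and \<beta>: "alt_form 2 \<beta>"
  shows "alt_form 3 (\<lambda>l. (\<alpha> \<and>\<^sub>w \<beta>) (w # l))"
proof (rule alt_form_3I)
  note a = alt_form_2D(1-2)[OF \<alpha>] and b = alt_form_2D(1-2)[OF \<beta>] and c = alt_form_2D(3)[OF \<alpha>] alt_form_2D(3)[OF \<beta>]
  note la = linear_add[OF a(1)] linear_scale[OF a(1)] linear_add[OF a(2)] linear_scale[OF a(2)]
  note lb = linear_add[OF b(1)] linear_scale[OF b(1)] linear_add[OF b(2)] linear_scale[OF b(2)]
  note W = wedge_2_2[OF \<alpha> \<beta>]
  show "(\<alpha> \<and>\<^sub>w \<beta>) (w # l) = 0" if "length l \<noteq> 3" for l
    using that by (intro wedge_alt_length[OF \<alpha> \<beta>]) auto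
  show "linear (\<lambda>v. (\<alpha> \<and>\<^sub>w \<beta>) [w, v, b, c])" "linear (\<lambda>v. (\<alpha> \<and>\<^sub>w \<beta>) [w, b, v, c])" "linear (\<lambda>v. (\<alpha> \<and>\<^sub>w \<beta>) [w, b, c, v])" for b c
    unfolding W by (auto intro!: linearI simp: la lb algebra_simps)
  show "(\<alpha> \<and>\<^sub>w \<beta>) [w, x, x, z] = 0" "(\<alpha> \<and>\<^sub>w \<beta>) [w, x, z, z] = 0" for x z
    unfolding W c by simp_all
  show "(\<alpha> \<and>\<^sub>w \<beta>) [w, x, z, x] = 0" for x z
    unfolding W c using alt_form_2D(4)[OF \<beta>, of x z] alt_form_2D(4)[OF \<alpha>, of x z] by simp
qed

lemma alt_form_add:
  assumes "alt_form k \<alpha>" "alt_form k \<beta>"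
  shows "alt_form k (\<lambda>l. \<alpha> l + \<beta> l)"
  using assms unfolding alt_form_def by (auto intro!: linear_compose_add)

lemma alt_form_scale:
  fixes \<alpha> :: "('v::real_vector, real) form"
  assumes "alt_form k \<alpha>"
  shows "alt_form k (\<lambda>l. a * \<alpha> l)"
  by (rule alt_form_bounded_linear[OF assms]) (auto intro!: linearI simp: algebra_simps)

text \<open>On a 3-dimensional span an alternating 3-form is a multiple of the determinant. This
  converts values on the coordinate frame into values on an orthonormal one.\<close>

lemma alt_form_3_det:
  assumes \<omega>: "alt_form 3 (\<omega> :: ('v::real_vector, real) form)"
  shows "\<omega> [a1 *\<^sub>R x + a2 *\<^sub>R y + a3 *\<^sub>R z, b1 *\<^sub>R x + b2 *\<^sub>R y + b3 *\<^sub>R z, c1 *\<^sub>R x + c2 *\<^sub>R y + c3 *\<^sub>R z]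
    = (a1 * b2 * c3 - a1 * b3 * c2 - a2 * b1 * c3 + a2 * b3 * c1 + a3 * b1 * c2 - a3 * b2 * c1) * \<omega> [x, y, z]"
proof -
  note b = alt_form_3D(1-3)[OF \<omega>]
  note lb = linear_add[OF b(1)] linear_scale[OF b(1)] linear_add[OF b(2)] linear_scale[OF b(2)] linear_add[OF b(3)] linear_scale[OF b(3)]
  have p: "\<omega> [x, z, y] = - \<omega> [x, y, z]" "\<omega> [y, x, z] = - \<omega> [x, y, z]" "\<omega> [z, y, x] = - \<omega> [x, y, z]"
    "\<omega> [y, z, x] = \<omega> [x, y, z]" "\<omega> [z, x, y] = \<omega> [x, y, z]"
    using alt_form_3D(7)[OF \<omega>, of x y z] alt_form_3D(8)[OF \<omega>, of x y z] alt_form_3D(9)[OF \<omega>, of x y z]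
      alt_form_3D(9)[OF \<omega>, of y x z] alt_form_3D(7)[OF \<omega>, of z x y] alt_form_3D(7)[OF \<omega>, of x z y] by linarith+
  show ?thesis by (simp add: lb alt_form_3D(4-6)[OF \<omega>] p algebra_simps)
qed

text \<open>The 5-form \<open>\<beta> \<and>\<^sub>w Re_form \<Upsilon>\<close> has six
  coefficients, one for each omitted frame vector, and each gives one relation. Together they say
  that \<beta> is J-invariant, that is, of type (1,1).\<close>

lemma Lambda28_relations:
  assumes u: "adapted \<Omega> \<Upsilon> u" and \<beta>: "\<beta> \<in> Lambda28 \<Omega> \<Upsilon>"
  defines "f \<equiv> frame u"
  shows "\<beta> [f 5, f 6] = \<beta> [f 2, f 3]" "\<beta> [f 6, f 4] = \<beta> [f 3, f 1]" "\<beta> [f 4, f 5] = \<beta> [f 1, f 2]"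
    "\<beta> [f 2, f 6] = \<beta> [f 3, f 5]" "\<beta> [f 3, f 4] = \<beta> [f 1, f 6]" "\<beta> [f 1, f 5] = \<beta> [f 2, f 4]"
proof -
  have alt: "alt_form 2 \<beta>" and w: "(\<beta> \<and>\<^sub>w Re_form \<Upsilon>) vs = 0" for vs
    using \<beta> by (auto simp: Lambda28_def)
  note alt3 = alt_form_Re_form[OF adapted_alt_form(2)[OF u]]
  have uf: "u (f i) = axis i 1" for i by (simp add: f_def frame_def adapted_u_inv[OF u])
  have Re: "Re_form \<Upsilon> [f i, f j, f k] = Re (Upsilon0 [axis i 1, axis j 1, axis k 1])" for i j k
    by (simp add: Re_form_def adapted_Upsilon[OF u] uf)
  note S = Re Upsilon0_eq zco_def axis_def
  note sw = alt_form_2D(4)[OF alt]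
  note W' = w[of "[a, b, c, d, e]" for a b c d e, unfolded wedge_2_3[OF alt alt3]]
  show "\<beta> [f 5, f 6] = \<beta> [f 2, f 3]" using W'[of "f 1" "f 2" "f 3" "f 5" "f 6"] by (simp add: S)
  show "\<beta> [f 6, f 4] = \<beta> [f 3, f 1]" using W'[of "f 1" "f 2" "f 3" "f 4" "f 6"] sw[of "f 6" "f 4"] sw[of "f 3" "f 1"] by (simp add: S)
  show "\<beta> [f 4, f 5] = \<beta> [f 1, f 2]" using W'[of "f 1" "f 2" "f 3" "f 4" "f 5"] by (simp add: S)
  show "\<beta> [f 2, f 6] = \<beta> [f 3, f 5]" using W'[of "f 2" "f 3" "f 4" "f 5" "f 6"] by (simp add: S)
  show "\<beta> [f 3, f 4] = \<beta> [f 1, f 6]" using W'[of "f 1" "f 3" "f 4" "f 5" "f 6"] by (simp add: S)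
  show "\<beta> [f 1, f 5] = \<beta> [f 2, f 4]" using W'[of "f 1" "f 2" "f 4" "f 5" "f 6"] by (simp add: S)
qed



text \<open>Passing to all ordered pairs removes the order of the index type, in which 6 precedes 1,
  from the computation of \<open>form2_inner\<close>.\<close>

lemma sum_less_symmetric:
  fixes s :: "'i::{finite,linorder} \<Rightarrow> 'i \<Rightarrow> real"
  assumes sym: "\<And>i j. s i j = s j i" and z: "\<And>i. s i i = 0"
  shows "(\<Sum>(i, j)\<in>{(i, j). i < j}. s i j) = (\<Sum>i\<in>UNIV. \<Sum>j\<in>UNIV. s i j) / 2"
proof -
  let ?L = "{(i, j). i < (j::'i)}" and ?R = "{(i, j). j < (i::'i)}" and ?D = "{(i, j). i = (j::'i)}"
  have "(\<Sum>i\<in>UNIV. \<Sum>j\<in>UNIV. s i j) = (\<Sum>(i, j)\<in>(?L \<union> ?R) \<union> ?D. s i j)"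
    unfolding sum.cartesian_product by (rule sum.cong) auto
  also have "\<dots> = (\<Sum>(i, j)\<in>?L \<union> ?R. s i j) + (\<Sum>(i, j)\<in>?D. s i j)"
    by (rule sum.union_disjoint) auto
  also have "(\<Sum>(i, j)\<in>?D. s i j) = 0"
    by (rule sum.neutral) (auto simp: z)
  also have "(\<Sum>(i, j)\<in>?L \<union> ?R. s i j) = (\<Sum>(i, j)\<in>?L. s i j) + (\<Sum>(i, j)\<in>?R. s i j)"
    by (rule sum.union_disjoint) auto
  also have "(\<Sum>(i, j)\<in>?R. s i j) = (\<Sum>(i, j)\<in>?L. s i j)"
    by (rule sum.reindex_bij_witness[of _ prod.swap prod.swap]) (auto simp: sym)
  finally show ?thesis by simp
qed

section \<open>The projection to the span of the forms \<open>Gam\<close> and the two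
  isomorphisms\<close>

context
  fixes \<Omega> :: "(real^6, real) form" and \<Upsilon> :: "(real^6, complex) form" and u
  assumes u: "adapted \<Omega> \<Upsilon> u"
begin

lemma u_frame: "u (frame u i) = axis i 1"
  unfolding frame_def by (rule adapted_u_inv[OF u])

lemma coframe_simps: "coframe u i [] = 0" "coframe u i [v] = u v $ i" "coframe u i (v # w # l) = 0"
  by (simp_all add: coframe_def pullback_def)

lemma coframe_length: "length l \<noteq> 1 \<Longrightarrow> coframe u i l = 0"
  by (simp add: coframe_def pullback_def covec_def)

lemma Gam_eq:
  "Gam u 1 [v, w] = - (u v $ 2 * u w $ 3 - u v $ 3 * u w $ 2) - (u v $ 5 * u w $ 6 - u v $ 6 * u w $ 5)"
  "Gam u 2 [v, w] = - (u v $ 3 * u w $ 1 - u v $ 1 * u w $ 3) - (u v $ 6 * u w $ 4 - u v $ 4 * u w $ 6)"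
  "Gam u 3 [v, w] = - (u v $ 1 * u w $ 2 - u v $ 2 * u w $ 1) - (u v $ 4 * u w $ 5 - u v $ 5 * u w $ 4)"
  by (simp_all add: Gam_def wedge_expand coframe_simps)

lemma Gam_alt: "p \<in> {1, 2, 3} \<Longrightarrow> alt_form 2 (Gam u p)"
proof (rule alt_form_2I)
  assume p: "p \<in> {1, 2, 3}"
  show "length l \<noteq> 2 \<Longrightarrow> Gam u p l = 0" for l
    unfolding Gam_def by (simp add: wedge_eq_0_length[OF coframe_length coframe_length])
qed (auto simp: Gam_eq linear_add[OF adapted_linear[OF u]] linear_scale[OF adapted_linear[OF u]] algebra_simps intro!: linearI)

lemma form2_inner_eq:
  assumes "alt_form 2 \<beta>" "alt_form 2 \<gamma>"
  shows "form2_inner u \<beta> \<gamma> = (\<Sum>i\<in>UNIV. \<Sum>j\<in>UNIV. \<beta> [frame u i, frame u j] * \<gamma> [frame u i, frame u j]) / 2"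
  unfolding form2_inner_def
proof (rule sum_less_symmetric)
  show "\<beta> [frame u i, frame u j] * \<gamma> [frame u i, frame u j] = \<beta> [frame u j, frame u i] * \<gamma> [frame u j, frame u i]" for i j
    using alt_form_2D(4)[OF assms(1), of "frame u i" "frame u j"] alt_form_2D(4)[OF assms(2), of "frame u i" "frame u j"] by simp
  show "\<beta> [frame u i, frame u i] * \<gamma> [frame u i, frame u i] = 0" for i
    using alt_form_2D(3)[OF assms(1)] by simp
qed

lemma form2_inner_Gam:
  assumes \<beta>: "alt_form 2 \<beta>"
  defines "f \<equiv> frame u"
  shows "form2_inner u \<beta> (Gam u 1) = - \<beta> [f 2, f 3] - \<beta> [f 5, f 6]"
    "form2_inner u \<beta> (Gam u 2) = - \<beta> [f 3, f 1] - \<beta> [f 6, f 4]"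
    "form2_inner u \<beta> (Gam u 3) = - \<beta> [f 1, f 2] - \<beta> [f 4, f 5]"
proof -
  have sw: "\<beta> [f 3, f 2] = - \<beta> [f 2, f 3]" "\<beta> [f 6, f 5] = - \<beta> [f 5, f 6]" "\<beta> [f 1, f 3] = - \<beta> [f 3, f 1]"
    "\<beta> [f 4, f 6] = - \<beta> [f 6, f 4]" "\<beta> [f 2, f 1] = - \<beta> [f 1, f 2]" "\<beta> [f 5, f 4] = - \<beta> [f 4, f 5]"
    by (rule alt_form_2D(4)[OF \<beta>])+
  note I = form2_inner_eq[OF \<beta> Gam_alt] sum_6 Gam_eq u_frame[folded f_def] axis_def f_def[symmetric] sw alt_form_2D(3)[OF \<beta>]
  show "form2_inner u \<beta> (Gam u 1) = - \<beta> [f 2, f 3] - \<beta> [f 5, f 6]"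
    "form2_inner u \<beta> (Gam u 2) = - \<beta> [f 3, f 1] - \<beta> [f 6, f 4]"
    "form2_inner u \<beta> (Gam u 3) = - \<beta> [f 1, f 2] - \<beta> [f 4, f 5]"
    by (simp_all add: I)
qed

lemma Gam_frame:
  defines "f \<equiv> frame u"
  shows "Gam u 1 [f 2, f 3] = -1" "Gam u 2 [f 2, f 3] = 0" "Gam u 3 [f 2, f 3] = 0"
    "Gam u 1 [f 3, f 1] = 0" "Gam u 2 [f 3, f 1] = -1" "Gam u 3 [f 3, f 1] = 0"
    "Gam u 1 [f 1, f 2] = 0" "Gam u 2 [f 1, f 2] = 0" "Gam u 3 [f 1, f 2] = -1"
    "Gam u 1 [f 5, f 6] = -1" "Gam u 2 [f 5, f 6] = 0" "Gam u 3 [f 5, f 6] = 0"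
    "Gam u 1 [f 6, f 4] = 0" "Gam u 2 [f 6, f 4] = -1" "Gam u 3 [f 6, f 4] = 0"
    "Gam u 1 [f 4, f 5] = 0" "Gam u 2 [f 4, f 5] = 0" "Gam u 3 [f 4, f 5] = -1"
  by (simp_all add: f_def Gam_eq u_frame axis_def)

lemma Gam_span_alt: "alt_form 2 (\<lambda>vs. \<Sum>p\<in>{1, 2, 3}. a p * Gam u p vs)"
proof -
  have "alt_form 2 (\<lambda>vs. a 1 * Gam u 1 vs + (a 2 * Gam u 2 vs + a 3 * Gam u 3 vs))"
    by (intro alt_form_add alt_form_scale Gam_alt) auto
  then show ?thesis by (simp add: add.assoc)
qed

text \<open>The forms \<open>Gam\<close> are orthogonal with square norm 2. By J-invariance the two
  terms of the inner product of \<tau> with each of them agree, so the factor 2 cancels.\<close>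

lemma proj_Lambda28_1_eq:
  assumes \<tau>: "\<tau> \<in> Lambda28 \<Omega> \<Upsilon>"
  defines "f \<equiv> frame u"
  defines "c \<equiv> (\<lambda>p. if p = 1 then - \<tau> [f 2, f 3] else if p = 2 then - \<tau> [f 3, f 1] else - \<tau> [f 1, f 2])"
  shows "proj_Lambda28_1 u \<tau> = (\<lambda>vs. \<Sum>p\<in>{1, 2, 3}. c p * Gam u p vs)"
proof -
  note rel = Lambda28_relations[OF u \<tau>, folded f_def]
  have alt\<tau>: "alt_form 2 \<tau>" using \<tau> by (simp add: Lambda28_def)
  have alt: "alt_form 2 (\<lambda>vs. \<tau> vs - (\<Sum>p\<in>{1, 2, 3}. a p * Gam u p vs))" for a
    using alt_form_add[OF alt\<tau> alt_form_scale[OF Gam_span_alt, of "-1"]]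
    by (simp only: mult_minus1 add_uminus_conv_diff)
  have inner: "form2_inner u (\<lambda>vs. \<tau> vs - (\<Sum>p\<in>{1, 2, 3}. a p * Gam u p vs)) (Gam u 1) = 2 * c 1 - 2 * a 1"
    "form2_inner u (\<lambda>vs. \<tau> vs - (\<Sum>p\<in>{1, 2, 3}. a p * Gam u p vs)) (Gam u 2) = 2 * c 2 - 2 * a 2"
    "form2_inner u (\<lambda>vs. \<tau> vs - (\<Sum>p\<in>{1, 2, 3}. a p * Gam u p vs)) (Gam u 3) = 2 * c 3 - 2 * a 3" for a
    unfolding form2_inner_Gam[OF alt, folded f_def] by (simp_all add: Gam_frame[folded f_def] rel c_def)
  have lin: "form2_inner u \<beta> (\<lambda>vs. \<Sum>p\<in>{1, 2, 3}. b p * Gam u p vs) = (\<Sum>p\<in>{1, 2, 3}. b p * form2_inner u \<beta> (Gam u p))" for \<beta> b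
    unfolding form2_inner_def sum_distrib_left by (subst sum.swap) (simp add: sum.distrib algebra_simps case_prod_beta)
  show ?thesis
    unfolding proj_Lambda28_1_def
  proof (rule the_equality)
    show "(\<lambda>vs. \<Sum>p\<in>{1, 2, 3}. c p * Gam u p vs) \<in> form_span3 (Gam u) \<and>
      (\<forall>\<gamma>\<in>form_span3 (Gam u). form2_inner u (\<lambda>vs. \<tau> vs - (\<Sum>p\<in>{1, 2, 3}. c p * Gam u p vs)) \<gamma> = 0)"
      unfolding form_span3_def using inner[of c] lin by auto
  next
    fix \<beta> assume \<beta>: "\<beta> \<in> form_span3 (Gam u) \<and> (\<forall>\<gamma>\<in>form_span3 (Gam u). form2_inner u (\<lambda>vs. \<tau> vs - \<beta> vs) \<gamma> = 0)"
    then obtain a where a: "\<beta> = (\<lambda>vs. \<Sum>p\<in>{1, 2, 3}. a p * Gam u p vs)"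
      by (auto simp: form_span3_def)
    have mem: "Gam u q \<in> form_span3 (Gam u)" if "q \<in> {1, 2, 3}" for q
      unfolding form_span3_def
      by (rule image_eqI[of _ _ "\<lambda>p. if p = q then 1 else 0"]) (use that in \<open>auto simp: fun_eq_iff\<close>)
    have "a 1 = c 1" "a 2 = c 2" "a 3 = c 3"
      using \<beta> mem[of 1] mem[of 2] mem[of 3] inner[of a] unfolding a by auto
    then show "\<beta> = (\<lambda>vs. \<Sum>p\<in>{1, 2, 3}. c p * Gam u p vs)"
      unfolding a by simp
  qed
qed

lemma linear_ext3_eq:
  fixes b :: "6 \<Rightarrow> ('v::real_vector, real) form"
  assumes "\<And>c d p. (\<lambda>vs. \<Sum>p\<in>{1, 2, 3}. c p * b p vs) = (\<lambda>vs. \<Sum>p\<in>{1, 2, 3}. d p * b p vs) \<Longrightarrow> c 1 = d 1 \<and> c 2 = d 2 \<and> c 3 = d 3"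
  shows "linear_ext3 b w (\<lambda>vs. \<Sum>p\<in>{1, 2, 3}. a p * b p vs) = (\<Sum>p\<in>{1, 2, 3}. a p *\<^sub>R w p)"
  unfolding linear_ext3_def
proof (rule the_equality)
  fix x assume "\<exists>c. (\<lambda>vs. \<Sum>p\<in>{1, 2, 3}. a p * b p vs) = (\<lambda>vs. \<Sum>p\<in>{1, 2, 3}. c p * b p vs) \<and> x = (\<Sum>p\<in>{1, 2, 3}. c p *\<^sub>R w p)"
  then obtain c where eq: "(\<lambda>vs. \<Sum>p\<in>{1, 2, 3}. a p * b p vs) = (\<lambda>vs. \<Sum>p\<in>{1, 2, 3}. c p * b p vs)"
    and x: "x = (\<Sum>p\<in>{1, 2, 3}. c p *\<^sub>R w p)" by blast
  show "x = (\<Sum>p\<in>{1, 2, 3}. a p *\<^sub>R w p)" using assms[OF eq] x by simp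
qed blast

lemma natural_iso_eq:
  "natural_iso u \<theta> (\<lambda>vs. \<Sum>p\<in>{1, 2, 3}. a p * Gam u p vs) = (\<Sum>p\<in>{1, 2, 3}. (a p * sqrt 2) *\<^sub>R normal_vec u \<theta> p)"
proof -
  have "natural_iso u \<theta> (\<lambda>vs. \<Sum>p\<in>{1, 2, 3}. a p * Gam u p vs) = (\<Sum>p\<in>{1, 2, 3}. a p *\<^sub>R (sqrt 2 *\<^sub>R normal_vec u \<theta> p))"
    unfolding natural_iso_def
  proof (rule linear_ext3_eq)
    fix c d :: "6 \<Rightarrow> real" and p :: 6
    assume *: "(\<lambda>vs. \<Sum>p\<in>{1, 2, 3}. c p * Gam u p vs) = (\<lambda>vs. \<Sum>p\<in>{1, 2, 3}. d p * Gam u p vs)"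
    show "c 1 = d 1 \<and> c 2 = d 2 \<and> c 3 = d 3"
      using fun_cong[OF *, of "[frame u 2, frame u 3]"] fun_cong[OF *, of "[frame u 3, frame u 1]"]
        fun_cong[OF *, of "[frame u 1, frame u 2]"] by (simp add: Gam_frame)
  qed
  then show ?thesis by simp
qed

lemma section_iso_eq:
  "section_iso u \<theta> (\<lambda>vs. \<Sum>p\<in>{1, 2, 3}. a p * coframe u p vs) = (\<Sum>p\<in>{1, 2, 3}. a p *\<^sub>R normal_vec u \<theta> p)"
  unfolding section_iso_def
proof (rule linear_ext3_eq)
  fix c d :: "6 \<Rightarrow> real" and p :: 6
  assume *: "(\<lambda>vs. \<Sum>p\<in>{1, 2, 3}. c p * coframe u p vs) = (\<lambda>vs. \<Sum>p\<in>{1, 2, 3}. d p * coframe u p vs)"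
  show "c 1 = d 1 \<and> c 2 = d 2 \<and> c 3 = d 3"
    using fun_cong[OF *, of "[frame u 1]"] fun_cong[OF *, of "[frame u 2]"] fun_cong[OF *, of "[frame u 3]"]
    by (simp add: coframe_simps u_frame axis_def)
qed

lemma pullback_J_N_component:
  "pullback (su3_J \<Omega> \<Upsilon>) (N_component u \<eta>) = (\<lambda>vs. \<Sum>p\<in>{1, 2, 3}. \<eta> [frame u (p + 3)] * coframe u p vs)"
proof
  fix vs
  have "coframe u (p + 3) (map (su3_J \<Omega> \<Upsilon>) vs) = coframe u p vs" if "p \<in> {1, 2, 3}" for p
    using that by (cases vs rule: list.exhaust; cases "tl vs") (auto simp: coframe_simps adapted_J[OF u])
  from this[of 1] this[of 2] this[of 3]
  show "pullback (su3_J \<Omega> \<Upsilon>) (N_component u \<eta>) vs = (\<Sum>p\<in>{1, 2, 3}. \<eta> [frame u (p + 3)] * coframe u p vs)"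
    by (simp add: N_component_def pullback_def)
qed

end

section \<open>Torsion terms in the frame rotated by e^{i \<theta> / 3}\<close>

lemma adapted_linear_J:
  assumes u: "adapted \<Omega> \<Upsilon> u"
  shows "linear (su3_J \<Omega> \<Upsilon>)"
proof -
  have inj: "u v = u w \<longleftrightarrow> v = w" for v w using adapted_bij[OF u] by (simp add: bij_is_inj inj_eq)
  note l = linear_add[OF adapted_linear[OF u]] linear_scale[OF adapted_linear[OF u]]
    linear_add[OF linear_J0] linear_scale[OF linear_J0] adapted_J[OF u]
  show ?thesis
    by (rule linearI; subst inj[symmetric]) (simp_all only: l)
qed

text \<open>What the torsion equations give for d\<phi> = cos \<theta> d Re \<Upsilon> + sin
  \<theta> d Im \<Upsilon> when the terms in \<Omega>^2 are left out.\<close>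

definition torsion_value ::
    "(real^6, real) form \<Rightarrow> (real^6, complex) form \<Rightarrow> real \<Rightarrow> (real^6, real) form \<Rightarrow> (real^6, real) form \<Rightarrow>
     (real^6, real) form \<Rightarrow> (real^6, real) form" where
  "torsion_value \<Omega> \<Upsilon> \<theta> \<tau>2 \<tau>2h \<tau>5 l =
     cos \<theta> * ((\<tau>5 \<and>\<^sub>w Re_form \<Upsilon>) l + (\<tau>2 \<and>\<^sub>w \<Omega>) l)
     + sin \<theta> * ((pullback (su3_J \<Omega> \<Upsilon>) \<tau>5 \<and>\<^sub>w Re_form \<Upsilon>) l + (\<tau>2h \<and>\<^sub>w \<Omega>) l)"

text \<open>The frame vectors of the plane of phase 0 multiplied by e^{i \<theta> / 3}; they are an
  orthonormal basis of the tangent plane.\<close>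

definition tangent_vec :: "(real^6 \<Rightarrow> real^6) \<Rightarrow> real \<Rightarrow> 6 \<Rightarrow> real^6" where
  "tangent_vec u \<theta> p = cos (\<theta> / 3) *\<^sub>R frame u p + sin (\<theta> / 3) *\<^sub>R frame u (p + 3)"

context
  fixes \<Omega> :: "(real^6, real) form" and \<Upsilon> :: "(real^6, complex) form" and u and \<theta> :: real and E
  assumes u: "adapted \<Omega> \<Upsilon> u"
  defines "E \<equiv> tangent_vec u \<theta>"
begin

lemma u_E: "u (E p) = cos (\<theta> / 3) *\<^sub>R axis p 1 + sin (\<theta> / 3) *\<^sub>R axis (p + 3) 1"
  by (simp add: E_def tangent_vec_def linear_add[OF adapted_linear[OF u]] linear_scale[OF adapted_linear[OF u]] u_frame[OF u])

lemma u_normal_vec: "u (normal_vec u \<theta> p) = - sin (\<theta> / 3) *\<^sub>R axis p 1 + cos (\<theta> / 3) *\<^sub>R axis (p + 3) 1"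
  by (simp add: normal_vec_def linear_diff[OF adapted_linear[OF u]] linear_scale[OF adapted_linear[OF u]] u_frame[OF u])

lemma zco_E: "zco 1 (u (E 1)) = cis (\<theta> / 3)" "zco 2 (u (E 1)) = 0" "zco 3 (u (E 1)) = 0"
  "zco 1 (u (E 2)) = 0" "zco 2 (u (E 2)) = cis (\<theta> / 3)" "zco 3 (u (E 2)) = 0"
  "zco 1 (u (E 3)) = 0" "zco 2 (u (E 3)) = 0" "zco 3 (u (E 3)) = cis (\<theta> / 3)"
  unfolding u_E by (simp_all add: zco_def axis_def complex_eq_iff)

lemma zco_normal_vec:
  "zco 1 (u (normal_vec u \<theta> 1)) = \<i> * cis (\<theta> / 3)" "zco 2 (u (normal_vec u \<theta> 1)) = 0" "zco 3 (u (normal_vec u \<theta> 1)) = 0"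
  "zco 1 (u (normal_vec u \<theta> 2)) = 0" "zco 2 (u (normal_vec u \<theta> 2)) = \<i> * cis (\<theta> / 3)" "zco 3 (u (normal_vec u \<theta> 2)) = 0"
  "zco 1 (u (normal_vec u \<theta> 3)) = 0" "zco 2 (u (normal_vec u \<theta> 3)) = 0" "zco 3 (u (normal_vec u \<theta> 3)) = \<i> * cis (\<theta> / 3)"
  unfolding u_normal_vec by (simp_all add: zco_def axis_def complex_eq_iff)

text \<open>The complex determinant of the rotation. It explains the third of the angle: multiplying
  three directions by e^{i \<theta> / 3} changes the phase by \<theta>.\<close>

lemma cis_third: "cis (\<theta> / 3) * (cis (\<theta> / 3) * cis (\<theta> / 3)) = cis \<theta>"
  by (simp add: cis_mult)

lemma Upsilon_E:
  shows "\<Upsilon> [E 1, E 2, E 3] = cis \<theta>"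
  "\<Upsilon> [normal_vec u \<theta> 1, E 2, E 3] = \<i> * cis \<theta>" "\<Upsilon> [normal_vec u \<theta> 1, E 1, E 3] = 0" "\<Upsilon> [normal_vec u \<theta> 1, E 1, E 2] = 0"
  "\<Upsilon> [normal_vec u \<theta> 2, E 2, E 3] = 0" "\<Upsilon> [normal_vec u \<theta> 2, E 1, E 3] = - \<i> * cis \<theta>" "\<Upsilon> [normal_vec u \<theta> 2, E 1, E 2] = 0"
  "\<Upsilon> [normal_vec u \<theta> 3, E 2, E 3] = 0" "\<Upsilon> [normal_vec u \<theta> 3, E 1, E 3] = 0" "\<Upsilon> [normal_vec u \<theta> 3, E 1, E 2] = \<i> * cis \<theta>"
  unfolding adapted_Upsilon[OF u] list.map Upsilon0_eq zco_E zco_normal_vec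
  by (simp_all add: cis_third mult_ac)

lemma Omega_E:
  shows "\<Omega> [E 1, E 2] = 0" "\<Omega> [E 1, E 3] = 0" "\<Omega> [E 2, E 3] = 0"
  "\<Omega> [normal_vec u \<theta> 1, E 1] = -1" "\<Omega> [normal_vec u \<theta> 1, E 2] = 0" "\<Omega> [normal_vec u \<theta> 1, E 3] = 0"
  "\<Omega> [normal_vec u \<theta> 2, E 1] = 0" "\<Omega> [normal_vec u \<theta> 2, E 2] = -1" "\<Omega> [normal_vec u \<theta> 2, E 3] = 0"
  "\<Omega> [normal_vec u \<theta> 3, E 1] = 0" "\<Omega> [normal_vec u \<theta> 3, E 2] = 0" "\<Omega> [normal_vec u \<theta> 3, E 3] = -1"
proof -
  have cs: "- (sin (\<theta> / 3) * sin (\<theta> / 3)) - cos (\<theta> / 3) * cos (\<theta> / 3) = -1"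
    using sin_cos_squared_add[of "\<theta> / 3"] by (simp add: power2_eq_square)
  show "\<Omega> [E 1, E 2] = 0" "\<Omega> [E 1, E 3] = 0" "\<Omega> [E 2, E 3] = 0"
  "\<Omega> [normal_vec u \<theta> 1, E 1] = -1" "\<Omega> [normal_vec u \<theta> 1, E 2] = 0" "\<Omega> [normal_vec u \<theta> 1, E 3] = 0"
  "\<Omega> [normal_vec u \<theta> 2, E 1] = 0" "\<Omega> [normal_vec u \<theta> 2, E 2] = -1" "\<Omega> [normal_vec u \<theta> 2, E 3] = 0"
  "\<Omega> [normal_vec u \<theta> 3, E 1] = 0" "\<Omega> [normal_vec u \<theta> 3, E 2] = 0" "\<Omega> [normal_vec u \<theta> 3, E 3] = -1"
    unfolding adapted_Omega[OF u] list.map u_E u_normal_vec Omega0_eq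
    by (simp_all add: axis_def cs)
qed

lemma J_E:
  assumes "p \<in> {1, 2, 3}"
  shows "su3_J \<Omega> \<Upsilon> (E p) = normal_vec u \<theta> p" "su3_J \<Omega> \<Upsilon> (normal_vec u \<theta> p) = - E p"
proof -
  have inj: "u v = u w \<longleftrightarrow> v = w" for v w using adapted_bij[OF u] by (simp add: bij_is_inj inj_eq)
  have "u (su3_J \<Omega> \<Upsilon> (E p)) = u (normal_vec u \<theta> p)"
    using assms by (auto simp: adapted_J[OF u] u_E u_normal_vec vec6_eq_iff axis_def)
  then show "su3_J \<Omega> \<Upsilon> (E p) = normal_vec u \<theta> p" by (simp only: inj)
  have "u (su3_J \<Omega> \<Upsilon> (normal_vec u \<theta> p)) = u (- E p)"
    using assms by (auto simp: adapted_J[OF u] linear_neg[OF adapted_linear[OF u]] u_E u_normal_vec vec6_eq_iff axis_def)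
  then show "su3_J \<Omega> \<Upsilon> (normal_vec u \<theta> p) = - E p" by (simp only: inj)
qed

text \<open>A J-invariant 2-form is invariant under every rotation e^{it} applied to both arguments,
  so the rotated frame gives the same values as the original one.\<close>

lemma Lambda28_E:
  assumes \<tau>: "\<tau> \<in> Lambda28 \<Omega> \<Upsilon>"
  shows "\<tau> [E 2, E 3] = \<tau> [frame u 2, frame u 3]" "\<tau> [E 1, E 3] = - \<tau> [frame u 3, frame u 1]" "\<tau> [E 1, E 2] = \<tau> [frame u 1, frame u 2]"
proof -
  have alt: "alt_form 2 \<tau>" using \<tau> by (simp add: Lambda28_def)
  note l = linear_add[OF alt_form_2D(1)[OF alt]] linear_add[OF alt_form_2D(2)[OF alt]]
    linear_scale[OF alt_form_2D(1)[OF alt]] linear_scale[OF alt_form_2D(2)[OF alt]]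
  note sw = alt_form_2D(4)[OF alt]
  note r = Lambda28_relations[OF u \<tau>]
  have cs: "cos (\<theta> / 3) * (cos (\<theta> / 3) * a) + sin (\<theta> / 3) * (sin (\<theta> / 3) * a) = a" for a
    using sin_cos_squared_add2[of "\<theta> / 3"] by (simp add: power2_eq_square mult.assoc[symmetric] distrib_right[symmetric])
  show "\<tau> [E 2, E 3] = \<tau> [frame u 2, frame u 3]"
    using sw[of "frame u 5" "frame u 3"] r by (simp add: E_def tangent_vec_def l cs algebra_simps)
  show "\<tau> [E 1, E 3] = - \<tau> [frame u 3, frame u 1]"
    using sw[of "frame u 4" "frame u 6"] sw[of "frame u 1" "frame u 3"] sw[of "frame u 4" "frame u 3"] r by (simp add: E_def tangent_vec_def l cs algebra_simps)
  show "\<tau> [E 1, E 2] = \<tau> [frame u 1, frame u 2]"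
    using sw[of "frame u 4" "frame u 2"] r by (simp add: E_def tangent_vec_def l cs algebra_simps)
qed

lemma torsion_value_alt:
  assumes "alt_form 2 \<tau>2" "alt_form 2 \<tau>2h" "alt_form 1 \<tau>5"
  shows "alt_form 3 (\<lambda>l. torsion_value \<Omega> \<Upsilon> \<theta> \<tau>2 \<tau>2h \<tau>5 (w # l))"
  unfolding torsion_value_def
  by (intro alt_form_add alt_form_scale alt_form_wedge_1_3 alt_form_wedge_2_2 alt_form_Re_form
      adapted_alt_form[OF u] assms alt_form_pullback adapted_linear_J[OF u])

text \<open>The values of \<tau>5 on tangent vectors cancel between the cosine and the sine part,
  and those on the normal vector carry cos^2 + sin^2. In the products with \<Omega> only the term
  pairing a normal vector with its own tangent partner survives.\<close>

lemma torsion_value_E: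
  assumes \<tau>2: "\<tau>2 \<in> Lambda28 \<Omega> \<Upsilon>" and \<tau>2h: "\<tau>2h \<in> Lambda28 \<Omega> \<Upsilon>" and \<tau>5: "alt_form 1 \<tau>5"
  defines "f \<equiv> frame u"
  shows "torsion_value \<Omega> \<Upsilon> \<theta> \<tau>2 \<tau>2h \<tau>5 [normal_vec u \<theta> 1, E 1, E 2, E 3] = \<tau>5 [normal_vec u \<theta> 1] - (cos \<theta> * \<tau>2 [f 2, f 3] + sin \<theta> * \<tau>2h [f 2, f 3])"
    "torsion_value \<Omega> \<Upsilon> \<theta> \<tau>2 \<tau>2h \<tau>5 [normal_vec u \<theta> 2, E 1, E 2, E 3] = \<tau>5 [normal_vec u \<theta> 2] - (cos \<theta> * \<tau>2 [f 3, f 1] + sin \<theta> * \<tau>2h [f 3, f 1])"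
    "torsion_value \<Omega> \<Upsilon> \<theta> \<tau>2 \<tau>2h \<tau>5 [normal_vec u \<theta> 3, E 1, E 2, E 3] = \<tau>5 [normal_vec u \<theta> 3] - (cos \<theta> * \<tau>2 [f 1, f 2] + sin \<theta> * \<tau>2h [f 1, f 2])"
proof -
  have alt2: "alt_form 2 \<tau>2" "alt_form 2 \<tau>2h" using \<tau>2 \<tau>2h by (simp_all add: Lambda28_def)
  have alt5: "alt_form 1 (pullback (su3_J \<Omega> \<Upsilon>) \<tau>5)"
    by (rule alt_form_pullback[OF \<tau>5 adapted_linear_J[OF u]])
  note alt3 = alt_form_Re_form[OF adapted_alt_form(2)[OF u]]
  note W = wedge_1_3[OF \<tau>5 alt3] wedge_1_3[OF alt5 alt3] wedge_2_2[OF alt2(1) adapted_alt_form(1)[OF u]]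
    wedge_2_2[OF alt2(2) adapted_alt_form(1)[OF u]]
  have neg: "\<tau>5 [- v] = - \<tau>5 [v]" for v using linear_neg[OF alt_form_1D[OF \<tau>5]] .
  have pb: "pullback (su3_J \<Omega> \<Upsilon>) \<tau>5 [v] = \<tau>5 [su3_J \<Omega> \<Upsilon> v]" for v by (simp add: pullback_def)
  have re: "Re_form \<Upsilon> [x, y, z] = Re (\<Upsilon> [x, y, z])" for x y z by (simp add: Re_form_def)
  have cs: "cos \<theta> * (a * cos \<theta> + x) + sin \<theta> * (a * sin \<theta> + y) = a + (cos \<theta> * x + sin \<theta> * y)" for a x y
  proof -
    have "cos \<theta> * (a * cos \<theta> + x) + sin \<theta> * (a * sin \<theta> + y) = a * (cos \<theta> ^ 2 + sin \<theta> ^ 2) + (cos \<theta> * x + sin \<theta> * y)"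
      by algebra
    then show ?thesis by simp
  qed
  note S = torsion_value_def W pb J_E neg re Upsilon_E Omega_E Lambda28_E[OF \<tau>2] Lambda28_E[OF \<tau>2h] f_def
  have "torsion_value \<Omega> \<Upsilon> \<theta> \<tau>2 \<tau>2h \<tau>5 [normal_vec u \<theta> 1, E 1, E 2, E 3] =
      cos \<theta> * (\<tau>5 [normal_vec u \<theta> 1] * cos \<theta> + - \<tau>2 [f 2, f 3]) + sin \<theta> * (\<tau>5 [normal_vec u \<theta> 1] * sin \<theta> + - \<tau>2h [f 2, f 3])"
    by (simp add: S, simp add: algebra_simps)
  then show "torsion_value \<Omega> \<Upsilon> \<theta> \<tau>2 \<tau>2h \<tau>5 [normal_vec u \<theta> 1, E 1, E 2, E 3] = \<tau>5 [normal_vec u \<theta> 1] - (cos \<theta> * \<tau>2 [f 2, f 3] + sin \<theta> * \<tau>2h [f 2, f 3])"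
    unfolding cs by simp
  have "torsion_value \<Omega> \<Upsilon> \<theta> \<tau>2 \<tau>2h \<tau>5 [normal_vec u \<theta> 2, E 1, E 2, E 3] =
      cos \<theta> * (\<tau>5 [normal_vec u \<theta> 2] * cos \<theta> + - \<tau>2 [f 3, f 1]) + sin \<theta> * (\<tau>5 [normal_vec u \<theta> 2] * sin \<theta> + - \<tau>2h [f 3, f 1])"
    by (simp add: S, simp add: algebra_simps)
  then show "torsion_value \<Omega> \<Upsilon> \<theta> \<tau>2 \<tau>2h \<tau>5 [normal_vec u \<theta> 2, E 1, E 2, E 3] = \<tau>5 [normal_vec u \<theta> 2] - (cos \<theta> * \<tau>2 [f 3, f 1] + sin \<theta> * \<tau>2h [f 3, f 1])"
    unfolding cs by simp
  have "torsion_value \<Omega> \<Upsilon> \<theta> \<tau>2 \<tau>2h \<tau>5 [normal_vec u \<theta> 3, E 1, E 2, E 3] =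
      cos \<theta> * (\<tau>5 [normal_vec u \<theta> 3] * cos \<theta> + - \<tau>2 [f 1, f 2]) + sin \<theta> * (\<tau>5 [normal_vec u \<theta> 3] * sin \<theta> + - \<tau>2h [f 1, f 2])"
    by (simp add: S, simp add: algebra_simps)
  then show "torsion_value \<Omega> \<Upsilon> \<theta> \<tau>2 \<tau>2h \<tau>5 [normal_vec u \<theta> 3, E 1, E 2, E 3] = \<tau>5 [normal_vec u \<theta> 3] - (cos \<theta> * \<tau>2 [f 1, f 2] + sin \<theta> * \<tau>2h [f 1, f 2])"
    unfolding cs by simp
qed

end


section \<open>Coordinate expressions in charts\<close>

lemma smooth_on_differentiable: "smooth_on S f \<Longrightarrow> x \<in> S \<Longrightarrow> f differentiable (at x)"
  unfolding smooth_on_def by (metis Ck_on.simps(2))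

lemma open_coord_dom:
  assumes N: "smooth_manifold N B" and M: "smooth_manifold M A" and f: "continuous_map N M f"
    and d: "d \<in> B" and c: "c \<in> A"
  shows "open (coord_dom d f c)"
proof -
  have hom: "homeomorphic_map (subtopology N (fst d)) (top_of_set (chart_img d)) (snd d)"
    and od: "openin N (fst d)" and oc: "openin M (fst c)" and oi: "open (chart_img d)"
    using N M d c by (auto simp: smooth_manifold_def)
  have "openin N {p \<in> topspace N. f p \<in> fst c}"
    using openin_continuous_map_preimage[OF f oc] .
  then have "openin (subtopology N (fst d)) (fst d \<inter> {p \<in> topspace N. f p \<in> fst c})"
    by (rule openin_subtopology_Int2)
  moreover have "fst d \<inter> {p \<in> topspace N. f p \<in> fst c} = {p \<in> fst d. f p \<in> fst c}"
    using openin_subset[OF od] by auto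
  ultimately have "openin (top_of_set (chart_img d)) (snd d ` {p \<in> fst d. f p \<in> fst c})"
    using homeomorphic_imp_open_map[OF hom] unfolding open_map_def by metis
  then show ?thesis
    using oi by (simp add: coord_dom_def openin_open_eq)
qed

lemma chart_inj_on:
  assumes N: "smooth_manifold N B" and d: "d \<in> B"
  shows "inj_on (snd d) (fst d)"
proof -
  have "homeomorphic_map (subtopology N (fst d)) (top_of_set (chart_img d)) (snd d)" and "openin N (fst d)"
    using N d by (auto simp: smooth_manifold_def)
  then show ?thesis
    using homeomorphic_imp_injective_map openin_subset by (metis topspace_subtopology_subset)
qed

lemma coord_rep_eq:
  assumes "smooth_manifold N B" "d \<in> B" "p \<in> fst d"
  shows "coord_rep d f c (snd d p) = snd c (f p)"
  unfolding coord_rep_def using chart_inj_on[OF assms(1,2)] assms(3) by simp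

lemma sl_patch_chart:
  assumes M: "smooth_manifold M A" and su3: "su3_structure A \<Omega> \<Upsilon>"
    and sl: "special_lagrangian M A \<Omega> \<Upsilon> \<theta> N B f" and d: "d \<in> B" and c: "c \<in> A"
  shows "sl_patch (chart_img c) (coord_dom d f c) (coord_rep d f c) (\<Omega> c) (\<Upsilon> c) \<theta>"
proof -
  let ?W = "coord_dom d f c" and ?F = "coord_rep d f c"
  have N: "smooth_manifold N B" and imm: "immersion N B M A f"
    using sl by (auto simp: special_lagrangian_def)
  have cont: "continuous_map N M f" and sm: "smooth_on ?W ?F"
    using imm d c by (auto simp: immersion_def smooth_map_def)
  have C2: "Ck_on (Suc (Suc 0)) ?W ?F" using sm by (simp add: smooth_on_def)
  have W: "\<exists>p\<in>fst d. f p \<in> fst c \<and> s = snd d p \<and> ?F s = snd c (f p)" if "s \<in> ?W" for s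
  proof -
    obtain p where p: "p \<in> fst d" "f p \<in> fst c" "s = snd d p" using \<open>s \<in> ?W\<close> by (auto simp: coord_dom_def)
    then show ?thesis using coord_rep_eq[OF N d p(1), of f c] by blast
  qed
  show ?thesis
  proof
    show "open (chart_img c)" using M c by (auto simp: smooth_manifold_def)
    show "open ?W" by (rule open_coord_dom[OF N M cont d c])
    show "?F s \<in> chart_img c" if "s \<in> ?W" for s
      using W[OF that] by (auto simp: chart_img_def)
    show "?F differentiable (at s)" if "s \<in> ?W" for s
      using C2 that by simp
    show "(\<lambda>r. frechet_derivative ?F (at r) v) differentiable (at s)" if "s \<in> ?W" for s v
      using C2 that by simp
    show "continuous_on ?W (\<lambda>s. frechet_derivative (\<lambda>r. frechet_derivative ?F (at r) a) (at s) b)" for a b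
      using C2 by simp
    show "\<exists>u. adapted (\<Omega> c y) (\<Upsilon> c y) u" if "y \<in> chart_img c" for y
      using su3 c that by (auto simp: su3_structure_def)
    show "(\<lambda>x. \<Omega> c x l) differentiable (at y)" "(\<lambda>x. \<Upsilon> c x l) differentiable (at y)" if "y \<in> chart_img c" for y l
      using su3 c that by (auto simp: su3_structure_def diff_form_def intro!: smooth_on_differentiable)
    show "sl_plane (\<Omega> c (?F s)) (\<Upsilon> c (?F s)) \<theta> (range (frechet_derivative ?F (at s)))" if s: "s \<in> ?W" for s
    proof -
      obtain p where p: "p \<in> fst d" "f p \<in> fst c" "s = snd d p" "?F s = snd c (f p)" using W[OF s] by blast
      have "sl_plane (\<Omega> c (snd c (f p))) (\<Upsilon> c (snd c (f p))) \<theta> (tangent_plane d f c (snd d p))"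
        using sl d c p by (auto simp: special_lagrangian_def)
      then show ?thesis unfolding p(4) by (simp add: tangent_plane_def p(3))
    qed
    show "inj (frechet_derivative ?F (at s))" if "s \<in> ?W" for s
      using imm d c that by (auto simp: immersion_def)
  qed
qed

section \<open>The mean curvature in terms of the torsion forms\<close>

context sl_patch
begin

lemma ext_deriv_\<phi>:
  assumes y: "y \<in> U"
  shows "ext_deriv \<phi> y l = cos \<theta> * ext_deriv (\<lambda>z. Re_form (\<Upsilon> z)) y l + sin \<theta> * ext_deriv (\<lambda>z. Im_form (\<Upsilon> z)) y l"
proof -
  have "frechet_derivative (\<lambda>z. \<phi> z l) (at y) =
      (\<lambda>h. cos \<theta> * frechet_derivative (\<lambda>z. Re_form (\<Upsilon> z) l) (at y) h + sin \<theta> * frechet_derivative (\<lambda>z. Im_form (\<Upsilon> z) l) (at y) h)" for l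
  proof -
    have "((\<lambda>z. Re_form (\<Upsilon> z) l) has_derivative frechet_derivative (\<lambda>z. Re_form (\<Upsilon> z) l) (at y)) (at y)"
      "((\<lambda>z. Im_form (\<Upsilon> z) l) has_derivative frechet_derivative (\<lambda>z. Im_form (\<Upsilon> z) l) (at y)) (at y)"
      unfolding Re_form_def Im_form_def
      by (rule differentiable_has_derivative, rule differentiable_Re differentiable_Im, rule d\<Upsilon>[OF y])+
    then have "((\<lambda>z. cos \<theta> * Re_form (\<Upsilon> z) l + sin \<theta> * Im_form (\<Upsilon> z) l) has_derivative
      (\<lambda>h. cos \<theta> * frechet_derivative (\<lambda>z. Re_form (\<Upsilon> z) l) (at y) h + sin \<theta> * frechet_derivative (\<lambda>z. Im_form (\<Upsilon> z) l) (at y) h)) (at y)"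
      by (intro has_derivative_add has_derivative_mult_right)
    moreover have "(\<lambda>z. cos \<theta> * Re_form (\<Upsilon> z) l + sin \<theta> * Im_form (\<Upsilon> z) l) = (\<lambda>z. \<phi> z l)"
      by (simp add: fun_eq_iff \<phi>_def Re_form_def Im_form_def)
    ultimately show ?thesis
      using frechet_derivative_at by fastforce
  qed
  then show ?thesis
    unfolding ext_deriv_def by (simp add: sum_distrib_left sum.distrib[symmetric] algebra_simps)
qed

lemma ext_deriv_\<phi>_torsion:
  assumes s: "s \<in> W"
    and dRe: "\<And>vs. ext_deriv (\<lambda>z. Re_form (\<Upsilon> z)) (F s) vs = 2 * t0h * (\<Omega> (F s) \<and>\<^sub>w \<Omega> (F s)) vs
      + (\<tau>5 \<and>\<^sub>w Re_form (\<Upsilon> (F s))) vs + (\<tau>2 \<and>\<^sub>w \<Omega> (F s)) vs"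
    and dIm: "\<And>vs. ext_deriv (\<lambda>z. Im_form (\<Upsilon> z)) (F s) vs = - 2 * t0 * (\<Omega> (F s) \<and>\<^sub>w \<Omega> (F s)) vs
      + (pullback (su3_J (\<Omega> (F s)) (\<Upsilon> (F s))) \<tau>5 \<and>\<^sub>w Re_form (\<Upsilon> (F s))) vs + (\<tau>2h \<and>\<^sub>w \<Omega> (F s)) vs"
  shows "ext_deriv \<phi> (F s) [w, P 1 s, P 2 s, P 3 s] = torsion_value (\<Omega> (F s)) (\<Upsilon> (F s)) \<theta> \<tau>2 \<tau>2h \<tau>5 [w, P 1 s, P 2 s, P 3 s]"
proof -
  note alt = \<Omega>_alt[OF FU[OF s]]
  \<comment> \<open>Of the four arguments three are tangent, so in every summand one of the two
    factors pairs tangent vectors.\<close>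
  have "(\<Omega> (F s) \<and>\<^sub>w \<Omega> (F s)) [w, P 1 s, P 2 s, P 3 s] = 0"
    unfolding wedge_2_2[OF alt alt] by (simp add: \<Omega>_P[OF s])
  then show ?thesis
    unfolding ext_deriv_\<phi>[OF FU[OF s]] dRe dIm torsion_value_def by simp
qed

text \<open>The mean curvature vector is itself normal and may be taken as w, which leaves its
  square length.\<close>

lemma minimal_of_torsion_free:
  assumes s: "s \<in> W"
    and "\<And>w. ext_deriv \<phi> (F s) [w, P 1 s, P 2 s, P 3 s] = 0"
  shows "mean_curvature G F s = 0"
proof -
  have "G (F s) (mean_curvature G F s) (mean_curvature G F s) * \<Phi> s = 0"
    using mean_curvature_variation[OF s mean_curvature_normal[OF s]] assms(2) by simp
  then show ?thesis using \<Phi>_nonzero[OF s] G_eq_0[OF FU[OF s]] by simp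
qed

text \<open>\<open>T_sharp\<close> is the tangent plane rotated by e^{-i \<theta> / 3}; rotating
  back carries its frame vectors to E.\<close>

lemma sl_adapted_plane:
  assumes s: "s \<in> W" and slu: "sl_adapted (\<Omega> (F s)) (\<Upsilon> (F s)) \<theta> (range (frechet_derivative F (at s))) u"
  defines "E \<equiv> tangent_vec u \<theta>"
  shows "range (frechet_derivative F (at s)) = {a *\<^sub>R E 1 + b *\<^sub>R E 2 + c *\<^sub>R E 3 | a b c. True}"
proof -
  let ?\<Omega> = "\<Omega> (F s)" and ?\<Upsilon> = "\<Upsilon> (F s)" and ?E = "range (frechet_derivative F (at s))"
  have u: "adapted ?\<Omega> ?\<Upsilon> u" and T: "T_sharp ?\<Omega> ?\<Upsilon> \<theta> ?E = span (frame u ` {1, 2, 3})"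
    using slu by (auto simp: sl_adapted_def)
  have sp: "span (frame u ` {1, 2, 3}) = {a *\<^sub>R frame u 1 + b *\<^sub>R frame u 2 + c *\<^sub>R frame u 3 | a b c. True}"
    by (auto simp: span_insert span_empty algebra_simps)
  let ?z = "\<lambda>t. complex_act ?\<Omega> ?\<Upsilon> (cis t)"
  have uz: "u (?z t v) = cos t *\<^sub>R u v + sin t *\<^sub>R J0 (u v)" for t v
    by (simp add: complex_act_def linear_add[OF adapted_linear[OF u]] linear_scale[OF adapted_linear[OF u]] adapted_J[OF u])
  have inj: "u v = u w \<longleftrightarrow> v = w" for v w using adapted_bij[OF u] by (simp add: bij_is_inj inj_eq)
  have inverse: "?z (\<theta> / 3) (?z (- \<theta> / 3) v) = v" for v
  proof -
    have cs: "(cos (\<theta> / 3) * cos (\<theta> / 3)) *\<^sub>R x + (sin (\<theta> / 3) * sin (\<theta> / 3)) *\<^sub>R x = x" for x :: "real^6"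
      by (simp only: scaleR_add_left[symmetric] sin_cos_squared_add3 scaleR_one)
    have "u (?z (\<theta> / 3) (?z (- \<theta> / 3) v)) = u v"
      unfolding uz linear_add[OF linear_J0] linear_scale[OF linear_J0] J0_J0
      by (simp add: algebra_simps cs)
    then show ?thesis by (simp add: inj)
  qed
  have zE: "?z (\<theta> / 3) (a *\<^sub>R frame u 1 + b *\<^sub>R frame u 2 + c *\<^sub>R frame u 3) = a *\<^sub>R E 1 + b *\<^sub>R E 2 + c *\<^sub>R E 3" for a b c
    by (subst inj[symmetric])
       (simp add: uz linear_add[OF adapted_linear[OF u]] linear_scale[OF adapted_linear[OF u]] u_frame[OF u]
         linear_add[OF linear_J0] linear_scale[OF linear_J0] u_E[OF u, where \<theta> = \<theta>, folded E_def] vec6_eq_iff axis_def)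
  have "?E = ?z (\<theta> / 3) ` ?z (- \<theta> / 3) ` ?E"
    by (simp only: image_image inverse image_ident)
  also have "?z (- \<theta> / 3) ` ?E = {a *\<^sub>R frame u 1 + b *\<^sub>R frame u 2 + c *\<^sub>R frame u 3 | a b c. True}"
    using T sp unfolding T_sharp_def by simp
  also have "?z (\<theta> / 3) ` \<dots> = {a *\<^sub>R E 1 + b *\<^sub>R E 2 + c *\<^sub>R E 3 | a b c. True}"
    by (auto simp: zE[symmetric] image_iff)
  finally show ?thesis .
qed


text \<open>The vectors E p and n p form an orthonormal basis. The products of the mean curvature
  with the E p vanish, and the first variation formula gives those with the n p.\<close>

lemma mean_curvature_formula:
  assumes s: "s \<in> W" and slu: "sl_adapted (\<Omega> (F s)) (\<Upsilon> (F s)) \<theta> (range (frechet_derivative F (at s))) u"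
    and \<tau>2: "\<tau>2 \<in> Lambda28 (\<Omega> (F s)) (\<Upsilon> (F s))" and \<tau>2h: "\<tau>2h \<in> Lambda28 (\<Omega> (F s)) (\<Upsilon> (F s))"
    and \<tau>5: "alt_form 1 \<tau>5"
    and tv: "\<And>w. ext_deriv \<phi> (F s) [w, P 1 s, P 2 s, P 3 s] = torsion_value (\<Omega> (F s)) (\<Upsilon> (F s)) \<theta> \<tau>2 \<tau>2h \<tau>5 [w, P 1 s, P 2 s, P 3 s]"
  shows "mean_curvature G F s =
             - ((1 / sqrt 2) * cos \<theta>) *\<^sub>R natural_iso u \<theta> (proj_Lambda28_1 u \<tau>2)
             - ((1 / sqrt 2) * sin \<theta>) *\<^sub>R natural_iso u \<theta> (proj_Lambda28_1 u \<tau>2h)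
             + sin (\<theta> / 3) *\<^sub>R section_iso u \<theta> (T_component u \<tau>5)
             - cos (\<theta> / 3) *\<^sub>R section_iso u \<theta>
                 (pullback (su3_J (\<Omega> (F s)) (\<Upsilon> (F s))) (N_component u \<tau>5))"
proof -
  let ?\<Omega> = "\<Omega> (F s)" and ?\<Upsilon> = "\<Upsilon> (F s)"
  define E where "E = tangent_vec u \<theta>"
  define n where "n = normal_vec u \<theta>"
  define f where "f = frame u"
  \<comment> \<open>The value of d\<phi> on \<open>[n p, E 1, E 2, E 3]\<close>, as computed in
    \<open>torsion_value_E\<close>.\<close>
  define \<kappa> where "\<kappa> = (\<lambda>p::6. \<tau>5 [n p] - (if p = 1 then cos \<theta> * \<tau>2 [f 2, f 3] + sin \<theta> * \<tau>2h [f 2, f 3]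
     else if p = 2 then cos \<theta> * \<tau>2 [f 3, f 1] + sin \<theta> * \<tau>2h [f 3, f 1] else cos \<theta> * \<tau>2 [f 1, f 2] + sin \<theta> * \<tau>2h [f 1, f 2]))"
  have u: "adapted ?\<Omega> ?\<Upsilon> u" using slu by (auto simp: sl_adapted_def)
  have y: "F s \<in> U" by (rule FU[OF s])
  note plane = sl_adapted_plane[OF s slu, folded E_def]
  note lin = adapted_linear[OF u]
  have Gu: "G (F s) v w = u v \<bullet> u w" for v w by (simp add: G_def adapted_metric[OF u])
  have cs: "cos (\<theta> / 3) * cos (\<theta> / 3) + sin (\<theta> / 3) * sin (\<theta> / 3) = 1"
    "sin (\<theta> / 3) * sin (\<theta> / 3) + cos (\<theta> / 3) * cos (\<theta> / 3) = 1"
    by (rule sin_cos_squared_add3, subst add.commute, rule sin_cos_squared_add3)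
  have nE: "G (F s) (n p) (E q) = 0" if "p \<in> {1, 2, 3}" "q \<in> {1, 2, 3}" for p q
    using that unfolding Gu n_def u_E[OF u, where \<theta> = \<theta>, folded E_def] u_normal_vec[OF u] inner_vec6
    by (auto simp: axis_def)
  have nn: "G (F s) (n p) (n q) = (if p = q then 1 else 0)" if "p \<in> {1, 2, 3}" "q \<in> {1, 2, 3}" for p q
    using that unfolding Gu n_def u_normal_vec[OF u] inner_vec6
    by (elim insertE emptyE; hypsubst; simp add: axis_def cs)
  have Ptan: "\<exists>a b c. P i s = a *\<^sub>R E 1 + b *\<^sub>R E 2 + c *\<^sub>R E 3" for i
    using P_range[of i s] unfolding plane by blast
  have nP: "G (F s) (n p) (P i s) = 0" if p: "p \<in> {1, 2, 3}" for p i
  proof -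
    obtain a b c where "P i s = a *\<^sub>R E 1 + b *\<^sub>R E 2 + c *\<^sub>R E 3" using Ptan by blast
    then show ?thesis
      by (simp add: linear_add[OF G_lin(2)[OF y]] linear_scale[OF G_lin(2)[OF y]] nE[OF p])
  qed
  obtain a1 a2 a3 b1 b2 b3 c1 c2 c3 where P: "P 1 s = a1 *\<^sub>R E 1 + a2 *\<^sub>R E 2 + a3 *\<^sub>R E 3"
    "P 2 s = b1 *\<^sub>R E 1 + b2 *\<^sub>R E 2 + b3 *\<^sub>R E 3" "P 3 s = c1 *\<^sub>R E 1 + c2 *\<^sub>R E 2 + c3 *\<^sub>R E 3"
    using Ptan by metis
  \<comment> \<open>The determinant of the coordinate frame with respect to E. It occurs on both
    sides of the variation formula and cancels.\<close>
  define D where "D = a1 * b2 * c3 - a1 * b3 * c2 - a2 * b1 * c3 + a2 * b3 * c1 + a3 * b1 * c2 - a3 * b2 * c1"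
  have "\<phi> (F s) [E 1, E 2, E 3] = 1"
    unfolding \<phi>_def Upsilon_E(1)[OF u, where \<theta> = \<theta>, folded E_def] by (simp add: cis_mult)
  then have \<Phi>: "\<Phi> s = D"
    unfolding P alt_form_3_det[OF \<phi>_alt[OF y]] D_def by simp
  have alt2: "alt_form 2 \<tau>2" "alt_form 2 \<tau>2h" using \<tau>2 \<tau>2h by (simp_all add: Lambda28_def)
  have tvE: "torsion_value ?\<Omega> ?\<Upsilon> \<theta> \<tau>2 \<tau>2h \<tau>5 [n p, E 1, E 2, E 3] = \<kappa> p" if "p \<in> {1, 2, 3}" for p
    using that torsion_value_E[OF u \<tau>2 \<tau>2h \<tau>5, where \<theta> = \<theta>, folded E_def f_def n_def] by (auto simp: \<kappa>_def n_def f_def)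
  have H: "G (F s) (n p) (mean_curvature G F s) = - \<kappa> p" if p: "p \<in> {1, 2, 3}" for p
  proof -
    have "torsion_value ?\<Omega> ?\<Upsilon> \<theta> \<tau>2 \<tau>2h \<tau>5 [n p, P 1 s, P 2 s, P 3 s] = D * \<kappa> p"
      unfolding P alt_form_3_det[OF torsion_value_alt[OF u alt2 \<tau>5]] D_def tvE[OF p] ..
    then have "G (F s) (n p) (mean_curvature G F s) * D = - \<kappa> p * D"
      using mean_curvature_variation[OF s nP[OF p]] unfolding tv \<Phi> by simp
    then show ?thesis by (rule mult_right_cancel[OF \<Phi>_nonzero[OF s, unfolded \<Phi>], THEN iffD1])
  qed
  define R where "R = (- \<kappa> 1) *\<^sub>R n 1 + (- \<kappa> 2) *\<^sub>R n 2 + (- \<kappa> 3) *\<^sub>R n 3"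
  note lG = linear_add[OF G_lin(2)[OF y]] linear_scale[OF G_lin(2)[OF y]] linear_diff[OF G_lin(2)[OF y]]
  have Rn: "G (F s) (n p) R = - \<kappa> p" if "p \<in> {1, 2, 3}" for p
    using that by (elim insertE emptyE; hypsubst; simp add: R_def lG nn linear_neg[OF G_lin(2)[OF y]])
  have RE: "G (F s) (E p) R = 0" if "p \<in> {1, 2, 3}" for p
  proof -
    have "G (F s) (E p) (n q) = 0" if "q \<in> {1, 2, 3}" for q
      using nE[OF that \<open>p \<in> {1, 2, 3}\<close>] G_sym[OF y, of "E p"] by simp
    then show ?thesis by (simp add: R_def lG linear_neg[OF G_lin(2)[OF y]])
  qed
  have E_mem: "E p \<in> range (frechet_derivative F (at s))" if "p \<in> {1, 2, 3}" for p
  proof -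
    have "E 1 = 1 *\<^sub>R E 1 + 0 *\<^sub>R E 2 + 0 *\<^sub>R E 3" "E 2 = 0 *\<^sub>R E 1 + 1 *\<^sub>R E 2 + 0 *\<^sub>R E 3" "E 3 = 0 *\<^sub>R E 1 + 0 *\<^sub>R E 2 + 1 *\<^sub>R E 3"
      by simp_all
    then show ?thesis using that unfolding plane by blast
  qed
  have HE: "G (F s) (E p) (mean_curvature G F s) = 0" if "p \<in> {1, 2, 3}" for p
  proof -
    have "\<forall>t\<in>range (frechet_derivative F (at s)). G (F s) (mean_curvature G F s) t = 0"
      using normal_iff[OF s, of "mean_curvature G F s"] mean_curvature_normal[OF s] by blast
    then have "G (F s) (mean_curvature G F s) (E p) = 0" using E_mem[OF that] by blast
    then show ?thesis using G_sym[OF y, of "E p" "mean_curvature G F s"] by simp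
  qed
  \<comment> \<open>The difference is orthogonal to every n p and E p. In coordinates this says that
    rotations by \<theta> / 3 annihilate the pairs (x 1, x 4), (x 2, x 5), (x 3, x 6), so x is
    zero.\<close>
  define x where "x = u (mean_curvature G F s - R)"
  have "u (n p) \<bullet> x = 0" "u (E p) \<bullet> x = 0" if "p \<in> {1, 2, 3}" for p
    using H[OF that] Rn[OF that] HE[OF that] RE[OF that] unfolding x_def Gu[symmetric] lG by simp_all
  from this[of 1] this[of 2] this[of 3]
  have rel: "cos (\<theta> / 3) * x $ 1 + sin (\<theta> / 3) * x $ 4 = 0" "- sin (\<theta> / 3) * x $ 1 + cos (\<theta> / 3) * x $ 4 = 0"
    "cos (\<theta> / 3) * x $ 2 + sin (\<theta> / 3) * x $ 5 = 0" "- sin (\<theta> / 3) * x $ 2 + cos (\<theta> / 3) * x $ 5 = 0"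
    "cos (\<theta> / 3) * x $ 3 + sin (\<theta> / 3) * x $ 6 = 0" "- sin (\<theta> / 3) * x $ 3 + cos (\<theta> / 3) * x $ 6 = 0"
    by (simp_all add: n_def u_E[OF u, where \<theta> = \<theta>, folded E_def] u_normal_vec[OF u] inner_vec6 axis_def)
  have rot: "a = 0 \<and> b = 0" if "cos (\<theta> / 3) * a + sin (\<theta> / 3) * b = 0" "- sin (\<theta> / 3) * a + cos (\<theta> / 3) * b = 0" for a b
  proof -
    have "(cos (\<theta> / 3) * cos (\<theta> / 3) + sin (\<theta> / 3) * sin (\<theta> / 3)) * a = 0"
      "(cos (\<theta> / 3) * cos (\<theta> / 3) + sin (\<theta> / 3) * sin (\<theta> / 3)) * b = 0"
      using that by algebra+
    then show ?thesis by (simp only: cs mult_1)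
  qed
  have "x = 0" using rot[OF rel(1,2)] rot[OF rel(3,4)] rot[OF rel(5,6)] by (simp add: vec6_eq_iff)
  then have "G (F s) (mean_curvature G F s - R) (mean_curvature G F s - R) = 0"
    by (simp add: Gu x_def)
  then have HR: "mean_curvature G F s = R" using G_eq_0[OF y] by simp
  have T: "T_component u \<tau>5 = (\<lambda>vs. \<Sum>p\<in>{1, 2, 3}. \<tau>5 [f p] * coframe u p vs)"
    by (simp add: T_component_def f_def)
  \<comment> \<open>Expanding n p separates the \<tau>5 term into its T and N parts. In the \<tau>2
    terms the factor sqrt 2 of \<open>natural_iso\<close> cancels against 1 / sqrt 2.\<close>
  have tn: "\<tau>5 [n p] = - sin (\<theta> / 3) * \<tau>5 [f p] + cos (\<theta> / 3) * \<tau>5 [f (p + 3)]" for p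
    unfolding n_def normal_vec_def f_def
    by (simp only: linear_add[OF alt_form_1D[OF \<tau>5]] linear_scale[OF alt_form_1D[OF \<tau>5]] real_scaleR_def)
  show ?thesis
    unfolding HR T proj_Lambda28_1_eq[OF u \<tau>2] proj_Lambda28_1_eq[OF u \<tau>2h] natural_iso_eq[OF u] pullback_J_N_component[OF u]
      section_iso_eq[OF u] R_def \<kappa>_def tn
    by (simp add: f_def[symmetric] n_def[symmetric] algebra_simps)
qed

end


section \<open>From coordinate patches to the manifold\<close>

lemma torsion_formsD:
  assumes "torsion_forms A \<Omega> \<Upsilon> \<tau>0 \<tau>0h \<tau>2 \<tau>2h \<tau>3 \<tau>4 \<tau>5" "c \<in> A" "y \<in> chart_img c"
  shows "alt_form 1 (\<tau>5 c y)" "\<tau>2 c y \<in> Lambda28 (\<Omega> c y) (\<Upsilon> c y)" "\<tau>2h c y \<in> Lambda28 (\<Omega> c y) (\<Upsilon> c y)"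
    "ext_deriv (\<lambda>z. Re_form (\<Upsilon> c z)) y vs =
           2 * \<tau>0h c y [] * (\<Omega> c y \<and>\<^sub>w \<Omega> c y) vs + (\<tau>5 c y \<and>\<^sub>w Re_form (\<Upsilon> c y)) vs
           + (\<tau>2 c y \<and>\<^sub>w \<Omega> c y) vs"
    "ext_deriv (\<lambda>z. Im_form (\<Upsilon> c z)) y vs =
           - 2 * \<tau>0 c y [] * (\<Omega> c y \<and>\<^sub>w \<Omega> c y) vs
           + (pullback (su3_J (\<Omega> c y) (\<Upsilon> c y)) (\<tau>5 c y) \<and>\<^sub>w Re_form (\<Upsilon> c y)) vs
           + (\<tau>2h c y \<and>\<^sub>w \<Omega> c y) vs"
  using assms unfolding torsion_forms_def diff_form_def by blast+

lemma coord_dom_mem: "p \<in> fst d \<Longrightarrow> f p \<in> fst c \<Longrightarrow> snd d p \<in> coord_dom d f c"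
  by (auto simp: coord_dom_def)

lemma su3_mean_curvature_formula:
  assumes M: "smooth_manifold M A" and su3: "su3_structure A \<Omega> \<Upsilon>"
    and tor: "torsion_forms A \<Omega> \<Upsilon> \<tau>0 \<tau>0h \<tau>2 \<tau>2h \<tau>3 \<tau>4 \<tau>5"
    and sl: "special_lagrangian M A \<Omega> \<Upsilon> \<theta> N B f"
    and d: "d \<in> B" and c: "c \<in> A" and p: "p \<in> fst d" "f p \<in> fst c"
  defines "y \<equiv> snd c (f p)"
  assumes u: "sl_adapted (\<Omega> c y) (\<Upsilon> c y) \<theta> (tangent_plane d f c (snd d p)) u"
  shows "su3_mean_curvature \<Omega> \<Upsilon> d f c p =
             - ((1 / sqrt 2) * cos \<theta>) *\<^sub>R natural_iso u \<theta> (proj_Lambda28_1 u (\<tau>2 c y))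
             - ((1 / sqrt 2) * sin \<theta>) *\<^sub>R natural_iso u \<theta> (proj_Lambda28_1 u (\<tau>2h c y))
             + sin (\<theta> / 3) *\<^sub>R section_iso u \<theta> (T_component u (\<tau>5 c y))
             - cos (\<theta> / 3) *\<^sub>R section_iso u \<theta>
                 (pullback (su3_J (\<Omega> c y) (\<Upsilon> c y)) (N_component u (\<tau>5 c y)))"
proof -
  have N: "smooth_manifold N B" using sl by (simp add: special_lagrangian_def)
  interpret sl_patch "chart_img c" "coord_dom d f c" "coord_rep d f c" "\<Omega> c" "\<Upsilon> c" \<theta>
    by (rule sl_patch_chart[OF M su3 sl d c])
  have s: "snd d p \<in> coord_dom d f c" by (rule coord_dom_mem[where f = f, OF p])
  have Fs: "coord_rep d f c (snd d p) = y"
    using coord_rep_eq[OF N d p(1), of f c] by (simp add: y_def)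
  have y: "y \<in> chart_img c" using FU[OF s] by (simp add: Fs)
  have G: "G = (\<lambda>y. su3_metric (\<Omega> c y) (\<Upsilon> c y))" by (simp add: fun_eq_iff G_def)
  note t = torsion_formsD[OF tor c y]
  have tv: "ext_deriv \<phi> (coord_rep d f c (snd d p)) [w, P 1 (snd d p), P 2 (snd d p), P 3 (snd d p)]
     = torsion_value (\<Omega> c y) (\<Upsilon> c y) \<theta> (\<tau>2 c y) (\<tau>2h c y) (\<tau>5 c y) [w, P 1 (snd d p), P 2 (snd d p), P 3 (snd d p)]" for w
    using ext_deriv_\<phi>_torsion[OF s, unfolded Fs, OF t(4,5)] unfolding Fs .
  show ?thesis
    using mean_curvature_formula[OF s, unfolded Fs, OF u[unfolded tangent_plane_def] t(2,3,1) tv[unfolded Fs]]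
    unfolding su3_mean_curvature_def G .
qed

text \<open>The explicit formula presupposes a frame adapted to the plane. Arguing from the first
  variation instead avoids having to construct one.\<close>

lemma sl_minimal_class_torsion_free: "sl_minimal_class TYPE('a) TYPE('b) {X0p, X0m, X3, X4}"
  unfolding sl_minimal_class_def minimal_def
proof (intro allI impI ballI)
  fix M :: "'a topology" and A \<Omega> \<Upsilon> \<theta> and N :: "'b topology" and B f d c p
  assume M: "smooth_manifold M A" and su3: "su3_structure A \<Omega> \<Upsilon>" and cl: "in_torsion_class {X0p, X0m, X3, X4} A \<Omega> \<Upsilon>"
    and sl: "special_lagrangian M A \<Omega> \<Upsilon> \<theta> N B f" and d: "d \<in> B" and c: "c \<in> A" and p: "p \<in> fst d" "f p \<in> fst c"
  from cl obtain \<tau>0 \<tau>0h \<tau>2 \<tau>2h \<tau>3 \<tau>4 \<tau>5 where tor: "torsion_forms A \<Omega> \<Upsilon> \<tau>0 \<tau>0h \<tau>2 \<tau>2h \<tau>3 \<tau>4 \<tau>5"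
    and van: "form_vanishes A \<tau>2" "form_vanishes A \<tau>2h" "form_vanishes A \<tau>5"
    unfolding in_torsion_class_def by auto
  interpret sl_patch "chart_img c" "coord_dom d f c" "coord_rep d f c" "\<Omega> c" "\<Upsilon> c" \<theta>
    by (rule sl_patch_chart[OF M su3 sl d c])
  have s: "snd d p \<in> coord_dom d f c" by (rule coord_dom_mem[where f = f, OF p])
  have y: "coord_rep d f c (snd d p) \<in> chart_img c" by (rule FU[OF s])
  have G: "G = (\<lambda>y. su3_metric (\<Omega> c y) (\<Upsilon> c y))" by (simp add: fun_eq_iff G_def)
  note t = torsion_formsD[OF tor c y]
  have z: "\<tau>2 c (coord_rep d f c (snd d p)) = (\<lambda>vs. 0)" "\<tau>2h c (coord_rep d f c (snd d p)) = (\<lambda>vs. 0)" "\<tau>5 c (coord_rep d f c (snd d p)) = (\<lambda>vs. 0)"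
    using van c y unfolding form_vanishes_def by auto
  have "ext_deriv \<phi> (coord_rep d f c (snd d p)) [w, P 1 (snd d p), P 2 (snd d p), P 3 (snd d p)] = 0" for w
    unfolding ext_deriv_\<phi>_torsion[OF s t(4,5)] z
    by (simp add: torsion_value_def wedge_def pullback_def)
  from minimal_of_torsion_free[OF s this]
  show "su3_mean_curvature \<Omega> \<Upsilon> d f c p = 0"
    unfolding su3_mean_curvature_def G .
qed

section \<open>Diagonal exponential structures\<close>

lemma wedge_add_left: "((\<lambda>l. \<alpha> l + \<beta> l) \<and>\<^sub>w \<gamma>) = (\<lambda>l. (\<alpha> \<and>\<^sub>w \<gamma>) l + (\<beta> \<and>\<^sub>w \<gamma>) l)"
  by (simp add: fun_eq_iff wedge_def algebra_simps sum.distrib)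

lemma wedge_add_right: "(\<gamma> \<and>\<^sub>w (\<lambda>l. \<alpha> l + \<beta> l)) = (\<lambda>l. (\<gamma> \<and>\<^sub>w \<alpha>) l + (\<gamma> \<and>\<^sub>w \<beta>) l)"
  by (simp add: fun_eq_iff wedge_def algebra_simps sum.distrib)

lemma wedge_scale_left: "((\<lambda>l. c * \<alpha> l) \<and>\<^sub>w \<gamma>) = (\<lambda>l. c * (\<alpha> \<and>\<^sub>w \<gamma>) l)"
  by (simp add: fun_eq_iff wedge_def sum_distrib_left mult_ac)

lemma wedge_scale_right: "(\<gamma> \<and>\<^sub>w (\<lambda>l. c * \<alpha> l)) = (\<lambda>l. c * (\<gamma> \<and>\<^sub>w \<alpha>) l)"
  by (simp add: fun_eq_iff wedge_def sum_distrib_left mult_ac)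

lemma wedge_minus_left: "((\<lambda>l. - \<alpha> l) \<and>\<^sub>w \<gamma>) = (\<lambda>l. - (\<alpha> \<and>\<^sub>w \<gamma>) l)"
  by (simp add: fun_eq_iff wedge_def sum_negf)

lemma wedge_minus_right: "(\<gamma> \<and>\<^sub>w (\<lambda>l. - \<alpha> l)) = (\<lambda>l. - (\<gamma> \<and>\<^sub>w \<alpha>) l)"
  by (simp add: fun_eq_iff wedge_def sum_negf)

lemma wedge_diff_left: "((\<lambda>l. \<alpha> l - \<beta> l) \<and>\<^sub>w \<gamma>) = (\<lambda>l. (\<alpha> \<and>\<^sub>w \<gamma>) l - (\<beta> \<and>\<^sub>w \<gamma>) l)"
  by (simp add: fun_eq_iff wedge_def algebra_simps sum_subtractf)

lemma wedge_diff_right: "(\<gamma> \<and>\<^sub>w (\<lambda>l. \<alpha> l - \<beta> l)) = (\<lambda>l. (\<gamma> \<and>\<^sub>w \<alpha>) l - (\<gamma> \<and>\<^sub>w \<beta>) l)"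
  by (simp add: fun_eq_iff wedge_def algebra_simps sum_subtractf)

lemma wedge_zero: "((\<lambda>l. 0) \<and>\<^sub>w \<gamma>) = (\<lambda>l. 0)" "(\<gamma> \<and>\<^sub>w (\<lambda>l. 0)) = (\<lambda>l. 0)"
  by (simp_all add: fun_eq_iff wedge_def)

lemmas wedge_linear = wedge_add_left wedge_add_right wedge_scale_left wedge_scale_right wedge_minus_left
  wedge_minus_right wedge_diff_left wedge_diff_right wedge_zero

text \<open>The grading involution is multiplicative. It absorbs the sign that
  \<open>wedge_Cons\<close> produces when the first factor is itself a product.\<close>

lemma wedge_sign:
  "(-1) ^ length vs * (\<alpha> \<and>\<^sub>w \<beta>) vs = ((\<lambda>l. (-1) ^ length l * \<alpha> l) \<and>\<^sub>w (\<lambda>l. (-1) ^ length l * \<beta> l)) vs"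
proof (induction vs arbitrary: \<alpha> \<beta>)
  case Nil
  then show ?case by (simp add: wedge_Nil)
next
  case (Cons v vs)
  show ?case
    using Cons.IH[of "\<lambda>l. \<alpha> (v # l)" \<beta>] Cons.IH[of "\<lambda>l. (-1) ^ length l * \<alpha> l" "\<lambda>l. \<beta> (v # l)"]
    by (simp add: wedge_Cons distrib_left wedge_minus_left wedge_minus_right)
qed

text \<open>Induction over the argument list: by \<open>wedge_Cons\<close> both sides are contracted
  by the same antiderivation rule.\<close>

lemma wedge_assoc: "((\<alpha> \<and>\<^sub>w \<beta>) \<and>\<^sub>w \<gamma>) = (\<alpha> \<and>\<^sub>w \<beta> \<and>\<^sub>w \<gamma>)"
proof
  fix vs
  show "((\<alpha> \<and>\<^sub>w \<beta>) \<and>\<^sub>w \<gamma>) vs = (\<alpha> \<and>\<^sub>w \<beta> \<and>\<^sub>w \<gamma>) vs"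
  proof (induction vs arbitrary: \<alpha> \<beta> \<gamma>)
    case Nil
    then show ?case by (simp add: wedge_Nil mult.assoc)
  next
    case (Cons v vs)
    show ?case
      unfolding wedge_Cons wedge_sign by (simp only: wedge_add_left wedge_add_right Cons.IH add.assoc)
  qed
qed

lemma covec_swap2: "(covec a \<and>\<^sub>w covec b) = (\<lambda>l. - (covec b \<and>\<^sub>w covec a) l)"
proof
  fix l
  show "(covec a \<and>\<^sub>w covec b) l = - (covec b \<and>\<^sub>w covec a) l"
  proof (cases "length l = 2")
    case True
    then show ?thesis by (auto simp: length_2_conv wedge_expand)
  next
    case False
    then show ?thesis by (simp add: wedge_eq_0_length[OF covec_length covec_length])
  qed
qed

lemma covec_nil2: "(covec a \<and>\<^sub>w covec a) = (\<lambda>l. 0)"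
  using covec_swap2[of a a] by (auto simp: fun_eq_iff)

lemma covec_swap: "(covec a \<and>\<^sub>w covec b \<and>\<^sub>w \<omega>) = (\<lambda>l. - (covec b \<and>\<^sub>w covec a \<and>\<^sub>w \<omega>) l)"
  by (simp only: wedge_assoc[symmetric] covec_swap2[of a b] wedge_minus_left)

lemma covec_nil: "(covec a \<and>\<^sub>w covec a \<and>\<^sub>w \<omega>) = (\<lambda>l. 0)"
  by (simp only: wedge_assoc[symmetric] covec_nil2 wedge_zero)

text \<open>As a rewrite rule \<open>covec_swap\<close> loops, so only its instances that sort the indices are used.\<close>

lemmas covec_sort = covec_nil covec_nil2
  covec_swap[of 2 1] covec_swap[of 3 1] covec_swap[of 4 1] covec_swap[of 5 1] covec_swap[of 6 1]
  covec_swap[of 3 2] covec_swap[of 4 2] covec_swap[of 5 2] covec_swap[of 6 2]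
  covec_swap[of 4 3] covec_swap[of 5 3] covec_swap[of 6 3]
  covec_swap[of 5 4] covec_swap[of 6 4] covec_swap[of 6 5]
  covec_swap2[of 2 1] covec_swap2[of 3 1] covec_swap2[of 4 1] covec_swap2[of 5 1] covec_swap2[of 6 1]
  covec_swap2[of 3 2] covec_swap2[of 4 2] covec_swap2[of 5 2] covec_swap2[of 6 2]
  covec_swap2[of 4 3] covec_swap2[of 5 3] covec_swap2[of 6 3]
  covec_swap2[of 5 4] covec_swap2[of 6 4] covec_swap2[of 6 5]

lemmas exterior = wedge_assoc wedge_linear covec_sort

lemma Re_Upsilon0: "Re_form Upsilon0 = (\<lambda>l. (covec 1 \<and>\<^sub>w covec 2 \<and>\<^sub>w covec 3) l - (covec 1 \<and>\<^sub>w covec 5 \<and>\<^sub>w covec 6) l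
    + (covec 2 \<and>\<^sub>w covec 4 \<and>\<^sub>w covec 6) l - (covec 3 \<and>\<^sub>w covec 4 \<and>\<^sub>w covec 5) l)"
  and Im_Upsilon0: "Im_form Upsilon0 = (\<lambda>l. (covec 2 \<and>\<^sub>w covec 3 \<and>\<^sub>w covec 4) l - (covec 1 \<and>\<^sub>w covec 3 \<and>\<^sub>w covec 5) l
    + (covec 1 \<and>\<^sub>w covec 2 \<and>\<^sub>w covec 6) l - (covec 4 \<and>\<^sub>w covec 5 \<and>\<^sub>w covec 6) l)"
proof -
  have z: "(covec i \<and>\<^sub>w covec j \<and>\<^sub>w covec k) l = 0" if "length l \<noteq> 3" for i j k and l :: "(real^6) list"
    by (rule wedge_eq_0_length[of 1 _ 2]; (rule wedge_eq_0_length[of 1 _ 1])?)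
       (use that in \<open>auto simp: covec_def\<close>)
  have "Re_form Upsilon0 l = (covec 1 \<and>\<^sub>w covec 2 \<and>\<^sub>w covec 3) l - (covec 1 \<and>\<^sub>w covec 5 \<and>\<^sub>w covec 6) l
    + (covec 2 \<and>\<^sub>w covec 4 \<and>\<^sub>w covec 6) l - (covec 3 \<and>\<^sub>w covec 4 \<and>\<^sub>w covec 5) l \<and>
    Im_form Upsilon0 l = (covec 2 \<and>\<^sub>w covec 3 \<and>\<^sub>w covec 4) l - (covec 1 \<and>\<^sub>w covec 3 \<and>\<^sub>w covec 5) l
    + (covec 1 \<and>\<^sub>w covec 2 \<and>\<^sub>w covec 6) l - (covec 4 \<and>\<^sub>w covec 5 \<and>\<^sub>w covec 6) l" for l
  proof (cases "length l = 3")
    case True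
    then obtain a b c where l: "l = [a, b, c]" by (auto simp: length_3_conv)
    show ?thesis unfolding l Re_form_def Im_form_def Upsilon0_eq zco_def
      by (simp add: wedge_expand algebra_simps)
  next
    case False
    then show ?thesis by (simp add: z Re_form_def Im_form_def Upsilon0_length)
  qed
  then show "Re_form Upsilon0 = (\<lambda>l. (covec 1 \<and>\<^sub>w covec 2 \<and>\<^sub>w covec 3) l - (covec 1 \<and>\<^sub>w covec 5 \<and>\<^sub>w covec 6) l
    + (covec 2 \<and>\<^sub>w covec 4 \<and>\<^sub>w covec 6) l - (covec 3 \<and>\<^sub>w covec 4 \<and>\<^sub>w covec 5) l)"
    "Im_form Upsilon0 = (\<lambda>l. (covec 2 \<and>\<^sub>w covec 3 \<and>\<^sub>w covec 4) l - (covec 1 \<and>\<^sub>w covec 3 \<and>\<^sub>w covec 5) l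
    + (covec 1 \<and>\<^sub>w covec 2 \<and>\<^sub>w covec 6) l - (covec 4 \<and>\<^sub>w covec 5 \<and>\<^sub>w covec 6) l)"
    by auto
qed

lemma wedge_pullback: "(pullback u \<alpha> \<and>\<^sub>w pullback u \<beta>) = pullback u (\<alpha> \<and>\<^sub>w \<beta>)"
  by (simp add: fun_eq_iff wedge_def pullback_def nths_map)

text \<open>The alternating sum is the one in \<open>ext_deriv\<close>, so that d (h \<omega>) = dh
  \<and> \<omega> for a function h and a constant form \<omega>.\<close>

lemma covec_wedge:
  "(covec m \<and>\<^sub>w \<omega>) vs = (\<Sum>i<length vs. (-1) ^ i * (vs ! i $ m) * \<omega> (take i vs @ drop (Suc i) vs))"
proof (induction vs arbitrary: \<omega>)
  case Nil
  then show ?case by (simp add: wedge_Nil)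
next
  case (Cons v vs)
  have 1: "((\<lambda>l. covec m (v # l)) \<and>\<^sub>w \<omega>) vs = v $ m * \<omega> vs"
  proof -
    have "(\<lambda>l. covec m (v # l)) = (\<lambda>l. v $ m * (if l = [] then 1 else 0))"
      by (auto simp: fun_eq_iff covec_def)
    \<comment> \<open>The constant 0-form 1 is a unit for the exterior product; contracting a
      covector leaves a multiple of it.\<close>
    moreover have "((\<lambda>l. if l = [] then 1 else 0) \<and>\<^sub>w \<omega>) vs = \<omega> vs" for \<omega> :: "(real^6, real) form" and vs
    proof (induction vs arbitrary: \<omega>)
      case (Cons x xs)
      have "(\<lambda>l. (-1) ^ length l * (if l = [] then 1 else 0)) = (\<lambda>l :: (real^6) list. if l = [] then 1 else (0::real))"
        by auto
      then show ?case using Cons.IH[of "\<lambda>l. \<omega> (x # l)"] by (simp add: wedge_Cons wedge_zero)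
    qed (simp add: wedge_Nil)
    ultimately show ?thesis by (simp add: wedge_scale_left)
  qed
  have 2: "(\<lambda>l. (-1) ^ length l * covec m l) = (\<lambda>l. - covec m l)"
    by (auto simp: fun_eq_iff covec_def)
  have "(covec m \<and>\<^sub>w \<omega>) (v # vs) = v $ m * \<omega> vs - (covec m \<and>\<^sub>w (\<lambda>l. \<omega> (v # l))) vs"
    unfolding wedge_Cons 1 2 wedge_minus_left by simp
  also have "\<dots> = (\<Sum>i<length (v # vs). (-1) ^ i * ((v # vs) ! i $ m) * \<omega> (take i (v # vs) @ drop (Suc i) (v # vs)))"
    unfolding Cons.IH length_Cons sum.lessThan_Suc_shift by (simp add: sum_negf)
  finally show ?case .
qed

lemma ext_deriv_exp:
  "ext_deriv (\<lambda>z l. exp (a * z $ m) * \<omega> l) y = (\<lambda>l. a * exp (a * y $ m) * (covec m \<and>\<^sub>w \<omega>) l)"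
proof
  fix l
  have "((\<lambda>z :: real^6. exp (a * z $ m) * k) has_derivative (\<lambda>h. a * exp (a * y $ m) * (h $ m) * k)) (at y)" for k
    by (auto intro!: derivative_eq_intros bounded_linear.has_derivative[OF bounded_linear_vec_nth] simp: fun_eq_iff)
  note D = frechet_derivative_at[OF this, symmetric]
  show "ext_deriv (\<lambda>z l. exp (a * z $ m) * \<omega> l) y l = a * exp (a * y $ m) * (covec m \<and>\<^sub>w \<omega>) l"
    unfolding ext_deriv_def covec_wedge D by (simp add: sum_distrib_left mult_ac)
qed

lemma ext_deriv_add:
  assumes "\<And>l. (\<lambda>z. \<alpha> z l) differentiable (at y)" "\<And>l. (\<lambda>z. \<beta> z l) differentiable (at y)"
  shows "ext_deriv (\<lambda>z l. \<alpha> z l + \<beta> z l) y = (\<lambda>l. ext_deriv \<alpha> y l + ext_deriv \<beta> y l)"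
proof
  fix l
  have "frechet_derivative (\<lambda>z. \<alpha> z l + \<beta> z l) (at y) = (\<lambda>h. frechet_derivative (\<lambda>z. \<alpha> z l) (at y) h + frechet_derivative (\<lambda>z. \<beta> z l) (at y) h)" for l
    by (rule frechet_derivative_at[symmetric]) (intro has_derivative_add assms[THEN frechet_derivative_works[THEN iffD1]])
  then show "ext_deriv (\<lambda>z l. \<alpha> z l + \<beta> z l) y l = ext_deriv \<alpha> y l + ext_deriv \<beta> y l"
    unfolding ext_deriv_def by (simp add: sum.distrib distrib_left)
qed

text \<open>The form - \<Gamma>_1 of the model, a primitive (1,1)-form that serves as the nonzero
  torsion in the examples.\<close>

definition B0 :: "(real^6, real) form" where
  "B0 = (\<lambda>l. (covec 2 \<and>\<^sub>w covec 3) l + (covec 5 \<and>\<^sub>w covec 6) l)"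

lemma Omega0_fun: "Omega0 = (\<lambda>l. (covec 1 \<and>\<^sub>w covec 4) l + (covec 2 \<and>\<^sub>w covec 5) l + (covec 3 \<and>\<^sub>w covec 6) l)"
  by (simp add: fun_eq_iff Omega0_def)

lemma B0_Lambda28: "(B0 \<and>\<^sub>w Re_form Upsilon0) = (\<lambda>l. 0)" "(B0 \<and>\<^sub>w Omega0 \<and>\<^sub>w Omega0) = (\<lambda>l. 0)"
  unfolding B0_def Re_Upsilon0 Omega0_fun by (simp_all add: exterior)

section \<open>Calculus of smooth functions on a whole vector space\<close>

lemma Ck_on_Suc_imp: "Ck_on (Suc k) S f \<Longrightarrow> Ck_on k S f"
proof (induction k arbitrary: f)
  case 0
  then show ?case
    by (auto intro!: continuous_at_imp_continuous_on differentiable_imp_continuous_within)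
next
  case (Suc k)
  then show ?case using Ck_on.simps(2) by blast
qed

lemma frechet_derivative_eqI: "(\<And>x. (f has_derivative D x) (at x)) \<Longrightarrow> (\<lambda>x. frechet_derivative f (at x) v) = (\<lambda>x. D x v)"
  by (metis frechet_derivative_at)

text \<open>On the whole space any explicit derivative may stand for
  \<open>frechet_derivative\<close>, so the inductions over k can use the usual differentiation
  rules.\<close>

lemma Ck_on_SucI:
  assumes "\<And>x. (f has_derivative D x) (at x)" "\<And>v. Ck_on k UNIV (\<lambda>x. D x v)"
  shows "Ck_on (Suc k) UNIV f"
  using assms(2) unfolding Ck_on.simps frechet_derivative_eqI[OF assms(1)]
  using assms(1) by (auto simp: differentiable_def)

lemma Ck_on_SucE:
  assumes "Ck_on (Suc k) UNIV f"
  obtains D where "\<And>x. (f has_derivative D x) (at x)" "\<And>v. Ck_on k UNIV (\<lambda>x. D x v)"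
  using assms that[of "\<lambda>x. frechet_derivative f (at x)"] by (auto simp: frechet_derivative_works)

lemma Ck_on_const: "Ck_on k UNIV (\<lambda>x. c)"
proof (induction k arbitrary: c)
  case (Suc k)
  show ?case by (rule Ck_on_SucI[of _ "\<lambda>x h. 0"]) (auto intro: Suc)
qed auto

lemma Ck_on_add: "Ck_on k UNIV f \<Longrightarrow> Ck_on k UNIV g \<Longrightarrow> Ck_on k UNIV (\<lambda>x. f x + g x)"
proof (induction k arbitrary: f g)
  case (Suc k)
  from Suc.prems obtain D E where "\<And>x. (f has_derivative D x) (at x)" "\<And>v. Ck_on k UNIV (\<lambda>x. D x v)"
    "\<And>x. (g has_derivative E x) (at x)" "\<And>v. Ck_on k UNIV (\<lambda>x. E x v)"
    by (metis Ck_on_SucE)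
  then show ?case
    by (intro Ck_on_SucI[of _ "\<lambda>x h. D x h + E x h"] has_derivative_add Suc.IH) auto
qed (auto intro: continuous_on_add)

lemma Ck_on_mult:
  fixes f g :: "'x::real_normed_vector \<Rightarrow> 'y::real_normed_algebra"
  shows "Ck_on k UNIV f \<Longrightarrow> Ck_on k UNIV g \<Longrightarrow> Ck_on k UNIV (\<lambda>x. f x * g x)"
proof (induction k arbitrary: f g)
  case (Suc k)
  from Suc.prems obtain D E where "\<And>x. (f has_derivative D x) (at x)" "\<And>v. Ck_on k UNIV (\<lambda>x. D x v)"
    "\<And>x. (g has_derivative E x) (at x)" "\<And>v. Ck_on k UNIV (\<lambda>x. E x v)"
    by (metis Ck_on_SucE)
  then show ?case using Suc.prems[THEN Ck_on_Suc_imp]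
    by (intro Ck_on_SucI[of _ "\<lambda>x h. f x * E x h + D x h * g x"] has_derivative_mult Ck_on_add Suc.IH) auto
qed (auto intro: continuous_on_mult)

lemma Ck_on_bounded_linear: "bounded_linear L \<Longrightarrow> Ck_on k UNIV f \<Longrightarrow> Ck_on k UNIV (\<lambda>x. L (f x))"
proof (induction k arbitrary: f)
  case 0
  then show ?case by (auto intro: bounded_linear.continuous_on)
next
  case (Suc k)
  from Suc.prems(2) obtain D where "\<And>x. (f has_derivative D x) (at x)" "\<And>v. Ck_on k UNIV (\<lambda>x. D x v)"
    by (metis Ck_on_SucE)
  note D = this
  show ?case
  proof (rule Ck_on_SucI[of _ "\<lambda>x h. L (D x h)"])
    show "((\<lambda>x. L (f x)) has_derivative (\<lambda>h. L (D x h))) (at x)" for x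
      by (rule bounded_linear.has_derivative[OF Suc.prems(1) D(1)])
    show "Ck_on k UNIV (\<lambda>x. L (D x v))" for v
      by (rule Suc.IH[OF Suc.prems(1) D(2)])
  qed
qed

lemma Ck_on_id: "Ck_on k UNIV (\<lambda>x. x)"
proof (cases k)
  case (Suc n)
  then show ?thesis by (auto intro!: Ck_on_SucI[of _ "\<lambda>x h. h"] Ck_on_const)
qed auto

lemma Ck_on_exp: "Ck_on k UNIV f \<Longrightarrow> Ck_on k UNIV (\<lambda>x. exp (f x :: real))"
proof (induction k arbitrary: f)
  case 0
  then show ?case by (auto intro: continuous_on_exp)
next
  case (Suc k)
  from Suc.prems obtain D where "\<And>x. (f has_derivative D x) (at x)" "\<And>v. Ck_on k UNIV (\<lambda>x. D x v)"
    by (metis Ck_on_SucE)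
  then show ?case using Suc.prems[THEN Ck_on_Suc_imp]
    by (intro Ck_on_SucI[of _ "\<lambda>x h. exp (f x) * D x h"] Ck_on_mult Suc.IH)
       (auto intro!: derivative_eq_intros)
qed

lemma smooth_const: "smooth_on UNIV (\<lambda>x. c)"
  and smooth_id: "smooth_on UNIV (\<lambda>x. x)"
  and smooth_add: "smooth_on UNIV f \<Longrightarrow> smooth_on UNIV g \<Longrightarrow> smooth_on UNIV (\<lambda>x. f x + g x)"
  and smooth_bounded_linear: "bounded_linear L \<Longrightarrow> smooth_on UNIV f \<Longrightarrow> smooth_on UNIV (\<lambda>x. L (f x))"
  and smooth_exp: "smooth_on UNIV r \<Longrightarrow> smooth_on UNIV (\<lambda>x. exp (r x :: real))"
  unfolding smooth_on_def
  by (auto intro: Ck_on_const Ck_on_id Ck_on_add Ck_on_bounded_linear Ck_on_exp)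

lemma smooth_mult:
  fixes f g :: "'x::real_normed_vector \<Rightarrow> 'y::real_normed_algebra"
  shows "smooth_on UNIV f \<Longrightarrow> smooth_on UNIV g \<Longrightarrow> smooth_on UNIV (\<lambda>x. f x * g x)"
  unfolding smooth_on_def by (auto intro: Ck_on_mult)

lemma smooth_exp_nth: "smooth_on UNIV (\<lambda>x :: real^'n. exp (a * x $ m) * k)"
  by (intro smooth_mult smooth_exp smooth_const smooth_bounded_linear[OF bounded_linear_vec_nth] smooth_id)

section \<open>Coordinate spaces as manifolds with a single chart\<close>

definition std_chart :: "(real^'n, 'n::finite) chart" where "std_chart = (UNIV, id)"

lemma std_chart_simps: "fst std_chart = UNIV" "snd std_chart = id" "chart_img std_chart = UNIV"
  "coord_dom std_chart f std_chart = UNIV" "coord_rep std_chart f std_chart = f"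
  by (auto simp: std_chart_def chart_img_def coord_dom_def coord_rep_def)

lemma second_countable_euclidean: "second_countable (euclidean :: 'x::second_countable_topology topology)"
proof -
  obtain B :: "'x set set" where "countable B" "topological_basis B"
    using ex_countable_basis by blast
  then show ?thesis
    unfolding second_countable_def
  proof (intro exI[of _ B] conjI ballI allI impI)
    show "openin euclidean V" if "V \<in> B" for V
      using topological_basis_open[OF \<open>topological_basis B\<close> that] by simp
    fix U x assume "openin (euclidean :: 'x topology) U \<and> x \<in> U"
    then obtain V where "V \<in> B" "x \<in> V" "V \<subseteq> U"
      using topological_basisE[OF \<open>topological_basis B\<close>, of U x] by auto
    then show "\<exists>V\<in>B. x \<in> V \<and> V \<subseteq> U" by blast
  qed
qed

lemma smooth_manifold_std: "smooth_manifold (euclidean :: (real^'n::finite) topology) {std_chart}"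
  unfolding smooth_manifold_def
  by (auto simp: std_chart_simps Hausdorff_space_euclidean second_countable_euclidean smooth_id[folded id_def] homeomorphic_map_id)

text \<open>Pulling back the model along this map replaces dx_i by exp (w i * x_m) dx_i; it is
  therefore an adapted isomorphism by construction.\<close>

definition scl :: "(6 \<Rightarrow> real) \<Rightarrow> 6 \<Rightarrow> real^6 \<Rightarrow> real^6 \<Rightarrow> real^6" where
  "scl w m x v = (\<chi> i. exp (w i * x $ m) * v $ i)"

lemma scl_nth [simp]: "scl w m x v $ i = exp (w i * x $ m) * v $ i"
  by (simp add: scl_def)

lemma linear_scl: "linear (scl w m x)"
  by (rule linearI) (simp_all add: vec_eq_iff algebra_simps)

lemma bij_scl: "bij (scl w m x)"
  by (rule bij_betw_byWitness[where f' = "\<lambda>v. \<chi> i. exp (- w i * x $ m) * v $ i"])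
     (auto simp: vec_eq_iff mult.assoc[symmetric] exp_add[symmetric])

definition exp_Omega where "exp_Omega w m y = pullback (scl w m y) Omega0"
definition exp_Upsilon where "exp_Upsilon w m y = pullback (scl w m y) Upsilon0"

lemma adapted_exp: "adapted (exp_Omega w m y) (exp_Upsilon w m y) (scl w m y)"
  by (simp add: adapted_def linear_scl bij_scl exp_Omega_def exp_Upsilon_def)

lemma pullback_covec: "pullback (scl w m y) (covec i) = (\<lambda>l. exp (w i * y $ m) * covec i l)"
  by (rule ext) (auto simp: pullback_def covec_def length_Suc_conv)

text \<open>Weights add under the product. The hypothesis on \<omega> has the form of the
  conclusion, so the rule composes with itself for any number of factors.\<close>

lemma pullback_covec_wedge:
  assumes "pullback (scl w m y) \<omega> = (\<lambda>l. exp (a * y $ m) * \<omega> l)"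
  shows "pullback (scl w m y) (covec i \<and>\<^sub>w \<omega>) = (\<lambda>l. exp ((w i + a) * y $ m) * (covec i \<and>\<^sub>w \<omega>) l)"
  unfolding wedge_pullback[symmetric] pullback_covec assms wedge_scale_left wedge_scale_right
  by (simp add: fun_eq_iff exp_add distrib_right)

lemmas pullback_covec2 = pullback_covec_wedge[OF pullback_covec]
lemmas pullback_covec3 = pullback_covec_wedge[OF pullback_covec2]
lemmas pullback_covec4 = pullback_covec_wedge[OF pullback_covec3]

lemma pullback_add: "pullback u (\<lambda>l. \<alpha> l + \<beta> l) = (\<lambda>l. pullback u \<alpha> l + pullback u \<beta> l)"
  and pullback_diff: "pullback u (\<lambda>l. \<alpha> l - \<gamma> l) = (\<lambda>l. pullback u \<alpha> l - pullback u \<gamma> l)" for \<alpha> \<beta> \<gamma> :: "('v, real) form"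
  by (simp_all add: pullback_def fun_eq_iff)

lemma exp_Omega_eq: "exp_Omega w m y = (\<lambda>l. exp ((w 1 + w 4) * y $ m) * (covec 1 \<and>\<^sub>w covec 4) l
    + exp ((w 2 + w 5) * y $ m) * (covec 2 \<and>\<^sub>w covec 5) l + exp ((w 3 + w 6) * y $ m) * (covec 3 \<and>\<^sub>w covec 6) l)"
  unfolding exp_Omega_def Omega0_fun pullback_add pullback_covec2 ..

lemma Re_exp_Upsilon: "Re_form (exp_Upsilon w m y) = pullback (scl w m y) (Re_form Upsilon0)"
  and Im_exp_Upsilon: "Im_form (exp_Upsilon w m y) = pullback (scl w m y) (Im_form Upsilon0)"
  by (simp_all add: fun_eq_iff exp_Upsilon_def pullback_def Re_form_def Im_form_def)

lemma Re_exp_Upsilon_eq: "Re_form (exp_Upsilon w m y) =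
    (\<lambda>l. exp ((w 1 + (w 2 + w 3)) * y $ m) * (covec 1 \<and>\<^sub>w covec 2 \<and>\<^sub>w covec 3) l
      + exp ((w 1 + (w 5 + w 6)) * y $ m) * - (covec 1 \<and>\<^sub>w covec 5 \<and>\<^sub>w covec 6) l
      + exp ((w 2 + (w 4 + w 6)) * y $ m) * (covec 2 \<and>\<^sub>w covec 4 \<and>\<^sub>w covec 6) l
      + exp ((w 3 + (w 4 + w 5)) * y $ m) * - (covec 3 \<and>\<^sub>w covec 4 \<and>\<^sub>w covec 5) l)"
  unfolding Re_exp_Upsilon Re_Upsilon0 pullback_add pullback_diff pullback_covec3 by simp

lemma Im_exp_Upsilon_eq: "Im_form (exp_Upsilon w m y) =
    (\<lambda>l. exp ((w 2 + (w 3 + w 4)) * y $ m) * (covec 2 \<and>\<^sub>w covec 3 \<and>\<^sub>w covec 4) l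
      + exp ((w 1 + (w 3 + w 5)) * y $ m) * - (covec 1 \<and>\<^sub>w covec 3 \<and>\<^sub>w covec 5) l
      + exp ((w 1 + (w 2 + w 6)) * y $ m) * (covec 1 \<and>\<^sub>w covec 2 \<and>\<^sub>w covec 6) l
      + exp ((w 4 + (w 5 + w 6)) * y $ m) * - (covec 4 \<and>\<^sub>w covec 5 \<and>\<^sub>w covec 6) l)"
  unfolding Im_exp_Upsilon Im_Upsilon0 pullback_add pullback_diff pullback_covec3 by simp

lemma exp_nth_differentiable: "(\<lambda>z :: real^6. exp (a * z $ m) * k) differentiable (at y)"
  by (rule smooth_on_differentiable[OF smooth_exp_nth UNIV_I])

lemma ext_deriv_exp_Omega: "ext_deriv (exp_Omega w m) y = (\<lambda>l.
    (w 1 + w 4) * exp ((w 1 + w 4) * y $ m) * (covec m \<and>\<^sub>w covec 1 \<and>\<^sub>w covec 4) l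
    + (w 2 + w 5) * exp ((w 2 + w 5) * y $ m) * (covec m \<and>\<^sub>w covec 2 \<and>\<^sub>w covec 5) l
    + (w 3 + w 6) * exp ((w 3 + w 6) * y $ m) * (covec m \<and>\<^sub>w covec 3 \<and>\<^sub>w covec 6) l)"
  unfolding exp_Omega_eq[abs_def]
  by (subst ext_deriv_add ext_deriv_exp; (intro differentiable_add exp_nth_differentiable)?)+ simp

lemma ext_deriv_Re_exp_Upsilon: "ext_deriv (\<lambda>y. Re_form (exp_Upsilon w m y)) y =
    (\<lambda>l. (w 1 + (w 2 + w 3)) * exp ((w 1 + (w 2 + w 3)) * y $ m) * (covec m \<and>\<^sub>w covec 1 \<and>\<^sub>w covec 2 \<and>\<^sub>w covec 3) l
      + (w 1 + (w 5 + w 6)) * exp ((w 1 + (w 5 + w 6)) * y $ m) * - (covec m \<and>\<^sub>w covec 1 \<and>\<^sub>w covec 5 \<and>\<^sub>w covec 6) l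
      + (w 2 + (w 4 + w 6)) * exp ((w 2 + (w 4 + w 6)) * y $ m) * (covec m \<and>\<^sub>w covec 2 \<and>\<^sub>w covec 4 \<and>\<^sub>w covec 6) l
      + (w 3 + (w 4 + w 5)) * exp ((w 3 + (w 4 + w 5)) * y $ m) * - (covec m \<and>\<^sub>w covec 3 \<and>\<^sub>w covec 4 \<and>\<^sub>w covec 5) l)"
  unfolding Re_exp_Upsilon_eq wedge_minus_right[symmetric]
  by (subst ext_deriv_add ext_deriv_exp; (intro differentiable_add exp_nth_differentiable)?)+ (simp add: wedge_minus_right)

lemma ext_deriv_Im_exp_Upsilon: "ext_deriv (\<lambda>y. Im_form (exp_Upsilon w m y)) y =
    (\<lambda>l. (w 2 + (w 3 + w 4)) * exp ((w 2 + (w 3 + w 4)) * y $ m) * (covec m \<and>\<^sub>w covec 2 \<and>\<^sub>w covec 3 \<and>\<^sub>w covec 4) l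
      + (w 1 + (w 3 + w 5)) * exp ((w 1 + (w 3 + w 5)) * y $ m) * - (covec m \<and>\<^sub>w covec 1 \<and>\<^sub>w covec 3 \<and>\<^sub>w covec 5) l
      + (w 1 + (w 2 + w 6)) * exp ((w 1 + (w 2 + w 6)) * y $ m) * (covec m \<and>\<^sub>w covec 1 \<and>\<^sub>w covec 2 \<and>\<^sub>w covec 6) l
      + (w 4 + (w 5 + w 6)) * exp ((w 4 + (w 5 + w 6)) * y $ m) * - (covec m \<and>\<^sub>w covec 4 \<and>\<^sub>w covec 5 \<and>\<^sub>w covec 6) l)"
  unfolding Im_exp_Upsilon_eq wedge_minus_right[symmetric]
  by (subst ext_deriv_add ext_deriv_exp; (intro differentiable_add exp_nth_differentiable)?)+ (simp add: wedge_minus_right)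


lemma diff_form_std:
  assumes "\<And>y. alt_form k (\<omega> y)" "\<And>vs. smooth_on UNIV (\<lambda>y. \<omega> y vs)"
  shows "diff_form {std_chart} k (\<lambda>c. \<omega>)"
  using assms unfolding diff_form_def
  by (simp add: std_chart_simps pullback_def frechet_derivative_id id_def)

lemma smooth_exp_Omega: "smooth_on UNIV (\<lambda>y. exp_Omega w m y vs)"
  unfolding exp_Omega_eq by (intro smooth_add smooth_exp_nth)

lemma smooth_exp_Upsilon: "smooth_on UNIV (\<lambda>y. exp_Upsilon w m y vs)"
proof -
  have "exp_Upsilon w m y vs = complex_of_real (Re_form (exp_Upsilon w m y) vs) + \<i> * complex_of_real (Im_form (exp_Upsilon w m y) vs)" for y
    by (simp add: Re_form_def Im_form_def complex_eq_iff)
  moreover have "smooth_on UNIV (\<lambda>y. Re_form (exp_Upsilon w m y) vs)" "smooth_on UNIV (\<lambda>y. Im_form (exp_Upsilon w m y) vs)"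
    unfolding Re_exp_Upsilon_eq Im_exp_Upsilon_eq by (intro smooth_add smooth_exp_nth)+
  then have "smooth_on UNIV (\<lambda>y. complex_of_real (Re_form (exp_Upsilon w m y) vs) + \<i> * complex_of_real (Im_form (exp_Upsilon w m y) vs))"
    by (intro smooth_add smooth_mult smooth_const smooth_bounded_linear[OF bounded_linear_of_real])
  ultimately show ?thesis by simp
qed

lemma su3_structure_exp: "su3_structure {std_chart} (\<lambda>c. exp_Omega w m) (\<lambda>c. exp_Upsilon w m)"
  unfolding su3_structure_def
  using adapted_exp adapted_alt_form[OF adapted_exp]
  by (auto intro!: diff_form_std smooth_exp_Omega smooth_exp_Upsilon)

section \<open>Torsion of the weighted structures\<close>

lemma alt_form_zero: "alt_form k (\<lambda>l. 0)"
  by (simp add: alt_form_def linear_zero)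

lemma zero_Lambda28: "(\<lambda>l. 0) \<in> Lambda28 \<Omega> \<Upsilon>" and zero_Lambda312: "(\<lambda>l. 0) \<in> Lambda312 \<Omega> \<Upsilon>"
  by (simp_all add: Lambda28_def Lambda312_def alt_form_zero wedge_zero)

lemma alt_form_covec: "alt_form 1 (covec i)"
  by (rule alt_form_1I) (auto simp: covec_length intro!: linearI)

lemma alt_form_B0: "alt_form 2 B0"
proof (rule alt_form_2I)
  show "length l \<noteq> 2 \<Longrightarrow> B0 l = 0" for l
    unfolding B0_def by (simp add: wedge_eq_0_length[OF covec_length covec_length])
qed (auto simp: B0_def wedge_expand algebra_simps intro!: linearI)

lemma B0_exp_Lambda28: "(\<lambda>l. c * pullback (scl w m y) B0 l) \<in> Lambda28 (exp_Omega w m y) (exp_Upsilon w m y)"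
  unfolding Lambda28_def
proof (intro CollectI conjI allI)
  show "alt_form 2 (\<lambda>l. c * pullback (scl w m y) B0 l)"
    by (intro alt_form_scale alt_form_pullback alt_form_B0 linear_scl)
  show "((\<lambda>l. c * pullback (scl w m y) B0 l) \<and>\<^sub>w Re_form (exp_Upsilon w m y)) vs = 0" for vs
    unfolding Re_exp_Upsilon wedge_scale_left wedge_pullback B0_Lambda28 by (simp add: pullback_def)
  show "((\<lambda>l. c * pullback (scl w m y) B0 l) \<and>\<^sub>w exp_Omega w m y \<and>\<^sub>w exp_Omega w m y) vs = 0" for vs
    unfolding exp_Omega_def wedge_scale_left wedge_pullback B0_Lambda28 by (simp add: pullback_def)
qed

lemma smooth_B0_exp: "smooth_on UNIV (\<lambda>y. c * pullback (scl w m y) B0 vs)"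
  unfolding B0_def pullback_add pullback_covec2
  by (intro smooth_mult[OF smooth_const] smooth_add smooth_exp_nth)

lemma B0_Omega_exp: "(pullback (scl w m y) B0 \<and>\<^sub>w exp_Omega w m y) = (\<lambda>l. exp ((w 1 + (w 2 + (w 3 + w 4))) * y $ m) * (covec 1 \<and>\<^sub>w covec 2 \<and>\<^sub>w covec 3 \<and>\<^sub>w covec 4) l
    + exp ((w 1 + (w 4 + (w 5 + w 6))) * y $ m) * (covec 1 \<and>\<^sub>w covec 4 \<and>\<^sub>w covec 5 \<and>\<^sub>w covec 6) l)"
proof -
  have "(B0 \<and>\<^sub>w Omega0) = (\<lambda>l. (covec 1 \<and>\<^sub>w covec 2 \<and>\<^sub>w covec 3 \<and>\<^sub>w covec 4) l + (covec 1 \<and>\<^sub>w covec 4 \<and>\<^sub>w covec 5 \<and>\<^sub>w covec 6) l)"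
    unfolding B0_def Omega0_fun by (simp add: exterior)
  then show ?thesis
    unfolding exp_Omega_def wedge_pullback by (simp add: pullback_add pullback_covec4)
qed

text \<open>Closedness of \<open>\<Omega>\<close> forces \<open>w 2 + w 5 = 0 = w 3 + w 6\<close>; asking one of \<open>Re \<Upsilon>\<close>, \<open>Im \<Upsilon>\<close> to be closed
  then gives \<open>w 2 = w 3\<close>.  The weights \<open>wB\<close> are those of a conformally rescaled flat factor, where \<open>\<tau>5 = dx\<^sub>4\<close>.\<close>

definition wA :: "6 \<Rightarrow> real" where "wA i = (if i = 2 \<or> i = 3 then 1 else if i = 5 \<or> i = 6 then -1 else 0)"
definition wB :: "6 \<Rightarrow> real" where "wB i = (if i = 1 \<or> i = 4 then 1 else 0)"

lemma ext_deriv_exp_Omega_wA: "ext_deriv (exp_Omega wA m) y = (\<lambda>l. 0)"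
  unfolding ext_deriv_exp_Omega by (simp add: wA_def)

text \<open>In Re \<Upsilon> only the terms dx_123 and dx_156 have nonzero total weight, 2 and -2;
  reordering after multiplication by dx_4 gives -2 \<open>B0\<close> times \<Omega>. The terms of Im
  \<Upsilon> with nonzero weight contain dx_4 already, so it is closed.\<close>

lemma torsion_exp_X2p:
  "torsion_forms {std_chart} (\<lambda>c. exp_Omega wA 4) (\<lambda>c. exp_Upsilon wA 4) (\<lambda>c y l. 0) (\<lambda>c y l. 0)
     (\<lambda>c y l. - 2 * pullback (scl wA 4 y) B0 l) (\<lambda>c y l. 0) (\<lambda>c y l. 0) (\<lambda>c y l. 0) (\<lambda>c y l. 0)"
  unfolding torsion_forms_def
proof (intro conjI ballI allI)
  show "diff_form {std_chart} 2 (\<lambda>c y l. - 2 * pullback (scl wA 4 y) B0 l)"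
    by (intro diff_form_std smooth_B0_exp alt_form_scale alt_form_pullback alt_form_B0 linear_scl)
  fix y vs
  show "ext_deriv (exp_Omega wA 4) y vs = 3 * 0 * Re_form (exp_Upsilon wA 4 y) vs + 3 * 0 * Im_form (exp_Upsilon wA 4 y) vs
     + 0 + ((\<lambda>l. 0) \<and>\<^sub>w exp_Omega wA 4 y) vs"
    by (simp add: ext_deriv_exp_Omega_wA wedge_zero)
  show "ext_deriv (\<lambda>z. Re_form (exp_Upsilon wA 4 z)) y vs = 2 * 0 * (exp_Omega wA 4 y \<and>\<^sub>w exp_Omega wA 4 y) vs
     + ((\<lambda>l. 0) \<and>\<^sub>w Re_form (exp_Upsilon wA 4 y)) vs + ((\<lambda>l. - 2 * pullback (scl wA 4 y) B0 l) \<and>\<^sub>w exp_Omega wA 4 y) vs"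
    unfolding ext_deriv_Re_exp_Upsilon wedge_scale_left B0_Omega_exp by (simp add: exterior wA_def)
  show "ext_deriv (\<lambda>z. Im_form (exp_Upsilon wA 4 z)) y vs = - 2 * 0 * (exp_Omega wA 4 y \<and>\<^sub>w exp_Omega wA 4 y) vs
     + (pullback (su3_J (exp_Omega wA 4 y) (exp_Upsilon wA 4 y)) (\<lambda>l. 0) \<and>\<^sub>w Re_form (exp_Upsilon wA 4 y)) vs + ((\<lambda>l. 0) \<and>\<^sub>w exp_Omega wA 4 y) vs"
    unfolding ext_deriv_Im_exp_Upsilon by (simp add: exterior wA_def pullback_def)
qed (auto intro!: diff_form_std alt_form_zero smooth_const zero_Lambda28 zero_Lambda312 B0_exp_Lambda28 B0_exp_Lambda28[of "-2", simplified])

text \<open>With x_1 in place of x_4, Re and Im exchange roles: now the weighted terms of Re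
  \<Upsilon> contain dx_1, and those of Im \<Upsilon>, dx_234 and dx_456, produce the
  torsion.\<close>

lemma torsion_exp_X2m:
  "torsion_forms {std_chart} (\<lambda>c. exp_Omega wA 1) (\<lambda>c. exp_Upsilon wA 1) (\<lambda>c y l. 0) (\<lambda>c y l. 0)
     (\<lambda>c y l. 0) (\<lambda>c y l. 2 * pullback (scl wA 1 y) B0 l) (\<lambda>c y l. 0) (\<lambda>c y l. 0) (\<lambda>c y l. 0)"
  unfolding torsion_forms_def
proof (intro conjI ballI allI)
  show "diff_form {std_chart} 2 (\<lambda>c y l. 2 * pullback (scl wA 1 y) B0 l)"
    by (intro diff_form_std smooth_B0_exp alt_form_scale alt_form_pullback alt_form_B0 linear_scl)
  fix y vs
  show "ext_deriv (exp_Omega wA 1) y vs = 3 * 0 * Re_form (exp_Upsilon wA 1 y) vs + 3 * 0 * Im_form (exp_Upsilon wA 1 y) vs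
     + 0 + ((\<lambda>l. 0) \<and>\<^sub>w exp_Omega wA 1 y) vs"
    by (simp add: ext_deriv_exp_Omega_wA wedge_zero)
  show "ext_deriv (\<lambda>z. Re_form (exp_Upsilon wA 1 z)) y vs = 2 * 0 * (exp_Omega wA 1 y \<and>\<^sub>w exp_Omega wA 1 y) vs
     + ((\<lambda>l. 0) \<and>\<^sub>w Re_form (exp_Upsilon wA 1 y)) vs + ((\<lambda>l. 0) \<and>\<^sub>w exp_Omega wA 1 y) vs"
    unfolding ext_deriv_Re_exp_Upsilon by (simp add: exterior wA_def)
  show "ext_deriv (\<lambda>z. Im_form (exp_Upsilon wA 1 z)) y vs = - 2 * 0 * (exp_Omega wA 1 y \<and>\<^sub>w exp_Omega wA 1 y) vs
     + (pullback (su3_J (exp_Omega wA 1 y) (exp_Upsilon wA 1 y)) (\<lambda>l. 0) \<and>\<^sub>w Re_form (exp_Upsilon wA 1 y)) vs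
     + ((\<lambda>l. 2 * pullback (scl wA 1 y) B0 l) \<and>\<^sub>w exp_Omega wA 1 y) vs"
    unfolding ext_deriv_Im_exp_Upsilon wedge_scale_left B0_Omega_exp by (simp add: exterior wA_def pullback_def)
qed (auto intro!: diff_form_std alt_form_zero smooth_const zero_Lambda28 zero_Lambda312 B0_exp_Lambda28 B0_exp_Lambda28[of "-2", simplified])

text \<open>The first and fourth coordinates have equal weights, so the rescaling cancels and J acts
  on this plane as in the model.\<close>

lemma pullback_J_exp: "pullback (su3_J (exp_Omega wB 4 y) (exp_Upsilon wB 4 y)) (covec 4) = covec 1"
proof -
  have "su3_J (exp_Omega wB 4 y) (exp_Upsilon wB 4 y) v $ 4 = v $ 1" for v
  proof -
    have "scl wB 4 y (su3_J (exp_Omega wB 4 y) (exp_Upsilon wB 4 y) v) $ 4 = J0 (scl wB 4 y v) $ 4"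
      by (simp only: adapted_J[OF adapted_exp])
    then show ?thesis by (simp add: wB_def)
  qed
  then show ?thesis by (intro ext) (auto simp: pullback_def covec_def length_Suc_conv)
qed

text \<open>Each term of \<Upsilon> contains exactly one of dx_1 and dx_4, so \<Upsilon> is exp
  (x_4) times the model and d\<Upsilon> = dx_4 \<and> \<Upsilon>. As dx_1 + i dx_4 divides
  \<Upsilon>, dx_4 \<and> Im \<Upsilon> = dx_1 \<and> Re \<Upsilon>, which matches dx_1 = dx_4 o J.
  The nonconstant term of \<Omega> contains dx_4, so \<Omega> is closed.\<close>

lemma torsion_exp_X5:
  "torsion_forms {std_chart} (\<lambda>c. exp_Omega wB 4) (\<lambda>c. exp_Upsilon wB 4) (\<lambda>c y l. 0) (\<lambda>c y l. 0)
     (\<lambda>c y l. 0) (\<lambda>c y l. 0) (\<lambda>c y l. 0) (\<lambda>c y l. 0) (\<lambda>c y. covec 4)"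
  unfolding torsion_forms_def pullback_J_exp
proof (intro conjI ballI allI)
  fix y vs
  show "ext_deriv (exp_Omega wB 4) y vs = 3 * 0 * Re_form (exp_Upsilon wB 4 y) vs + 3 * 0 * Im_form (exp_Upsilon wB 4 y) vs
     + 0 + ((\<lambda>l. 0) \<and>\<^sub>w exp_Omega wB 4 y) vs"
    unfolding ext_deriv_exp_Omega by (simp add: exterior wB_def)
  show "ext_deriv (\<lambda>z. Re_form (exp_Upsilon wB 4 z)) y vs = 2 * 0 * (exp_Omega wB 4 y \<and>\<^sub>w exp_Omega wB 4 y) vs
     + (covec 4 \<and>\<^sub>w Re_form (exp_Upsilon wB 4 y)) vs + ((\<lambda>l. 0) \<and>\<^sub>w exp_Omega wB 4 y) vs"
    by (unfold ext_deriv_Re_exp_Upsilon, unfold Re_exp_Upsilon_eq) (simp add: exterior wB_def)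
  show "ext_deriv (\<lambda>z. Im_form (exp_Upsilon wB 4 z)) y vs = - 2 * 0 * (exp_Omega wB 4 y \<and>\<^sub>w exp_Omega wB 4 y) vs
     + (covec 1 \<and>\<^sub>w Re_form (exp_Upsilon wB 4 y)) vs + ((\<lambda>l. 0) \<and>\<^sub>w exp_Omega wB 4 y) vs"
    by (unfold ext_deriv_Im_exp_Upsilon, unfold Re_exp_Upsilon_eq) (simp add: exterior wB_def)
qed (auto intro!: diff_form_std alt_form_zero alt_form_covec[simplified] smooth_const zero_Lambda28 zero_Lambda312)

lemma form_vanishes_zero: "form_vanishes A (\<lambda>c y l. 0)"
  by (simp add: form_vanishes_def)

lemma class_exp_X2p: "X2p \<in> S \<Longrightarrow> in_torsion_class S {std_chart} (\<lambda>c. exp_Omega wA 4) (\<lambda>c. exp_Upsilon wA 4)"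
  unfolding in_torsion_class_def
  by (intro exI conjI impI, rule torsion_exp_X2p) (auto simp: form_vanishes_zero)

lemma class_exp_X2m: "X2m \<in> S \<Longrightarrow> in_torsion_class S {std_chart} (\<lambda>c. exp_Omega wA 1) (\<lambda>c. exp_Upsilon wA 1)"
  unfolding in_torsion_class_def
  by (intro exI conjI impI, rule torsion_exp_X2m) (auto simp: form_vanishes_zero)

lemma class_exp_X5: "X5 \<in> S \<Longrightarrow> in_torsion_class S {std_chart} (\<lambda>c. exp_Omega wB 4) (\<lambda>c. exp_Upsilon wB 4)"
  unfolding in_torsion_class_def
  by (intro exI conjI impI, rule torsion_exp_X5) (auto simp: form_vanishes_zero)

section \<open>Special Lagrangians that are not minimal\<close>

text \<open>A coordinate 3-plane: phase 0 for j = 1 and, since \<open>Upsilon0\<close> takes the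
  value i on (e_4, e_2, e_3), phase pi / 2 for j = 4.\<close>

definition inc :: "6 \<Rightarrow> real^3 \<Rightarrow> real^6" where
  "inc j s = s $ 1 *\<^sub>R axis j 1 + s $ 2 *\<^sub>R axis 2 1 + s $ 3 *\<^sub>R axis 3 1"

lemma linear_inc: "linear (inc j)"
  by (rule linearI) (simp_all add: inc_def algebra_simps)

lemma bounded_linear_inc: "bounded_linear (inc j)"
  using linear_inc by (simp add: linear_conv_bounded_linear)

lemma inc_derivative: "(inc j has_derivative inc j) (at s)"
  by (rule bounded_linear_imp_has_derivative[OF bounded_linear_inc])

lemma frechet_derivative_inc: "frechet_derivative (inc j) (at s) = inc j"
  using frechet_derivative_at[OF inc_derivative] by metis

lemma inj_inc: "j = 1 \<or> j = 4 \<Longrightarrow> inj (inc j)"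
  by (rule injI) (auto simp: inc_def vec6_eq_iff axis_def vec_eq_iff forall_3)

lemma inc_nth: "inc 1 a $ 1 = a $ 1" "inc 1 a $ 2 = a $ 2" "inc 1 a $ 3 = a $ 3" "inc 1 a $ 4 = 0" "inc 1 a $ 5 = 0" "inc 1 a $ 6 = 0"
  "inc 4 a $ 1 = 0" "inc 4 a $ 2 = a $ 2" "inc 4 a $ 3 = a $ 3" "inc 4 a $ 4 = a $ 1" "inc 4 a $ 5 = 0" "inc 4 a $ 6 = 0"
  by (simp_all add: inc_def axis_def)

lemma inc_axis: "inc j (axis 1 1) = axis j 1" "inc j (axis 2 1) = axis 2 1" "inc j (axis 3 1) = axis 3 1"
  by (simp_all add: inc_def axis_def)

lemma sl_plane_inc:
  assumes j: "j = 1 \<and> \<theta> = 0 \<or> j = 4 \<and> \<theta> = pi / 2"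
  shows "sl_plane (exp_Omega w m y) (exp_Upsilon w m y) \<theta> (range (inc j))"
  unfolding sl_plane_def
proof (intro conjI)
  show "subspace (range (inc j))" by (rule linear_subspace_image[OF linear_inc subspace_UNIV])
  have "dim (range (inc j)) = dim (UNIV :: (real^3) set)"
    by (rule dim_image_eq[OF linear_inc]) (use j inj_inc in \<open>auto simp: inj_on_def inj_def\<close>)
  then show "dim (range (inc j)) = 3" by simp
  show "\<forall>v\<in>range (inc j). \<forall>w'\<in>range (inc j). exp_Omega w m y [v, w'] = 0"
    using j by (auto simp: adapted_Omega[OF adapted_exp] Omega0_eq inc_nth)
  show "\<forall>v\<in>range (inc j). \<forall>w'\<in>range (inc j). \<forall>z\<in>range (inc j). Im (cis (- \<theta>) * exp_Upsilon w m y [v, w', z]) = 0"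
    using j by (elim disjE conjE; hypsubst) (auto simp: adapted_Upsilon[OF adapted_exp] Upsilon0_eq zco_def inc_nth)
qed

lemma special_lagrangian_inc:
  assumes j: "j = 1 \<and> \<theta> = 0 \<or> j = 4 \<and> \<theta> = pi / 2"
  shows "special_lagrangian euclidean {std_chart} (\<lambda>c. exp_Omega w m) (\<lambda>c. exp_Upsilon w m) \<theta> euclidean {std_chart} (inc j)"
  unfolding special_lagrangian_def immersion_def smooth_map_def tangent_plane_def
proof (intro conjI ballI impI smooth_manifold_std)
  show "continuous_map euclidean euclidean (inc j)"
    using linear_continuous_on[OF bounded_linear_inc] by simp
next
  fix d :: "(real^3, 3) chart" and c :: "(real^6, 6) chart" assume "d \<in> {std_chart}" "c \<in> {std_chart}"
  then show "smooth_on (coord_dom d (inc j) c) (coord_rep d (inc j) c)"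
    using smooth_bounded_linear[OF bounded_linear_inc smooth_id] by (simp add: std_chart_simps)
next
  fix d :: "(real^3, 3) chart" and c :: "(real^6, 6) chart" and s assume "d \<in> {std_chart}" "c \<in> {std_chart}"
  then show "inj (frechet_derivative (coord_rep d (inc j) c) (at s))"
    using j inj_inc by (auto simp: std_chart_simps frechet_derivative_inc)
next
  fix d :: "(real^3, 3) chart" and c :: "(real^6, 6) chart" and p assume "d \<in> {std_chart}" "c \<in> {std_chart}"
  then show "sl_plane (exp_Omega w m (snd c (inc j p))) (exp_Upsilon w m (snd c (inc j p))) \<theta>
      (range (frechet_derivative (coord_rep d (inc j) c) (at (snd d p))))"
    using sl_plane_inc[OF j] by (auto simp: std_chart_simps frechet_derivative_inc)
qed

text \<open>The indices j and m are 1 and 4 in either order, so the direction in which the coframe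
  varies is normal to the plane. Minimality then makes d\<phi> vanish on it by the variation
  formula, evaluated at the origin, where all exponentials are 1.\<close>

lemma minimal_class_exp:
  assumes S: "sl_minimal_class TYPE(real^6) TYPE(real^3) S"
    and cl: "in_torsion_class S {std_chart} (\<lambda>c. exp_Omega w m) (\<lambda>c. exp_Upsilon w m)"
    and j: "j = 1 \<and> \<theta> = 0 \<and> m = 4 \<or> j = 4 \<and> \<theta> = pi / 2 \<and> m = 1"
  shows "cos \<theta> * ext_deriv (\<lambda>y. Re_form (exp_Upsilon w m y)) 0 [axis m 1, axis j 1, axis 2 1, axis 3 1]
    + sin \<theta> * ext_deriv (\<lambda>y. Im_form (exp_Upsilon w m y)) 0 [axis m 1, axis j 1, axis 2 1, axis 3 1] = 0"
proof -
  let ?\<Omega> = "\<lambda>c :: (real^6, 6) chart. exp_Omega w m" and ?\<Upsilon> = "\<lambda>c :: (real^6, 6) chart. exp_Upsilon w m"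
  have j': "j = 1 \<and> \<theta> = 0 \<or> j = 4 \<and> \<theta> = pi / 2" using j by blast
  have th: "0 \<le> \<theta>" "\<theta> < 2 * pi" using j pi_gt_zero by (elim disjE conjE; hypsubst; simp)+
  note sL = special_lagrangian_inc[OF j']
  have "minimal {std_chart} ?\<Omega> ?\<Upsilon> {std_chart} (inc j)"
    using S smooth_manifold_std su3_structure_exp cl th sL unfolding sl_minimal_class_def by blast
  then have "su3_mean_curvature ?\<Omega> ?\<Upsilon> std_chart (inc j) std_chart 0 = 0"
    unfolding minimal_def by (simp add: std_chart_simps)
  then have H: "mean_curvature (\<lambda>y. su3_metric (exp_Omega w m y) (exp_Upsilon w m y)) (inc j) 0 = 0"
    by (simp add: su3_mean_curvature_def std_chart_simps)
  interpret sl_patch "chart_img std_chart" "coord_dom std_chart (inc j) std_chart" "coord_rep std_chart (inc j) std_chart"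
      "exp_Omega w m" "exp_Upsilon w m" \<theta>
    by (rule sl_patch_chart[OF smooth_manifold_std su3_structure_exp sL]) auto
  have s: "0 \<in> coord_dom std_chart (inc j) std_chart" by (simp add: std_chart_simps)
  have inc0: "inc j 0 = 0" by (simp add: inc_def)
  have P: "P 1 0 = axis j 1" "P 2 0 = axis 2 1" "P 3 0 = axis 3 1"
    by (unfold P_def, unfold std_chart_simps frechet_derivative_inc inc_axis) (rule refl)+
  have G: "G = (\<lambda>y. su3_metric (exp_Omega w m y) (exp_Upsilon w m y))" by (simp add: fun_eq_iff G_def)
  have n: "G (coord_rep std_chart (inc j) std_chart 0) (axis m 1) (P i 0) = 0" for i
  proof -
    obtain v where v: "P i 0 = v" "v = axis j 1 \<or> v = axis 2 1 \<or> v = axis 3 1"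
      using exhaust_3[of i] P by metis
    show ?thesis
      unfolding v(1) G adapted_metric[OF adapted_exp] using v(2) j by (auto simp: inner_vec6 axis_def)
  qed
  have y: "coord_rep std_chart (inc j) std_chart 0 \<in> chart_img std_chart" by (rule FU[OF s])
  have "G (coord_rep std_chart (inc j) std_chart 0) (axis m 1) (mean_curvature G (coord_rep std_chart (inc j) std_chart) 0) = 0"
    using H linear_0[OF G_lin(2)[OF y]] by (simp add: G std_chart_simps)
  then have "ext_deriv \<phi> (coord_rep std_chart (inc j) std_chart 0) [axis m 1, P 1 0, P 2 0, P 3 0] = 0"
    using mean_curvature_variation[OF s n] by simp
  then show ?thesis
    unfolding ext_deriv_\<phi>[OF y] P by (simp add: std_chart_simps inc0)
qed

text \<open>The quantity that would have to vanish is the total weight of dx_123, or of dx_234 for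
  \<open>X2m\<close>: it is 2, 2 and 1 in the three examples.\<close>

lemma largest_class:
  assumes S: "sl_minimal_class TYPE(real^6) TYPE(real^3) S"
  shows "S \<subseteq> {X0p, X0m, X3, X4}"
proof -
  note S' = minimal_class_exp[OF S]
  have "X2p \<notin> S"
  proof
    assume "X2p \<in> S"
    from S'[OF class_exp_X2p[OF this], of 1 0] show False
      by (simp add: ext_deriv_Re_exp_Upsilon wA_def wedge_expand axis_def)
  qed
  moreover have "X2m \<notin> S"
  proof
    assume "X2m \<in> S"
    from S'[OF class_exp_X2m[OF this], of 4 "pi / 2"] show False
      by (simp add: ext_deriv_Im_exp_Upsilon wA_def wedge_expand axis_def)
  qed
  moreover have "X5 \<notin> S"
  proof
    assume "X5 \<in> S"
    from S'[OF class_exp_X5[OF this], of 1 0] show False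
      by (simp add: ext_deriv_Re_exp_Upsilon wB_def wedge_expand axis_def)
  qed
  ultimately have "x \<in> {X0p, X0m, X3, X4}" if "x \<in> S" for x
    using that by (cases x) auto
  then show ?thesis by blast
qed

text \<open>Maximality is tested on \<open>real^6\<close> and \<open>real^3\<close> because an
  arbitrary point type may be too small to carry a nonempty 6-manifold, and every class would then
  qualify vacuously.\<close>

theorem theorem2p19:
  shows
  "(\<forall>(M :: 'a topology) A \<Omega> \<Upsilon> \<tau>0 \<tau>0h \<tau>2 \<tau>2h \<tau>3 \<tau>4 \<tau>5 \<theta> (N :: 'b topology) B f.
      smooth_manifold M A \<longrightarrow> su3_structure A \<Omega> \<Upsilon> \<longrightarrow>
      torsion_forms A \<Omega> \<Upsilon> \<tau>0 \<tau>0h \<tau>2 \<tau>2h \<tau>3 \<tau>4 \<tau>5 \<longrightarrow>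
      0 \<le> \<theta> \<longrightarrow> \<theta> < 2 * pi \<longrightarrow> special_lagrangian M A \<Omega> \<Upsilon> \<theta> N B f \<longrightarrow>
      (\<forall>d\<in>B. \<forall>c\<in>A. \<forall>p\<in>fst d. f p \<in> fst c \<longrightarrow>
        (let y = snd c (f p) in
         \<forall>u. sl_adapted (\<Omega> c y) (\<Upsilon> c y) \<theta> (tangent_plane d f c (snd d p)) u \<longrightarrow>
           su3_mean_curvature \<Omega> \<Upsilon> d f c p =
             - ((1 / sqrt 2) * cos \<theta>) *\<^sub>R natural_iso u \<theta> (proj_Lambda28_1 u (\<tau>2 c y))
             - ((1 / sqrt 2) * sin \<theta>) *\<^sub>R natural_iso u \<theta> (proj_Lambda28_1 u (\<tau>2h c y))
             + sin (\<theta> / 3) *\<^sub>R section_iso u \<theta> (T_component u (\<tau>5 c y))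
             - cos (\<theta> / 3) *\<^sub>R section_iso u \<theta>
                 (pullback (su3_J (\<Omega> c y) (\<Upsilon> c y)) (N_component u (\<tau>5 c y))))))
   \<and> (sl_minimal_class TYPE('a) TYPE('b) {X0p, X0m, X3, X4}
      \<and> (\<forall>S. sl_minimal_class TYPE(real^6) TYPE(real^3) S \<longrightarrow> S \<subseteq> {X0p, X0m, X3, X4}))"
proof (intro conjI)
  show "\<forall>S. sl_minimal_class TYPE(real^6) TYPE(real^3) S \<longrightarrow> S \<subseteq> {X0p, X0m, X3, X4}"
    using largest_class by blast
qed (unfold Let_def, intro allI impI ballI, rule su3_mean_curvature_formula, assumption+,
    rule sl_minimal_class_torsion_free)

end
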